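(* Let $\chi$ be the cusp map and, for $\alpha\ge0$, let $C_\chi f=f\circ\chi$ act on the weighted Dirichlet space $\mathcal D^2_\alpha$. For every $\alpha\ge0$ there exist constants $b'_\alpha>b_\alpha>0$ depending only on $\alpha$, and constants $c,C>0$ (possibly depending on $\alpha$), such that: if $\alpha>0$, then for all $n\ge2$, $$c\,e^{-b'_\alpha\, n/\log n}\le a_n(C_\chi)\le C\,e^{-b_\alpha\, n/\log n};$$ if $\alpha=0$, then for all $n\ge1$, $$c\,e^{-b'_0\sqrt n}\le a_n(C_\chi)\le C\,e^{-b_0\sqrt n}.$$
   Context: $\mathbb D$ is the open unit disk of $\mathbb C$, $dA=dx\,dy/\pi$. For $\alpha>-1$, $\mathcal D^2_\alpha$ is the Hilbert space of analytic functions $f$ on $\mathbb D$ with $\|f\|^2_{\mathcal D^2_\alpha}=|f(0)|^2+(\alpha+1)\int_{\mathbb D}|f'(z)|^2(1-|z|^2)^\alpha\,dA(z)<\infty$. For a bounded operator $T$, $a_n(T)=\inf\{\|T-R\|:\operatorname{rank}R<n\}$. The cusp map $\chi\colon\mathbb D\to\mathbb D$ is defined as follows. Let $$\chi_0(z)=\frac{\big(\frac{z-i}{iz-1}\big)^{1/2}-i}{-i\big(\frac{z-i}{iz-1}\big)^{1/2}+1}$$ (principal square root; $z\mapsto\frac{z-i}{iz-1}$ maps $\mathbb D$ onto the upper half-plane); this is a conformal map of $\mathbb D$ onto the half-disk $\{z\in\mathbb D:\operatorname{Re}z>0\}$ with $\chi_0(1)=0$, $\chi_0(-1)=1$, $\chi_0(i)=-i$,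 $\chi_0(-i)=i$, $\chi_0(0)=\sqrt2-1$. Then put $\chi_1=\log\chi_0$ (principal logarithm), $\chi_2=-\frac2\pi\chi_1+1$, $\chi_3=a/\chi_2$ and $\chi=1-\chi_3$, where $a=1-\frac2\pi\log(\sqrt2-1)$, so that $\chi(0)=0$. The map $\chi$ is univalent and $C_\chi$ is bounded on $\mathcal D^2_\alpha$ for all $\alpha\ge0$. *)

theory Defs
  imports
    "HOL-Complex_Analysis.Complex_Analysis"
    "HOL-Library.Function_Algebras"
begin

global_interpretation cfun: vector_space "\<lambda>(c::complex) (f::complex \<Rightarrow> complex) z. c * f z"
  defines cfun_dim = cfun.dim and cfun_span = cfun.span
  by unfold_locales (auto simp: fun_eq_iff algebra_simps)

abbreviation unit_disk :: "complex set" where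
  "unit_disk \<equiv> ball 0 1"

definition dA :: "complex measure" where
  "dA = density lborel (\<lambda>_. ennreal (1 / pi))"

(* An analytic function on the disk is represented by its extension by 0 to the whole plane,
   so that equality in the space is plain equality of HOL functions. *)
definition dirichlet_space :: "real \<Rightarrow> (complex \<Rightarrow> complex) set" where
  "dirichlet_space \<alpha> =
     {f. f holomorphic_on unit_disk \<and> (\<forall>z. z \<notin> unit_disk \<longrightarrow> f z = 0) \<and>
         set_integrable dA unit_disk (\<lambda>z. (cmod (deriv f z))\<^sup>2 * (1 - (cmod z)\<^sup>2) powr \<alpha>)}"

definition dirichlet_norm :: "real \<Rightarrow> (complex \<Rightarrow> complex) \<Rightarrow> real" where
  "dirichlet_norm \<alpha> f =
     sqrt ((cmod (f 0))\<^sup>2 +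
       (\<alpha> + 1) * (LINT z:unit_disk|dA. (cmod (deriv f z))\<^sup>2 * (1 - (cmod z)\<^sup>2) powr \<alpha>))"

type_synonym operator = "(complex \<Rightarrow> complex) \<Rightarrow> (complex \<Rightarrow> complex)"

(* Operators are HOL functions on all of complex \<Rightarrow> complex; only their restriction to the
   Dirichlet space is relevant in this and the following definitions. *)
definition bounded_operator :: "real \<Rightarrow> operator \<Rightarrow> bool" where
  "bounded_operator \<alpha> T \<longleftrightarrow>
     T ` dirichlet_space \<alpha> \<subseteq> dirichlet_space \<alpha> \<and>
     (\<forall>f\<in>dirichlet_space \<alpha>. \<forall>g\<in>dirichlet_space \<alpha>. T (f + g) = T f + T g) \<and>
     (\<forall>c. \<forall>f\<in>dirichlet_space \<alpha>. T (\<lambda>z. c * f z) = (\<lambda>z. c * T f z)) \<and>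
     (\<exists>K. \<forall>f\<in>dirichlet_space \<alpha>. dirichlet_norm \<alpha> (T f) \<le> K * dirichlet_norm \<alpha> f)"

definition operator_norm :: "real \<Rightarrow> operator \<Rightarrow> real" where
  "operator_norm \<alpha> T =
     (SUP f\<in>{f \<in> dirichlet_space \<alpha>. dirichlet_norm \<alpha> f \<le> 1}. dirichlet_norm \<alpha> (T f))"

(* The finite-dimensionality of the range has to be required separately, because the dimension
   of an infinite-dimensional space is 0 by convention. *)
definition rank_less :: "real \<Rightarrow> operator \<Rightarrow> nat \<Rightarrow> bool" where
  "rank_less \<alpha> R n \<longleftrightarrow>
     (\<exists>B. finite B \<and> R ` dirichlet_space \<alpha> \<subseteq> cfun_span B) \<and>
     cfun_dim (R ` dirichlet_space \<alpha>) < n"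

(* Meaningful for n \<ge> 1 and bounded T. *)
definition approx_number :: "real \<Rightarrow> nat \<Rightarrow> operator \<Rightarrow> real" where
  "approx_number \<alpha> n T =
     (INF R\<in>{R. bounded_operator \<alpha> R \<and> rank_less \<alpha> R n}. operator_norm \<alpha> (T - R))"

definition composition_operator :: "(complex \<Rightarrow> complex) \<Rightarrow> operator" where
  "composition_operator \<phi> f = (\<lambda>z. if z \<in> unit_disk then f (\<phi> z) else 0)"

definition cusp_map0 :: "complex \<Rightarrow> complex" where
  "cusp_map0 z =
     (csqrt ((z - \<i>) / (\<i> * z - 1)) - \<i>) / (- \<i> * csqrt ((z - \<i>) / (\<i> * z - 1)) + 1)"

definition cusp_map1 :: "complex \<Rightarrow> complex" where
  "cusp_map1 z = Ln (cusp_map0 z)"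

definition cusp_map2 :: "complex \<Rightarrow> complex" where
  "cusp_map2 z = - complex_of_real (2 / pi) * cusp_map1 z + 1"

definition cusp_const :: real where
  "cusp_const = 1 - 2 / pi * ln (sqrt 2 - 1)"

definition cusp_map3 :: "complex \<Rightarrow> complex" where
  "cusp_map3 z = complex_of_real cusp_const / cusp_map2 z"

definition cusp_map :: "complex \<Rightarrow> complex" where
  "cusp_map z = 1 - cusp_map3 z"

end

theory Submission
  imports Defs "HOL-Real_Asymp.Real_Asymp"
begin

text \<open>
  Put \<open>w = \<chi> z\<close> and \<open>s = 1 - w\<close>. Since \<open>s = a / \<zeta>\<close> with \<open>\<zeta>\<close> in the half-strip \<open>Re \<zeta> > 1\<close>,
  \<open>\<bar>Im \<zeta>\<bar> < 1\<close>, the image of \<open>\<chi>\<close> is a cusp at 1 of width \<open>\<bar>s\<bar>\<^sup>2\<close>, its points have distance of order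
  \<open>\<bar>s\<bar>\<close> from the unit circle, and \<open>1 - \<bar>z\<bar>\<^sup>2\<close> is at most of order \<open>exp (- c / \<bar>s\<bar>)\<close>. By a change of
  variables the norm of \<open>f \<circ> \<chi>\<close> is an integral of \<open>\<bar>f'\<bar>\<^sup>2\<close> over the image, with the weight
  \<open>(1 - \<bar>z\<bar>\<^sup>2) powr \<alpha>\<close>.

  Upper bound: the part \<open>\<bar>s\<bar> \<ge> h\<close> of the image is covered by \<open>O(log (1/h))\<close> disks whose threefold
  dilations lie in the unit disk. If \<open>f'\<close> vanishes to order \<open>m\<close> at their centres, this part
  contributes at most \<open>O(log (1/h) 4^(-m))\<close>, while the rest contributes \<open>O(h)\<close> if \<open>\<alpha> = 0\<close> and
  \<open>O(exp (- c / h))\<close> if \<open>\<alpha> > 0\<close>. The choices \<open>h = exp (- sqrt n)\<close> and \<open>h = 1 / n\<close> balance the two.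
  The orthogonal projection enforcing the vanishing conditions is only needed on Taylor polynomials
  of large degree, where it is finite-dimensional linear algebra.

  Lower bound: an operator of rank less than \<open>n\<close> annihilates a combination of the \<open>n\<close> Lagrange
  interpolants, built from Blaschke factors, at hyperbolically equidistant nodes in \<open>[0, 1 - h]\<close>.
  Their norm is \<open>exp (O(n / log (1/h)))\<close> and point evaluations at the preimages of the nodes cost
  \<open>exp (O(\<alpha> / h))\<close>, both up to powers of \<open>n\<close> and \<open>1 / h\<close>; now \<open>h = exp (- sqrt n)\<close> if \<open>\<alpha> = 0\<close> and \<open>h = 1 / sqrt n\<close>
  if \<open>\<alpha> > 0\<close>.
\<close>

section \<open>Change of variables in the complex plane\<close>

text \<open>With about log (1/h) disks and m conditions at each centre, rank n leaves m of order n /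
  log (1/h); this quotient is the exponent in both directions. For \<alpha> > 0 the weight makes the
  tail so small that h may be a power of 1/n. For \<alpha> = 0 the weight gives nothing: what
  remains is the thinness of the cusp, |f'|^2 = O(|s|^-2) being integrated over a region of width
  O(|s|^2), and h must be exponentially small. In the lower bound the nodes are governed by a ratio
  q with q^n = h, so that 1 / (1 - q), which controls the cost of interpolation, is again of order n
  / log (1/h). That the image stays at distance of order |s| from the circle rests on a < 2. Only
  rates matter: squared norms are added with a factor 2 in place of the triangle inequality, and
  constants are not optimised. The degree of the Taylor polynomials does not enter the rank, so no
  control of its size is required.\<close>

definition vec_complex :: "real^2 \<Rightarrow> complex" where
  "vec_complex v = Complex (v $ 1) (v $ 2)"

definition complex_vec :: "complex \<Rightarrow> real^2" where
  "complex_vec z = vector [Re z, Im z]"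

lemma vec_complex_inverse [simp]: "complex_vec (vec_complex v) = v"
  by (simp add: vec_complex_def complex_vec_def vec_eq_iff forall_2)

lemma complex_vec_inverse [simp]: "vec_complex (complex_vec z) = z"
  by (simp add: vec_complex_def complex_vec_def)

lemma bounded_linear_vec_complex: "bounded_linear vec_complex"
  by (rule linear_conv_bounded_linear[THEN iffD1], rule linearI)
     (simp_all add: vec_complex_def complex_eq_iff)

lemma bounded_linear_complex_vec: "bounded_linear complex_vec"
  by (rule linear_conv_bounded_linear[THEN iffD1], rule linearI)
     (simp_all add: complex_vec_def vec_eq_iff forall_2)

lemma measurable_vec_complex [measurable]: "vec_complex \<in> borel_measurable borel"
  by (intro borel_measurable_continuous_onI linear_continuous_on bounded_linear_vec_complex)

lemma measurable_complex_vec [measurable]: "complex_vec \<in> borel_measurable borel"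
  by (intro borel_measurable_continuous_onI linear_continuous_on bounded_linear_complex_vec)

text \<open>Both measures agree on boxes. The detour through \<open>real^2\<close> is made because
  determinants, and with them the change of variables theorem, are stated there.\<close>

lemma distr_vec_complex: "distr lborel borel vec_complex = lborel"
proof (rule lborel_eqI[symmetric])
  fix l u :: complex
  assume le: "\<And>b. b \<in> Basis \<Longrightarrow> l \<bullet> b \<le> u \<bullet> b"
  have le': "Re l \<le> Re u" "Im l \<le> Im u"
    using le[of 1] le[of \<i>] by (auto simp: Basis_complex_def)
  have "vec_complex -` box l u = box (complex_vec l) (complex_vec u)"
    by (auto simp: mem_box_cart box_Complex_eq mem_box Basis_complex_def vec_complex_def complex_vec_def forall_2)
  moreover have "emeasure lborel (box (complex_vec l) (complex_vec u)) = ennreal ((Re u - Re l) * (Im u - Im l))"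
    using le' by (subst emeasure_lborel_box)
      (auto simp: Basis_vec_def complex_vec_def inner_axis UNIV_2 axis_eq_axis)
  ultimately show "emeasure (distr lborel borel vec_complex) (box l u) = (\<Prod>b\<in>Basis. (u - l) \<bullet> b)"
    by (simp add: emeasure_distr Basis_complex_def prod.insert)
qed simp

lemma nn_integral_vec_complex:
  assumes [measurable]: "f \<in> borel_measurable borel"
  shows "(\<integral>\<^sup>+z. f z \<partial>lborel) = (\<integral>\<^sup>+v. f (vec_complex v) \<partial>lborel)"
  by (subst distr_vec_complex[symmetric], subst nn_integral_distr) auto

text \<open>Bridge between two languages: the change of variables theorem speaks of absolute
  integrability and \<open>integral\<close>, everything else below of
  \<open>nn_integral\<close>.\<close>

lemma absolutely_integrable_on_iff_nn_integral:
  fixes k :: "'a::euclidean_space \<Rightarrow> real"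
  assumes [measurable]: "(\<lambda>x. indicator T x * k x) \<in> borel_measurable borel"
    and nn: "\<And>x. 0 \<le> k x"
  shows "k absolutely_integrable_on T \<longleftrightarrow> (\<integral>\<^sup>+x. ennreal (indicator T x * k x) \<partial>lborel) < \<infinity>"
    and "k absolutely_integrable_on T \<Longrightarrow>
      (\<integral>\<^sup>+x. ennreal (indicator T x * k x) \<partial>lborel) = ennreal (integral T k)"
proof -
  have nn': "0 \<le> indicator T x * k x" for x
    by (simp add: nn)
  have iff: "k absolutely_integrable_on T \<longleftrightarrow> integrable lborel (\<lambda>x. indicator T x * k x)"
    by (simp add: set_integrable_def integrable_completion)
  show "k absolutely_integrable_on T \<longleftrightarrow> (\<integral>\<^sup>+x. ennreal (indicator T x * k x) \<partial>lborel) < \<infinity>"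
    unfolding iff integrable_iff_bounded by (simp add: nn)
  assume *: "k absolutely_integrable_on T"
  have "(\<integral>\<^sup>+x. ennreal (indicator T x * k x) \<partial>lborel) = ennreal (\<integral>x. indicator T x * k x \<partial>lborel)"
    using * nn' by (intro nn_integral_eq_integral) (auto simp: iff)
  also have "(\<integral>x. indicator T x * k x \<partial>lborel) = (\<integral>x. indicator T x * k x \<partial>lebesgue)"
    by (subst integral_completion) auto
  also have "\<dots> = integral T k"
    using set_lebesgue_integral_eq_integral(2)[OF *] by (simp add: set_lebesgue_integral_def)
  finally show "(\<integral>\<^sup>+x. ennreal (indicator T x * k x) \<partial>lborel) = ennreal (integral T k)" .
qed

text \<open>With c = a + ib the matrix has rows (a, -b) and (b, a).\<close>

lemma det_matrix_complex_mult:
  "det (matrix (\<lambda>v. complex_vec (c * vec_complex v))) = (cmod c)\<^sup>2"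
  by (simp add: det_2 matrix_def complex_vec_def vec_complex_def axis_def cmod_power2)
     (simp add: power2_eq_square)

lemma borel_measurable_indicator_comp:
  fixes f :: "complex \<Rightarrow> real"
  assumes "open S" "continuous_on S g" and [measurable]: "f \<in> borel_measurable borel"
  shows "(\<lambda>z. indicator S z * f (g z)) \<in> borel_measurable borel"
proof -
  have "g \<in> borel_measurable (restrict_space borel S)"
    using assms by (intro borel_measurable_continuous_on_restrict)
  then have "(\<lambda>z. f (g z)) \<in> borel_measurable (restrict_space borel S)"
    by measurable
  then show ?thesis
    using assms(1) by (subst (asm) borel_measurable_restrict_space_iff) (auto simp: mult.commute)
qed

text \<open>By the Cauchy-Riemann equations the Jacobian of a holomorphic map is
  \<open>(cmod (deriv g z))\<^sup>2\<close>. The identity is one in \<open>ennreal\<close>, so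
  infinite integrals are included.\<close>

lemma nn_integral_holomorphic_image:
  fixes f :: "complex \<Rightarrow> real"
  assumes S: "open S" and g: "g holomorphic_on S" and inj: "inj_on g S"
    and f[measurable]: "f \<in> borel_measurable borel" and nn: "\<And>w. 0 \<le> f w"
  shows "(\<integral>\<^sup>+w. ennreal (indicator (g ` S) w * f w) \<partial>lborel) =
    (\<integral>\<^sup>+z. ennreal (indicator S z * ((cmod (deriv g z))\<^sup>2 * f (g z))) \<partial>lborel)"
proof -
  define V where "V = vec_complex -` S"
  define G where "G = (\<lambda>v. complex_vec (g (vec_complex v)))"
  define G' where "G' = (\<lambda>v h. complex_vec (deriv g (vec_complex v) * vec_complex h))"
  have V: "open V"
    unfolding V_def using S by (intro open_vimage linear_continuous_on bounded_linear_vec_complex)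
  have GV: "G ` V = vec_complex -` (g ` S)"
  proof -
    have "v \<in> G ` V" if "vec_complex v = g z" "z \<in> S" for v z
      by (rule image_eqI[of _ _ "complex_vec z"]) (use that in \<open>auto simp: G_def V_def that(1)[symmetric]\<close>)
    then show ?thesis
      by (auto simp: G_def V_def)
  qed
  have gS: "open (g ` S)"
    using open_mapping_thm3[OF g S inj] .
  have [measurable]: "S \<in> sets borel" "g ` S \<in> sets borel"
    using S gS by auto
  have der: "(G has_derivative G' v) (at v within V)" if "v \<in> V" for v
  proof -
    have "(g has_field_derivative deriv g (vec_complex v)) (at (vec_complex v))"
      using g S that by (auto simp: V_def intro: holomorphic_derivI)
    then have 1: "(g has_derivative (*) (deriv g (vec_complex v))) (at (vec_complex v))"
      by (simp add: has_field_derivative_def)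
    have 2: "(vec_complex has_derivative vec_complex) (at v)"
      by (rule bounded_linear_imp_has_derivative[OF bounded_linear_vec_complex])
    have 3: "(complex_vec has_derivative complex_vec) (at (g (vec_complex v)))"
      by (rule bounded_linear_imp_has_derivative[OF bounded_linear_complex_vec])
    have "(G has_derivative G' v) (at v)"
      using diff_chain_at[OF diff_chain_at[OF 2 1], of complex_vec complex_vec] 3
      by (simp add: G_def G'_def comp_def)
    then show ?thesis
      by (rule has_derivative_at_withinI)
  qed
  have injG: "inj_on G V"
  proof (rule inj_onI)
    fix v w assume "v \<in> V" "w \<in> V" "G v = G w"
    then have "g (vec_complex v) = g (vec_complex w)" "vec_complex v \<in> S" "vec_complex w \<in> S"
      by (metis G_def complex_vec_inverse, auto simp: V_def)
    then show "v = w"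
      using inj by (metis inj_on_def vec_complex_inverse)
  qed
  define k where "k = (\<lambda>v. f (vec_complex v))"
  have main: "(\<lambda>v. (cmod (deriv g (vec_complex v)))\<^sup>2 * k (G v)) absolutely_integrable_on V \<and>
      integral V (\<lambda>v. (cmod (deriv g (vec_complex v)))\<^sup>2 * k (G v)) = b \<longleftrightarrow>
      k absolutely_integrable_on (G ` V) \<and> integral (G ` V) k = b" for b
  proof -
    \<comment> \<open>The change of variables theorem is about vector-valued integrands; the scalar
      one is therefore wrapped as a vector in \<open>real^1\<close>.\<close>
    have *: "(\<lambda>x. \<bar>det (matrix (G' x))\<bar> *\<^sub>R (vec (k (G x)) :: real^1)) =
       (\<lambda>v. vec ((cmod (deriv g (vec_complex v)))\<^sup>2 * k (G v)))"
      by (simp add: G'_def det_matrix_complex_mult vec_eq_iff fun_eq_iff)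
    show ?thesis
      using has_absolute_integral_change_of_variables[of V G G' "\<lambda>v. vec (k v) :: real^1" "vec b"] V der injG
      unfolding *
      by (simp add: absolutely_integrable_on_1_iff integral_on_1_eq borel_open vec_eq_iff)
  qed
  have mcont: "continuous_on S (deriv g)" "continuous_on S g"
    using holomorphic_on_imp_continuous_on holomorphic_deriv[OF g S] g by blast+
  have m1[measurable]: "(\<lambda>z. indicator S z * ((cmod (deriv g z))\<^sup>2 * f (g z))) \<in> borel_measurable borel"
  proof -
    have [measurable]: "(\<lambda>z. indicator S z * (cmod (deriv g z))\<^sup>2) \<in> borel_measurable borel"
      using borel_measurable_indicator_comp[OF S mcont(1), of "\<lambda>z. (cmod z)\<^sup>2"] by simp
    have [measurable]: "(\<lambda>z. indicator S z * f (g z)) \<in> borel_measurable borel"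
      using borel_measurable_indicator_comp[OF S mcont(2) f] .
    have "(\<lambda>z. (indicator S z * (cmod (deriv g z))\<^sup>2) * (indicator S z * f (g z))) \<in> borel_measurable borel"
      by measurable
    moreover have "(\<lambda>z. (indicator S z * (cmod (deriv g z))\<^sup>2) * (indicator S z * f (g z))) =
        (\<lambda>z. indicator S z * ((cmod (deriv g z))\<^sup>2 * f (g z)))"
      by (auto simp: fun_eq_iff indicator_def)
    ultimately show ?thesis by simp
  qed
  have kG: "k (G v) = f (g (vec_complex v))" for v
    by (simp add: k_def G_def)
  have ind: "indicator V v = (indicator S (vec_complex v) :: real)"
      "indicator (G ` V) v = (indicator (g ` S) (vec_complex v) :: real)" for v
    unfolding GV by (auto simp: V_def indicator_def)
  have m2: "(\<lambda>v. indicator V v * ((cmod (deriv g (vec_complex v)))\<^sup>2 * k (G v))) \<in> borel_measurable borel"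
    unfolding ind kG using measurable_compose[OF measurable_vec_complex m1] by simp
  have m3: "(\<lambda>v. indicator (G ` V) v * k v) \<in> borel_measurable borel"
    unfolding ind k_def by measurable
  have e1: "(\<integral>\<^sup>+z. ennreal (indicator S z * ((cmod (deriv g z))\<^sup>2 * f (g z))) \<partial>lborel) =
     (\<integral>\<^sup>+v. ennreal (indicator V v * ((cmod (deriv g (vec_complex v)))\<^sup>2 * k (G v))) \<partial>lborel)"
    by (subst nn_integral_vec_complex) (auto simp: ind kG)
  have e2: "(\<integral>\<^sup>+w. ennreal (indicator (g ` S) w * f w) \<partial>lborel) =
     (\<integral>\<^sup>+v. ennreal (indicator (G ` V) v * k v) \<partial>lborel)"
    by (subst nn_integral_vec_complex) (auto simp: ind k_def)
  have knn: "0 \<le> k v" "0 \<le> (cmod (deriv g (vec_complex w)))\<^sup>2 * k (G w)" for v w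
    using nn by (auto simp: k_def)
  note A = absolutely_integrable_on_iff_nn_integral[OF m2 knn(2)]
  note B = absolutely_integrable_on_iff_nn_integral[OF m3 knn(1)]
  \<comment> \<open>Taking \<open>b\<close> to be the integral itself gives equality. Without
    integrability on one side, \<open>main\<close> transfers the failure to the other and both
    integrals are infinite.\<close>
  show ?thesis
  proof (cases "k absolutely_integrable_on (G ` V)")
    case True
    with main[of "integral (G ` V) k"] show ?thesis
      unfolding e1 e2 B(2)[OF True] by (subst A(2)) auto
  next
    case False
    moreover have "\<not> (\<lambda>v. (cmod (deriv g (vec_complex v)))\<^sup>2 * k (G v)) absolutely_integrable_on V"
      using False main by blast
    ultimately show ?thesis
      unfolding e1 e2 A(1) B(1) by (simp add: less_top[symmetric])
  qed
qed

section \<open>Weighted energies and power series\<close>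

lemma distr_rotation:
  assumes "cmod \<omega> = 1"
  shows "distr lborel borel ((*) \<omega>) = lborel"
proof (rule measure_eqI)
  fix A assume "A \<in> sets (distr lborel borel ((*) \<omega>))"
  then have A[measurable]: "A \<in> sets borel" by simp
  have \<omega>: "\<omega> \<noteq> 0" using assms by auto
  have surj: "range ((*) \<omega>) = UNIV"
  proof -
    have "x \<in> range ((*) \<omega>)" for x
      by (rule image_eqI[of _ _ "x / \<omega>"]) (use \<omega> in auto)
    then show ?thesis by auto
  qed
  have "emeasure lborel A = (\<integral>\<^sup>+w. ennreal (indicator (range ((*) \<omega>)) w * indicator A w) \<partial>lborel)"
    unfolding surj by (simp add: ennreal_indicator)
  also have "\<dots> = (\<integral>\<^sup>+z. ennreal (indicator UNIV z * ((cmod (deriv ((*) \<omega>) z))\<^sup>2 * indicator A (\<omega> * z))) \<partial>lborel)"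
    by (rule nn_integral_holomorphic_image) (use \<omega> in \<open>auto intro!: holomorphic_intros inj_onI\<close>)
  also have "\<dots> = (\<integral>\<^sup>+z. indicator ((*) \<omega> -` A) z \<partial>lborel)"
    using assms by (intro nn_integral_cong) (auto simp: indicator_def)
  also have "\<dots> = emeasure lborel ((*) \<omega> -` A)"
    by (rule nn_integral_indicator) (use measurable_sets[of "(*) \<omega>" borel borel A] in auto)
  finally show "emeasure (distr lborel borel ((*) \<omega>)) A = emeasure lborel A"
    by (simp add: emeasure_distr)
qed simp

text \<open>Here \<open>g\<close> plays the part of f'. The factors \<alpha> + 1 and 1 / pi of the
  Dirichlet norm are left out and return in \<open>dirichlet_norm_sq\<close>. Values in
  \<open>ennreal\<close> spare side conditions on integrability.\<close>

definition energy :: "real \<Rightarrow> complex set \<Rightarrow> (complex \<Rightarrow> complex) \<Rightarrow> ennreal" where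
  "energy \<alpha> S g = (\<integral>\<^sup>+z. ennreal (indicator S z * ((cmod (g z))\<^sup>2 * (1 - (cmod z)\<^sup>2) powr \<alpha>)) \<partial>lborel)"

lemma energy_cong:
  "(\<And>z. z \<in> S \<Longrightarrow> g z = h z) \<Longrightarrow> energy \<alpha> S g = energy \<alpha> S h"
  unfolding energy_def by (intro nn_integral_cong) (auto simp: indicator_def)

lemma energy_mono_set: "S \<subseteq> T \<Longrightarrow> energy \<alpha> S g \<le> energy \<alpha> T g"
  unfolding energy_def by (intro nn_integral_mono ennreal_leI mult_right_mono)
    (auto simp: indicator_def)

lemma energy_measurable:
  assumes "S \<in> sets borel" "S \<subseteq> unit_disk" "continuous_on unit_disk g"
  shows "(\<lambda>z. indicator S z * ((cmod (g z))\<^sup>2 * (1 - (cmod z)\<^sup>2) powr \<alpha>)) \<in> borel_measurable borel"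
proof -
  note [measurable] = assms(1)
  have [measurable]: "(\<lambda>z. indicator unit_disk z * (cmod (g z))\<^sup>2) \<in> borel_measurable borel"
    using borel_measurable_indicator_comp[OF open_ball assms(3), of "\<lambda>z. (cmod z)\<^sup>2"] by simp
  have "(\<lambda>z. indicator S z * ((indicator unit_disk z * (cmod (g z))\<^sup>2) * (1 - (cmod z)\<^sup>2) powr \<alpha>)) \<in> borel_measurable borel"
    by measurable
  moreover have "(\<lambda>z. indicator S z * ((indicator unit_disk z * (cmod (g z))\<^sup>2) * (1 - (cmod z)\<^sup>2) powr \<alpha>)) =
      (\<lambda>z. indicator S z * ((cmod (g z))\<^sup>2 * (1 - (cmod z)\<^sup>2) powr \<alpha>))"
    using assms(2) by (auto simp: fun_eq_iff indicator_def)
  ultimately show ?thesis by simp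
qed

lemma energy_measurable_ennreal:
  assumes "S \<in> sets borel" "S \<subseteq> unit_disk" "continuous_on unit_disk g"
  shows "(\<lambda>z. ennreal (indicator S z * ((cmod (g z))\<^sup>2 * (1 - (cmod z)\<^sup>2) powr \<alpha>))) \<in> borel_measurable lborel"
  using measurable_compose[OF energy_measurable[OF assms] measurable_ennreal] by simp

lemma weight_le_1: "\<alpha> \<ge> 0 \<Longrightarrow> z \<in> unit_disk \<Longrightarrow> (1 - (cmod z)\<^sup>2) powr \<alpha> \<le> 1"
  by (rule powr_le1) (auto simp: power_le_one abs_square_le_1)

lemma integrable_weighted:
  fixes h :: "complex \<Rightarrow> complex"
  assumes \<alpha>: "\<alpha> \<ge> 0" and \<rho>: "\<rho> \<le> 1" and h: "continuous_on UNIV h"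
  shows "integrable lborel (\<lambda>z. (indicator (ball 0 \<rho>) z * (1 - (cmod z)\<^sup>2) powr \<alpha>) *\<^sub>R h z)"
proof -
  obtain B where B: "\<And>z. z \<in> cball 0 1 \<Longrightarrow> norm (h z) \<le> B"
    using compact_continuous_image[OF continuous_on_subset[OF h subset_UNIV] compact_cball, of 0 1]
    by (meson bounded_iff compact_imp_bounded image_eqI)
  have [measurable]: "h \<in> borel_measurable borel"
    using h by (rule borel_measurable_continuous_onI)
  have bd: "norm ((indicator (ball 0 \<rho>) z * (1 - (cmod z)\<^sup>2) powr \<alpha>) *\<^sub>R h z) \<le> B" if z: "z \<in> ball 0 \<rho>" for z
  proof -
    have "z \<in> unit_disk" using z \<rho> by auto
    then have "(1 - (cmod z)\<^sup>2) powr \<alpha> * norm (h z) \<le> 1 * B"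
      using B[of z] weight_le_1[OF \<alpha>, of z] by (intro mult_mono) auto
    then show ?thesis using z by simp
  qed
  have [measurable]: "ball (0::complex) \<rho> \<in> sets borel" by simp
  have "(\<lambda>z. (indicator (ball 0 \<rho>) z * (1 - (cmod z)\<^sup>2) powr \<alpha>) *\<^sub>R h z) \<in> borel_measurable lborel"
    by measurable
  then show ?thesis
    by (rule integrableI_bounded_set[of "ball 0 \<rho>" _ _ B, rotated])
       (use bd emeasure_lborel_ball_finite[of "0::complex" \<rho>] in \<open>simp_all add: less_top[symmetric]\<close>)
qed

lemma measurable_cnj [measurable]: "cnj \<in> borel_measurable borel"
  by (intro borel_measurable_continuous_onI continuous_intros)

text \<open>A rotation by \<theta> preserves the measure, the disk and the weight, and multiplies
  the integrand by exp (i (j - k) \<theta>). For \<theta> = pi / (j - k) this factor is -1, so the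
  integral equals its own negative.\<close>

lemma monomial_orthogonal:
  assumes "j \<noteq> k"
  shows "(\<integral>z. (indicator (ball 0 \<rho>) z * (1 - (cmod z)\<^sup>2) powr \<alpha>) *\<^sub>R (z ^ j * cnj z ^ k) \<partial>lborel) = 0"
    (is "integral\<^sup>L lborel ?F = 0")
proof -
  define \<theta> where "\<theta> = pi / (real j - real k)"
  define \<omega> where "\<omega> = cis \<theta>"
  have "\<omega> ^ j * cnj \<omega> ^ k = cis (real j * \<theta>) * cis (- (real k * \<theta>))"
    unfolding \<omega>_def cis_cnj by (simp only: Complex.DeMoivre mult_minus_right)
  also have "\<dots> = cis ((real j - real k) * \<theta>)"
    by (simp add: cis_mult algebra_simps)
  also have "\<dots> = -1"
    using assms by (simp add: \<theta>_def complex_eq_iff)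
  finally have m1: "\<omega> ^ j * cnj \<omega> ^ k = -1" .
  have n1: "cmod \<omega> = 1" by (simp add: \<omega>_def)
  have "integral\<^sup>L lborel ?F = integral\<^sup>L (distr lborel borel ((*) \<omega>)) ?F"
    by (simp add: distr_rotation n1)
  also have "\<dots> = (\<integral>z. ?F (\<omega> * z) \<partial>lborel)"
  proof (rule integral_distr)
    have [measurable]: "ball (0::complex) \<rho> \<in> sets borel" by simp
    show "?F \<in> borel_measurable borel" by measurable
  qed auto
  also have "\<dots> = (\<integral>z. - ?F z \<partial>lborel)"
  proof (rule Bochner_Integration.integral_cong[OF refl])
    fix z
    have "(\<omega> * z) ^ j * cnj (\<omega> * z) ^ k = (\<omega> ^ j * cnj \<omega> ^ k) * (z ^ j * cnj z ^ k)"
      by (simp add: power_mult_distrib)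
    also have "\<dots> = - (z ^ j * cnj z ^ k)" by (simp add: m1)
    finally show "?F (\<omega> * z) = - ?F z"
      using n1 by (simp add: norm_mult indicator_def)
  qed
  also have "\<dots> = - integral\<^sup>L lborel ?F" by simp
  finally show ?thesis by simp
qed

lemma energy_eq_integral:
  assumes \<alpha>: "\<alpha> \<ge> 0" and \<rho>: "\<rho> \<le> 1" and h: "continuous_on UNIV h"
  shows "energy \<alpha> (ball 0 \<rho>) h =
    ennreal (Re (\<integral>z. (indicator (ball 0 \<rho>) z * (1 - (cmod z)\<^sup>2) powr \<alpha>) *\<^sub>R (h z * cnj (h z)) \<partial>lborel))"
proof -
  let ?F = "\<lambda>z. (indicator (ball 0 \<rho>) z * (1 - (cmod z)\<^sup>2) powr \<alpha>) *\<^sub>R (h z * cnj (h z))"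
  have int: "integrable lborel ?F"
    using h by (intro integrable_weighted \<alpha> \<rho> continuous_intros)
  have eq: "Re (?F z) = indicator (ball 0 \<rho>) z * ((cmod (h z))\<^sup>2 * (1 - (cmod z)\<^sup>2) powr \<alpha>)" for z
    by (simp add: cmod_power2) (simp add: power2_eq_square)
  have "energy \<alpha> (ball 0 \<rho>) h = (\<integral>\<^sup>+z. ennreal (Re (?F z)) \<partial>lborel)"
    unfolding energy_def eq ..
  also have "\<dots> = ennreal (\<integral>z. Re (?F z) \<partial>lborel)"
    by (rule nn_integral_eq_integral[OF integrable_Re[OF int]]) (auto simp: eq simp del: scaleR_complex.sel)
  also have "(\<integral>z. Re (?F z) \<partial>lborel) = Re (integral\<^sup>L lborel ?F)"
    by (rule integral_Re[OF int])
  finally show ?thesis .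
qed

text \<open>The square of the sum is expanded into a double sum, of which orthogonality leaves the
  diagonal.\<close>

lemma energy_polynomial:
  assumes \<alpha>: "\<alpha> \<ge> 0" and \<rho>: "\<rho> \<le> 1"
  shows "energy \<alpha> (ball 0 \<rho>) (\<lambda>z. \<Sum>k<M. a k * z ^ k) =
    (\<Sum>k<M. ennreal ((cmod (a k))\<^sup>2) * energy \<alpha> (ball 0 \<rho>) (\<lambda>z. z ^ k))"
proof -
  let ?w = "\<lambda>z. indicator (ball 0 \<rho>) z * (1 - (cmod z)\<^sup>2) powr \<alpha> :: real"
  let ?I = "\<lambda>j k. \<integral>z. ?w z *\<^sub>R (z ^ j * cnj z ^ k) \<partial>lborel"
  have int: "integrable lborel (\<lambda>z. ?w z *\<^sub>R (z ^ j * cnj z ^ k))" for j k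
    by (intro integrable_weighted \<alpha> \<rho> continuous_intros)
  have "(\<integral>z. ?w z *\<^sub>R ((\<Sum>k<M. a k * z ^ k) * cnj (\<Sum>k<M. a k * z ^ k)) \<partial>lborel) =
      (\<integral>z. (\<Sum>j<M. \<Sum>k<M. (a j * cnj (a k)) * (?w z *\<^sub>R (z ^ j * cnj z ^ k))) \<partial>lborel)"
    by (intro Bochner_Integration.integral_cong)
       (simp_all add: sum_product scaleR_conv_of_real sum_distrib_left sum_distrib_right mult_ac,
        subst sum.swap, simp)
  also have "\<dots> = (\<Sum>j<M. \<Sum>k<M. (a j * cnj (a k)) * ?I j k)"
  proof -
    have "integrable lborel (\<lambda>z. a j * cnj (a k) * (?w z *\<^sub>R (z ^ j * cnj z ^ k)))" for j k
      by (intro integrable_mult_right int)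
    then show ?thesis
      by (simp add: Bochner_Integration.integral_sum Bochner_Integration.integrable_sum del: mult_scaleR_right)
  qed
  also have "\<dots> = (\<Sum>j<M. \<Sum>k<M. if k = j then (a j * cnj (a j)) * ?I j j else 0)"
    by (intro sum.cong refl) (auto simp: monomial_orthogonal)
  also have "\<dots> = (\<Sum>j<M. (a j * cnj (a j)) * ?I j j)"
    by (simp add: sum.delta)
  finally have 1: "(\<integral>z. ?w z *\<^sub>R ((\<Sum>k<M. a k * z ^ k) * cnj (\<Sum>k<M. a k * z ^ k)) \<partial>lborel) =
      (\<Sum>j<M. of_real ((cmod (a j))\<^sup>2) * ?I j j)"
    by (simp only: complex_norm_square)
  have 2: "energy \<alpha> (ball 0 \<rho>) (\<lambda>z. z ^ k) = ennreal (Re (?I k k))" for k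
    by (subst energy_eq_integral[OF \<alpha> \<rho>]) (auto intro!: continuous_intros)
  have 3: "0 \<le> Re (?I k k)" for k
  proof -
    have "Re (?I k k) = (\<integral>z. Re (?w z *\<^sub>R (z ^ k * cnj z ^ k)) \<partial>lborel)"
      by (rule integral_Re[symmetric, OF int])
    also have "\<dots> \<ge> 0"
    proof (rule Bochner_Integration.integral_nonneg)
      fix z :: complex
      have "z ^ k * cnj z ^ k = of_real ((cmod (z ^ k))\<^sup>2)"
        by (simp only: complex_norm_square complex_cnj_power)
      then show "0 \<le> Re (?w z *\<^sub>R (z ^ k * cnj z ^ k))"
        by simp
    qed
    finally show ?thesis .
  qed
  have "energy \<alpha> (ball 0 \<rho>) (\<lambda>z. \<Sum>k<M. a k * z ^ k) = ennreal (\<Sum>j<M. (cmod (a j))\<^sup>2 * Re (?I j j))"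
    unfolding energy_eq_integral[OF \<alpha> \<rho> continuous_on_sum[OF continuous_on_mult[OF continuous_on_const continuous_on_power[OF continuous_on_id]]]] 1
    by (simp del: of_real_power)
  also have "\<dots> = (\<Sum>j<M. ennreal ((cmod (a j))\<^sup>2 * Re (?I j j)))"
    by (rule sum_ennreal[symmetric]) (use 3 in auto)
  also have "\<dots> = (\<Sum>j<M. ennreal ((cmod (a j))\<^sup>2) * energy \<alpha> (ball 0 \<rho>) (\<lambda>z. z ^ j))"
    using 3 by (simp add: 2 ennreal_mult)
  finally show ?thesis .
qed

text \<open>On the smaller disk the partial sums \<open>P M\<close> are uniformly bounded, so their
  energies converge to that of \<open>g\<close> by dominated convergence; for
  \<open>M \<ge> N\<close> each of them is at least the sum over the first \<open>N\<close>
  terms.\<close>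

lemma bessel_smaller_disk:
  assumes \<alpha>: "\<alpha> \<ge> 0" and \<rho>: "0 < \<rho>" "\<rho> < 1" and g: "g holomorphic_on unit_disk"
  defines "a \<equiv> \<lambda>k. (deriv ^^ k) g 0 / fact k"
  shows "(\<Sum>k<N. ennreal ((cmod (a k))\<^sup>2) * energy \<alpha> (ball 0 \<rho>) (\<lambda>z. z ^ k)) \<le> energy \<alpha> (ball 0 \<rho>) g"
proof -
  \<comment> \<open>A radius strictly between \<rho> and 1: convergence of the series at
    \<open>r\<close> gives absolute convergence at \<rho>.\<close>
  define r where "r = (1 + \<rho>) / 2"
  have r: "\<rho> < r" "r < 1" "0 < r" using \<rho> by (auto simp: r_def)
  have ser: "(\<lambda>n. a n * z ^ n) sums g z" if "z \<in> unit_disk" for z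
    using holomorphic_power_series[OF g that] by (simp add: a_def)
  have "summable (\<lambda>n. norm (a n * of_real \<rho> ^ n))"
    by (rule powser_insidea[OF sums_summable[OF ser[of "of_real r"]]]) (use r \<rho> in auto)
  then have sm: "summable (\<lambda>n. cmod (a n) * \<rho> ^ n)"
    using \<rho> by (simp add: norm_mult norm_power)
  define B where "B = (\<Sum>n. cmod (a n) * \<rho> ^ n)"
  define P where "P = (\<lambda>M z. \<Sum>k<M. a k * z ^ k)"
  have PB: "cmod (P M z) \<le> B" if "z \<in> ball 0 \<rho>" for M z
  proof -
    have "cmod (P M z) \<le> (\<Sum>k<M. cmod (a k) * \<rho> ^ k)"
      unfolding P_def using that
      by (intro order_trans[OF norm_sum] sum_mono) (auto simp: norm_mult norm_power intro!: mult_left_mono power_mono)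
    also have "\<dots> \<le> B"
      unfolding B_def using sm \<rho> by (intro sum_le_suminf) auto
    finally show ?thesis .
  qed
  have sub: "ball 0 \<rho> \<subseteq> unit_disk" using \<rho> by auto
  have [measurable]: "ball (0::complex) \<rho> \<in> sets borel" by simp
  have "(\<lambda>M. energy \<alpha> (ball 0 \<rho>) (P M)) \<longlonglongrightarrow> energy \<alpha> (ball 0 \<rho>) g"
    unfolding energy_def
  proof (rule nn_integral_dominated_convergence[where w = "\<lambda>z. ennreal (indicator (ball 0 \<rho>) z * B\<^sup>2)"])
    show "(\<lambda>z. ennreal (indicator (ball 0 \<rho>) z * ((cmod (P M z))\<^sup>2 * (1 - (cmod z)\<^sup>2) powr \<alpha>))) \<in> borel_measurable lborel" for M
      unfolding P_def using sub
      by (intro energy_measurable_ennreal continuous_intros) auto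
    show "(\<lambda>z. ennreal (indicator (ball 0 \<rho>) z * ((cmod (g z))\<^sup>2 * (1 - (cmod z)\<^sup>2) powr \<alpha>))) \<in> borel_measurable lborel"
      using energy_measurable[of "ball 0 \<rho>" g \<alpha>] sub holomorphic_on_imp_continuous_on[OF g] by auto
    have "(\<integral>\<^sup>+z. ennreal (indicator (ball 0 \<rho>) z * B\<^sup>2) \<partial>(lborel::complex measure)) = ennreal (B\<^sup>2) * emeasure lborel (ball (0::complex) \<rho>)"
      by (subst nn_integral_cmult_indicator[symmetric]) (auto intro!: nn_integral_cong simp: indicator_def)
    also have "\<dots> < \<infinity>"
      using emeasure_lborel_ball_finite[of "0::complex" \<rho>] by (simp add: ennreal_mult_less_top)
    finally show "(\<integral>\<^sup>+z. ennreal (indicator (ball 0 \<rho>) z * B\<^sup>2) \<partial>(lborel::complex measure)) < \<infinity>" .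
    show "AE z in lborel. ennreal (indicator (ball 0 \<rho>) z * ((cmod (P M z))\<^sup>2 * (1 - (cmod z)\<^sup>2) powr \<alpha>))
        \<le> ennreal (indicator (ball 0 \<rho>) z * B\<^sup>2)" for M
    proof (intro AE_I2 ennreal_leI)
      fix z :: complex
      have "(cmod (P M z))\<^sup>2 * (1 - (cmod z)\<^sup>2) powr \<alpha> \<le> B\<^sup>2 * 1" if "z \<in> ball 0 \<rho>"
        using PB[OF that] weight_le_1[OF \<alpha>, of z] sub that by (intro mult_mono power_mono) auto
      then show "indicator (ball 0 \<rho>) z * ((cmod (P M z))\<^sup>2 * (1 - (cmod z)\<^sup>2) powr \<alpha>) \<le> indicator (ball 0 \<rho>) z * B\<^sup>2"
        by (auto simp: indicator_def)
    qed
    show "AE z in lborel. (\<lambda>M. ennreal (indicator (ball 0 \<rho>) z * ((cmod (P M z))\<^sup>2 * (1 - (cmod z)\<^sup>2) powr \<alpha>)))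
       \<longlonglongrightarrow> ennreal (indicator (ball 0 \<rho>) z * ((cmod (g z))\<^sup>2 * (1 - (cmod z)\<^sup>2) powr \<alpha>))"
    proof (rule AE_I2)
      fix z :: complex
      show "(\<lambda>M. ennreal (indicator (ball 0 \<rho>) z * ((cmod (P M z))\<^sup>2 * (1 - (cmod z)\<^sup>2) powr \<alpha>)))
       \<longlonglongrightarrow> ennreal (indicator (ball 0 \<rho>) z * ((cmod (g z))\<^sup>2 * (1 - (cmod z)\<^sup>2) powr \<alpha>))"
      proof (cases "z \<in> ball 0 \<rho>")
        case True
        then have "(\<lambda>M. P M z) \<longlonglongrightarrow> g z"
          using ser[of z] sub by (auto simp: sums_def P_def)
        then show ?thesis
          by (intro tendsto_ennrealI tendsto_intros)
      qed auto
    qed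
  qed measurable
  moreover have "(\<Sum>k<N. ennreal ((cmod (a k))\<^sup>2) * energy \<alpha> (ball 0 \<rho>) (\<lambda>z. z ^ k)) \<le> energy \<alpha> (ball 0 \<rho>) (P M)"
    if "M \<ge> N" for M
    unfolding P_def using that \<rho> by (subst energy_polynomial[OF \<alpha>]) (auto intro!: sum_mono2)
  ultimately show ?thesis
    by (intro tendsto_lowerbound[of _ _ sequentially]) (auto simp: eventually_sequentially)
qed

text \<open>The smaller disks increase to the unit disk. Only the energies of the monomials have to
  converge, which is monotone convergence; on the right the energy of \<open>g\<close> is simply
  bounded by that on the whole disk.\<close>

lemma bessel:
  assumes \<alpha>: "\<alpha> \<ge> 0" and g: "g holomorphic_on unit_disk"
  shows "(\<Sum>k<N. ennreal ((cmod ((deriv ^^ k) g 0 / fact k))\<^sup>2) * energy \<alpha> unit_disk (\<lambda>z. z ^ k))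
    \<le> energy \<alpha> unit_disk g"
proof -
  define \<rho> where "\<rho> = (\<lambda>n. 1 - 1 / real (n + 2))"
  have \<rho>: "0 < \<rho> n" "\<rho> n < 1" for n
    by (auto simp: \<rho>_def field_simps)
  have inc: "\<rho> m \<le> \<rho> n" if "m \<le> n" for m n
    using that by (auto simp: \<rho>_def field_simps)
  have lim1: "\<rho> \<longlonglongrightarrow> 1"
    unfolding \<rho>_def by real_asymp
  have lim: "(\<lambda>n. energy \<alpha> (ball 0 (\<rho> n)) (\<lambda>z. z ^ k)) \<longlonglongrightarrow> energy \<alpha> unit_disk (\<lambda>z. z ^ k)" for k
    unfolding energy_def
  proof (rule nn_integral_LIMSEQ)
    show "incseq (\<lambda>n z. ennreal (indicator (ball 0 (\<rho> n)) z * ((cmod (z ^ k))\<^sup>2 * (1 - (cmod z)\<^sup>2) powr \<alpha>)))"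
    proof (intro incseq_SucI le_funI ennreal_leI mult_right_mono)
      fix n and z :: complex
      have "ball 0 (\<rho> n) \<subseteq> ball (0::complex) (\<rho> (Suc n))"
        using inc by (intro subset_ball) auto
      then show "indicator (ball 0 (\<rho> n)) z \<le> (indicator (ball 0 (\<rho> (Suc n))) z :: real)"
        by (auto simp: indicator_def)
    qed auto
    show "(\<lambda>n. ennreal (indicator (ball 0 (\<rho> n)) z * ((cmod (z ^ k))\<^sup>2 * (1 - (cmod z)\<^sup>2) powr \<alpha>)))
         \<longlonglongrightarrow> ennreal (indicator unit_disk z * ((cmod (z ^ k))\<^sup>2 * (1 - (cmod z)\<^sup>2) powr \<alpha>))" for z
    proof (rule tendsto_eventually)
      show "\<forall>\<^sub>F n in sequentially. ennreal (indicator (ball 0 (\<rho> n)) z * ((cmod (z ^ k))\<^sup>2 * (1 - (cmod z)\<^sup>2) powr \<alpha>)) =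
         ennreal (indicator unit_disk z * ((cmod (z ^ k))\<^sup>2 * (1 - (cmod z)\<^sup>2) powr \<alpha>))"
      proof (cases "cmod z < 1")
        case True
        then have "\<forall>\<^sub>F n in sequentially. \<rho> n > cmod z"
          by (rule order_tendstoD[OF lim1])
        then show ?thesis
          by eventually_elim (use True in \<open>auto simp: indicator_def\<close>)
      next
        case False
        then have "z \<notin> ball 0 (\<rho> n)" for n
          using \<rho>(2)[of n] by auto
        then show ?thesis using False by (simp add: indicator_def)
      qed
    qed
    show "(\<lambda>z. ennreal (indicator (ball 0 (\<rho> n)) z * ((cmod (z ^ k))\<^sup>2 * (1 - (cmod z)\<^sup>2) powr \<alpha>))) \<in> borel_measurable lborel" for n
      using \<rho>[of n] by (intro energy_measurable_ennreal continuous_intros) auto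
  qed
  have "(\<lambda>n. \<Sum>k<N. ennreal ((cmod ((deriv ^^ k) g 0 / fact k))\<^sup>2) * energy \<alpha> (ball 0 (\<rho> n)) (\<lambda>z. z ^ k))
     \<longlonglongrightarrow> (\<Sum>k<N. ennreal ((cmod ((deriv ^^ k) g 0 / fact k))\<^sup>2) * energy \<alpha> unit_disk (\<lambda>z. z ^ k))"
    by (intro tendsto_sum ennreal_tendsto_cmult lim) auto
  moreover have "(\<Sum>k<N. ennreal ((cmod ((deriv ^^ k) g 0 / fact k))\<^sup>2) * energy \<alpha> (ball 0 (\<rho> n)) (\<lambda>z. z ^ k))
      \<le> energy \<alpha> unit_disk g" for n
    using bessel_smaller_disk[OF \<alpha> \<rho> g] energy_mono_set[of "ball 0 (\<rho> n)" unit_disk \<alpha> g] \<rho>[of n]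
    by (meson less_imp_le order_trans subset_ball)
  ultimately show ?thesis
    by (intro LIMSEQ_le_const2) auto
qed

text \<open>After an affine map this is \<open>bessel\<close> with exponent 0 and the single term k
  = 0, where the energy of the constant 1 is pi.\<close>

lemma area_mean_value:
  assumes r: "r > 0" and g: "g holomorphic_on ball c r"
  shows "ennreal ((cmod (g c))\<^sup>2 * (pi * r\<^sup>2)) \<le> (\<integral>\<^sup>+z. ennreal (indicator (ball c r) z * (cmod (g z))\<^sup>2) \<partial>lborel)"
proof -
  define A where "A = (\<lambda>z. c + of_real r * z)"
  have AI: "A ` unit_disk = ball c r"
  proof -
    have "z \<in> A ` unit_disk" if "z \<in> ball c r" for z
      by (rule image_eqI[of _ _ "(z - c) / of_real r"])
         (use r that in \<open>auto simp: A_def norm_divide dist_norm norm_minus_commute\<close>)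
    moreover have "A z \<in> ball c r" if "z \<in> unit_disk" for z
      using that r by (auto simp: A_def dist_norm norm_mult)
    ultimately show ?thesis by auto
  qed
  have hA: "A holomorphic_on unit_disk" unfolding A_def by (intro holomorphic_intros)
  have gA: "(\<lambda>z. g (A z)) holomorphic_on unit_disk"
    using holomorphic_on_compose_gen[OF hA g] AI by (auto simp: comp_def)
  have inj: "inj_on A unit_disk" using r by (auto simp: A_def inj_on_def)
  have dA: "deriv A z = of_real r" for z
    unfolding A_def by (rule DERIV_imp_deriv) (auto intro!: derivative_eq_intros)
  define f where "f = (\<lambda>z. indicator (ball c r) z * (cmod (g z))\<^sup>2)"
  have f: "f \<in> borel_measurable borel"
    unfolding f_def using borel_measurable_indicator_comp[OF open_ball holomorphic_on_imp_continuous_on[OF g], of "\<lambda>z. (cmod z)\<^sup>2"] by simp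
  have "(\<integral>\<^sup>+z. ennreal (indicator (ball c r) z * (cmod (g z))\<^sup>2) \<partial>lborel) = (\<integral>\<^sup>+w. ennreal (indicator (A ` unit_disk) w * f w) \<partial>lborel)"
    unfolding AI f_def by (intro nn_integral_cong) (auto simp: indicator_def)
  also have "\<dots> = (\<integral>\<^sup>+z. ennreal (indicator unit_disk z * ((cmod (deriv A z))\<^sup>2 * f (A z))) \<partial>lborel)"
    by (rule nn_integral_holomorphic_image[OF _ hA inj f]) (auto simp: f_def)
  also have "\<dots> = (\<integral>\<^sup>+z. ennreal (r\<^sup>2) * ennreal (indicator unit_disk z * ((cmod (g (A z)))\<^sup>2 * (1 - (cmod z)\<^sup>2) powr 0)) \<partial>lborel)"
  proof (intro nn_integral_cong)
    fix z :: complex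
    show "ennreal (indicator unit_disk z * ((cmod (deriv A z))\<^sup>2 * f (A z))) = ennreal (r\<^sup>2) * ennreal (indicator unit_disk z * ((cmod (g (A z)))\<^sup>2 * (1 - (cmod z)\<^sup>2) powr 0))"
    proof (cases "z \<in> unit_disk")
      case True
      then have "(cmod z)\<^sup>2 < 1" by (simp add: abs_square_less_1)
      moreover have "A z \<in> ball c r" using True AI by auto
      ultimately show ?thesis using True by (simp add: dA f_def ennreal_mult)
    qed auto
  qed
  also have "\<dots> = ennreal (r\<^sup>2) * energy 0 unit_disk (\<lambda>z. g (A z))"
    unfolding energy_def
    by (rule nn_integral_cmult) (use energy_measurable[of unit_disk "\<lambda>z. g (A z)" 0] holomorphic_on_imp_continuous_on[OF gA] in auto)
  finally have 1: "(\<integral>\<^sup>+z. ennreal (indicator (ball c r) z * (cmod (g z))\<^sup>2) \<partial>lborel) = ennreal (r\<^sup>2) * energy 0 unit_disk (\<lambda>z. g (A z))" .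
  have "energy 0 unit_disk (\<lambda>z. z ^ 0) = (\<integral>\<^sup>+z. indicator unit_disk z \<partial>lborel)"
    unfolding energy_def
  proof (intro nn_integral_cong)
    fix z :: complex
    have "(cmod z)\<^sup>2 < 1" if "z \<in> unit_disk" using that by (simp add: abs_square_less_1)
    then show "ennreal (indicator unit_disk z * ((cmod (z ^ 0))\<^sup>2 * (1 - (cmod z)\<^sup>2) powr 0)) = indicator unit_disk z"
      by (auto simp: indicator_def)
  qed
  also have "\<dots> = ennreal pi"
    by (simp add: emeasure_ball unit_ball_vol_2)
  finally have 2: "energy 0 unit_disk (\<lambda>z. z ^ 0) = ennreal pi" .
  have "ennreal ((cmod (g c))\<^sup>2) * ennreal pi \<le> energy 0 unit_disk (\<lambda>z. g (A z))"
    using bessel[OF order_refl gA, of 1] 2 by (simp add: A_def)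
  then have "ennreal (r\<^sup>2) * (ennreal ((cmod (g c))\<^sup>2) * ennreal pi) \<le> ennreal (r\<^sup>2) * energy 0 unit_disk (\<lambda>z. g (A z))"
    by (intro mult_left_mono) auto
  then show ?thesis
    unfolding 1 by (simp add: ennreal_mult[symmetric] mult_ac)
qed

lemma holomorphic_imp_measurable_energy:
  assumes "g holomorphic_on unit_disk" "S \<in> sets borel" "S \<subseteq> unit_disk"
  shows "(\<lambda>z. ennreal (indicator S z * ((cmod (g z))\<^sup>2 * (1 - (cmod z)\<^sup>2) powr \<alpha>))) \<in> borel_measurable lborel"
  using assms by (intro energy_measurable_ennreal holomorphic_on_imp_continuous_on)

lemma deriv_holomorphic_disk: "f holomorphic_on unit_disk \<Longrightarrow> deriv f holomorphic_on unit_disk"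
  by (intro holomorphic_deriv) auto

section \<open>Dirichlet norms as energies\<close>

lemma dirichlet_energy_integral:
  assumes f: "f holomorphic_on unit_disk"
  shows "set_integrable dA unit_disk (\<lambda>z. (cmod (deriv f z))\<^sup>2 * (1 - (cmod z)\<^sup>2) powr \<alpha>) \<longleftrightarrow>
      energy \<alpha> unit_disk (deriv f) < \<infinity>" (is ?A)
    and "energy \<alpha> unit_disk (deriv f) < \<infinity> \<Longrightarrow>
      (LINT z:unit_disk|dA. (cmod (deriv f z))\<^sup>2 * (1 - (cmod z)\<^sup>2) powr \<alpha>) =
      enn2real (energy \<alpha> unit_disk (deriv f)) / pi"
proof -
  let ?k = "\<lambda>z. indicator unit_disk z * ((cmod (deriv f z))\<^sup>2 * (1 - (cmod z)\<^sup>2) powr \<alpha>)"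
  have m[measurable]: "?k \<in> borel_measurable borel"
    using deriv_holomorphic_disk[OF f]
    by (intro energy_measurable holomorphic_on_imp_continuous_on) auto
  have 1: "integrable dA ?k \<longleftrightarrow> integrable lborel (\<lambda>z. (1 / pi) *\<^sub>R ?k z)"
    unfolding dA_def by (rule integrable_density) auto
  also have "\<dots> \<longleftrightarrow> integrable lborel ?k"
    unfolding real_scaleR_def by (rule integrable_mult_left_iff[THEN trans]) simp
  also have "\<dots> \<longleftrightarrow> energy \<alpha> unit_disk (deriv f) < \<infinity>"
    by (simp add: integrable_iff_bounded energy_def abs_mult)
  finally have 2: "integrable dA ?k \<longleftrightarrow> energy \<alpha> unit_disk (deriv f) < \<infinity>" .
  then show ?A by (simp add: set_integrable_def)
  assume "energy \<alpha> unit_disk (deriv f) < \<infinity>"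
  have "(LINT z:unit_disk|dA. (cmod (deriv f z))\<^sup>2 * (1 - (cmod z)\<^sup>2) powr \<alpha>) = integral\<^sup>L dA ?k"
    by (simp add: set_lebesgue_integral_def)
  also have "\<dots> = (\<integral>z. (1 / pi) *\<^sub>R ?k z \<partial>lborel)"
    unfolding dA_def by (rule integral_density) auto
  also have "\<dots> = (1 / pi) * integral\<^sup>L lborel ?k"
    by simp
  also have "integral\<^sup>L lborel ?k = enn2real (energy \<alpha> unit_disk (deriv f))"
    unfolding energy_def by (rule integral_eq_nn_integral) auto
  finally show "(LINT z:unit_disk|dA. (cmod (deriv f z))\<^sup>2 * (1 - (cmod z)\<^sup>2) powr \<alpha>) =
      enn2real (energy \<alpha> unit_disk (deriv f)) / pi"
    by simp
qed

lemma dirichlet_space_iff: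
  "f \<in> dirichlet_space \<alpha> \<longleftrightarrow> f holomorphic_on unit_disk \<and> (\<forall>z. z \<notin> unit_disk \<longrightarrow> f z = 0) \<and>
     energy \<alpha> unit_disk (deriv f) < \<infinity>"
  unfolding dirichlet_space_def using dirichlet_energy_integral(1) by blast

lemma dirichlet_norm_sq:
  assumes "f \<in> dirichlet_space \<alpha>" "\<alpha> \<ge> 0"
  shows "(dirichlet_norm \<alpha> f)\<^sup>2 = (cmod (f 0))\<^sup>2 + (\<alpha> + 1) / pi * enn2real (energy \<alpha> unit_disk (deriv f))"
proof -
  have "f holomorphic_on unit_disk" "energy \<alpha> unit_disk (deriv f) < \<infinity>"
    using assms(1) by (auto simp: dirichlet_space_iff)
  from dirichlet_energy_integral(2)[OF this] show ?thesis
    using assms(2) unfolding dirichlet_norm_def by (subst real_sqrt_pow2) auto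
qed

lemma dirichlet_norm_nonneg: "dirichlet_norm \<alpha> f \<ge> 0" if "\<alpha> \<ge> 0" for f
proof -
  have "(LINT z:unit_disk|dA. (cmod (deriv f z))\<^sup>2 * (1 - (cmod z)\<^sup>2) powr \<alpha>) \<ge> 0"
    unfolding set_lebesgue_integral_def by (intro Bochner_Integration.integral_nonneg) auto
  then show ?thesis
    using that unfolding dirichlet_norm_def by simp
qed

section \<open>Functions vanishing to high order at the centre of a disk\<close>

lemma higher_schwarz:
  assumes R: "R > 0" and q: "0 \<le> q" "q < 1" and g: "g holomorphic_on ball c R" "continuous_on (cball c R) g"
    and M: "\<And>z. z \<in> cball c R \<Longrightarrow> cmod (g z) \<le> M"
    and vanish: "\<And>k. k < m \<Longrightarrow> (deriv ^^ k) g c = 0"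
    and z: "cmod (z - c) \<le> q * R"
  shows "cmod (g z) \<le> M * q ^ m / (1 - q)"
proof -
  \<comment> \<open>Cauchy's inequality at radius \<open>R\<close> bounds the k-th Taylor term by M
    q^k; the vanishing derivatives remove the first \<open>m\<close> terms, and the tail of a
    geometric series remains.\<close>
  define t where "t = (\<lambda>k. (deriv ^^ k) g c / fact k * (z - c) ^ k)"
  have M0: "M \<ge> 0" using M[of c] R by (auto intro: order_trans[OF norm_ge_zero])
  have "q * R < R" using q R by simp
  then have "z \<in> ball c R" using z by (simp add: dist_norm norm_minus_commute)
  then have sums: "t sums g z"
    unfolding t_def by (rule holomorphic_power_series[OF g(1)])
  have tb: "cmod (t k) \<le> M * q ^ k" for k
  proof -
    have "cmod ((deriv ^^ k) g c) \<le> fact k * M / R ^ k"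
      using R M by (intro Cauchy_inequality g) (auto simp: dist_norm)
    moreover have "cmod (z - c) ^ k \<le> (q * R) ^ k"
      using z by (intro power_mono) auto
    ultimately have "cmod ((deriv ^^ k) g c) * cmod (z - c) ^ k \<le> (fact k * M / R ^ k) * (q * R) ^ k"
      using M0 R by (intro mult_mono) auto
    also have "\<dots> = fact k * (M * q ^ k)"
      using R by (simp add: power_mult_distrib field_simps)
    finally show ?thesis
      by (simp add: t_def norm_mult norm_divide norm_power field_simps)
  qed
  have "(\<lambda>k. t (k + m)) sums g z"
    using sums_iff_shift[of t m "g z"] sums vanish by (simp add: t_def)
  moreover have "(\<lambda>k. M * q ^ (k + m)) sums (M * q ^ m / (1 - q))"
    using sums_mult[OF geometric_sums[of q], of "M * q ^ m"] q by (simp add: power_add field_simps)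
  ultimately show ?thesis
    using norm_suminf_le[of "\<lambda>k. t (k + m)" "\<lambda>k. M * q ^ (k + m)"] tb
    by (simp add: sums_iff)
qed

text \<open>Three radii are needed: disks of radius r about points of \<open>cball c (2 * r)\<close>
  stay in \<open>ball c (3 * r)\<close>, so the mean value inequality bounds |g| on the middle disk;
  \<open>higher_schwarz\<close> from radius 2 r down to r has q = 1/2 and gains 2 / 2^m in modulus,
  hence 4 / 4^m in the square. The area pi r^2 cancels.\<close>

lemma vanishing_energy_ball:
  assumes r: "r > 0" and g: "g holomorphic_on ball c (3 * r)"
    and vanish: "\<And>k. k < m \<Longrightarrow> (deriv ^^ k) g c = 0"
  shows "(\<integral>\<^sup>+z. ennreal (indicator (ball c r) z * (cmod (g z))\<^sup>2) \<partial>lborel) \<le>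
     ennreal (4 / 4 ^ m) * (\<integral>\<^sup>+z. ennreal (indicator (ball c (3 * r)) z * (cmod (g z))\<^sup>2) \<partial>lborel)" (is "?L \<le> _ * ?R")
proof (cases "?R = \<infinity>")
  case True
  then show ?thesis by (simp add: ennreal_mult_top)
next
  case False
  then obtain I where I: "?R = ennreal I" "I \<ge> 0"
    by (cases ?R rule: ennreal_cases) auto
  define M where "M = sqrt (I / (pi * r\<^sup>2))"
  have M2: "M\<^sup>2 = I / (pi * r\<^sup>2)" using I r by (simp add: M_def)
  have M: "cmod (g z) \<le> M" if z: "z \<in> cball c (2 * r)" for z
  proof -
    have sub: "ball z r \<subseteq> ball c (3 * r)"
    proof
      fix w assume "w \<in> ball z r"
      then show "w \<in> ball c (3 * r)"
        using z dist_triangle[of c w z] by auto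
    qed
    have "ennreal ((cmod (g z))\<^sup>2 * (pi * r\<^sup>2)) \<le> (\<integral>\<^sup>+w. ennreal (indicator (ball z r) w * (cmod (g w))\<^sup>2) \<partial>lborel)"
      using sub by (intro area_mean_value r holomorphic_on_subset[OF g])
    also have "\<dots> \<le> ?R"
      using sub by (intro nn_integral_mono ennreal_leI mult_right_mono) (auto simp: indicator_def)
    finally have "(cmod (g z))\<^sup>2 * (pi * r\<^sup>2) \<le> I"
      using I by simp
    then have "(cmod (g z))\<^sup>2 \<le> I / (pi * r\<^sup>2)"
      using r by (simp add: field_simps)
    then show ?thesis
      unfolding M_def by (rule real_le_rsqrt)
  qed
  have b: "cmod (g z) \<le> 2 * M / 2 ^ m" if "z \<in> ball c r" for z
  proof -
    have "cmod (g z) \<le> M * (1 / 2) ^ m / (1 - 1 / 2)"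
    proof (rule higher_schwarz[OF _ _ _ _ _ M vanish])
      show "g holomorphic_on ball c (2 * r)" using r by (intro holomorphic_on_subset[OF g]) auto
      show "continuous_on (cball c (2 * r)) g"
        using r by (intro continuous_on_subset[OF holomorphic_on_imp_continuous_on[OF g]]) auto
    qed (use r that in \<open>auto simp: dist_norm norm_minus_commute\<close>)
    then show ?thesis by (simp add: power_divide mult.commute)
  qed
  have b2: "(cmod (g z))\<^sup>2 \<le> 4 * M\<^sup>2 / 4 ^ m" if "z \<in> ball c r" for z
  proof -
    have "(cmod (g z))\<^sup>2 \<le> (2 * M / 2 ^ m)\<^sup>2"
      using b[OF that] by (intro power_mono) auto
    also have "\<dots> = 4 * M\<^sup>2 / 4 ^ m"
      by (simp add: power_divide power_mult_distrib power_mult[symmetric] mult.commute[of m])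
         (simp add: power_mult)
    finally show ?thesis .
  qed
  have "?L \<le> (\<integral>\<^sup>+z. ennreal (4 * M\<^sup>2 / 4 ^ m) * indicator (ball c r) z \<partial>lborel)"
    using b2 by (intro nn_integral_mono) (auto simp: indicator_def)
  also have "\<dots> = ennreal (4 * M\<^sup>2 / 4 ^ m) * emeasure lborel (ball c r)"
    by (simp add: nn_integral_cmult_indicator)
  also have "\<dots> = ennreal (4 * M\<^sup>2 / 4 ^ m) * ennreal (pi * r\<^sup>2)"
    using r by (simp add: emeasure_ball unit_ball_vol_2)
  also have "\<dots> = ennreal (4 / 4 ^ m * I)"
    using r I(2) by (subst ennreal_mult[symmetric]) (auto simp: M2)
  also have "\<dots> = ennreal (4 / 4 ^ m) * ?R"
    unfolding I(1) using I(2) by (subst ennreal_mult) auto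
  finally show ?thesis .
qed

lemma disk_weight_bounds:
  assumes "z \<in> unit_disk"
  shows "1 - cmod z \<le> 1 - (cmod z)\<^sup>2" "1 - (cmod z)\<^sup>2 \<le> 2 * (1 - cmod z)" "0 < 1 - cmod z"
proof -
  have "(1 - cmod z) * (1 + cmod z) = 1 - (cmod z)\<^sup>2" by (simp add: power2_eq_square algebra_simps)
  moreover have "(1 - cmod z) * 1 \<le> (1 - cmod z) * (1 + cmod z)" "(1 - cmod z) * (1 + cmod z) \<le> (1 - cmod z) * 2"
    using assms by (intro mult_left_mono; auto)+
  ultimately show "1 - cmod z \<le> 1 - (cmod z)\<^sup>2" "1 - (cmod z)\<^sup>2 \<le> 2 * (1 - cmod z)"
    by auto
  show "0 < 1 - cmod z" using assms by auto
qed

text \<open>With \<delta> = 1 - |c|, the number 1 - |z|^2 lies between \<delta> / 4 and 7 \<delta> /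
  2 on the threefold disk. The weight thus varies by at most the factor
  \<open>14 powr \<alpha>\<close>, and the unweighted estimate applies.\<close>

lemma energy_vanishing_disk:
  assumes \<alpha>: "\<alpha> \<ge> 0" and r: "r > 0" "4 * r \<le> 1 - cmod c" and g: "g holomorphic_on unit_disk"
    and vanish: "\<And>k. k < m \<Longrightarrow> (deriv ^^ k) g c = 0"
  shows "energy \<alpha> (ball c r) g \<le> ennreal (4 * 14 powr \<alpha> / 4 ^ m) * energy \<alpha> unit_disk g"
proof -
  define \<delta> where "\<delta> = 1 - cmod c"
  have \<delta>: "\<delta> > 0" "4 * r \<le> \<delta>" using r by (auto simp: \<delta>_def)
  have sub: "ball c (3 * r) \<subseteq> unit_disk"
  proof
    fix z assume "z \<in> ball c (3 * r)"
    then have "cmod z \<le> cmod c + 3 * r"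
      using norm_triangle_ineq2[of z c] by (auto simp: dist_norm norm_minus_commute)
    then show "z \<in> unit_disk" using \<delta> r unfolding \<delta>_def by auto
  qed
  have near: "\<delta> / 4 \<le> 1 - cmod z \<and> 1 - cmod z \<le> 7 * \<delta> / 4" if "z \<in> ball c (3 * r)" for z
    using that norm_triangle_ineq2[of z c] norm_triangle_ineq2[of c z] \<delta> unfolding \<delta>_def
    by (auto simp: dist_norm norm_minus_commute)
  have up: "(1 - (cmod z)\<^sup>2) powr \<alpha> \<le> (7 * \<delta> / 2) powr \<alpha>" if "z \<in> ball c (3 * r)" for z
    using near[OF that] disk_weight_bounds[of z] sub that \<alpha> by (intro powr_mono2) auto
  have lo: "(\<delta> / 4) powr \<alpha> \<le> (1 - (cmod z)\<^sup>2) powr \<alpha>" if "z \<in> ball c (3 * r)" for z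
    using near[OF that] disk_weight_bounds[of z] sub that \<alpha> \<delta> by (intro powr_mono2) auto
  have mg: "(\<lambda>z. ennreal (indicator (ball c s) z * (cmod (g z))\<^sup>2)) \<in> borel_measurable lborel" if "s \<le> 3 * r" for s
  proof -
    have "ball c s \<subseteq> unit_disk" using that sub by (meson order_trans subset_ball)
    then have "continuous_on (ball c s) g"
      using holomorphic_on_imp_continuous_on[OF g] continuous_on_subset by blast
    from borel_measurable_indicator_comp[OF open_ball this, of "\<lambda>z. (cmod z)\<^sup>2"]
    show ?thesis by (simp add: measurable_compose[OF _ measurable_ennreal])
  qed
  have "energy \<alpha> (ball c r) g \<le> (\<integral>\<^sup>+z. ennreal ((7 * \<delta> / 2) powr \<alpha>) * ennreal (indicator (ball c r) z * (cmod (g z))\<^sup>2) \<partial>lborel)"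
    unfolding energy_def ennreal_mult'[OF powr_ge_zero, symmetric]
  proof (intro nn_integral_mono ennreal_leI)
    fix z
    have "(1 - (cmod z)\<^sup>2) powr \<alpha> \<le> (7 * \<delta> / 2) powr \<alpha>" if "z \<in> ball c r"
      using up[of z] that r by auto
    then show "indicator (ball c r) z * ((cmod (g z))\<^sup>2 * (1 - (cmod z)\<^sup>2) powr \<alpha>) \<le> (7 * \<delta> / 2) powr \<alpha> * (indicator (ball c r) z * (cmod (g z))\<^sup>2)"
      by (cases "z \<in> ball c r") (auto simp: mult.commute[of _ "(cmod (g z))\<^sup>2"] intro!: mult_left_mono)
  qed
  also have "\<dots> = ennreal ((7 * \<delta> / 2) powr \<alpha>) * (\<integral>\<^sup>+z. ennreal (indicator (ball c r) z * (cmod (g z))\<^sup>2) \<partial>lborel)"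
    using r by (intro nn_integral_cmult mg) auto
  also have "\<dots> \<le> ennreal ((7 * \<delta> / 2) powr \<alpha>) * (ennreal (4 / 4 ^ m) * (\<integral>\<^sup>+z. ennreal (indicator (ball c (3 * r)) z * (cmod (g z))\<^sup>2) \<partial>lborel))"
    by (intro mult_left_mono vanishing_energy_ball r holomorphic_on_subset[OF g sub] vanish) auto
  also have "\<dots> = ennreal (4 * 14 powr \<alpha> / 4 ^ m) * (ennreal ((\<delta> / 4) powr \<alpha>) * (\<integral>\<^sup>+z. ennreal (indicator (ball c (3 * r)) z * (cmod (g z))\<^sup>2) \<partial>lborel))"
  proof -
    have "(7 * \<delta> / 2) powr \<alpha> = 14 powr \<alpha> * (\<delta> / 4) powr \<alpha>"
      using \<delta> by (subst powr_mult[symmetric]) auto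
    then show ?thesis
      by (simp add: ennreal_mult[symmetric] mult.assoc[symmetric]) (simp add: mult_ac)
  qed
  also have "\<dots> = ennreal (4 * 14 powr \<alpha> / 4 ^ m) * (\<integral>\<^sup>+z. ennreal ((\<delta> / 4) powr \<alpha>) * ennreal (indicator (ball c (3 * r)) z * (cmod (g z))\<^sup>2) \<partial>lborel)"
    by (subst nn_integral_cmult[OF mg]) auto
  also have "\<dots> \<le> ennreal (4 * 14 powr \<alpha> / 4 ^ m) * energy \<alpha> unit_disk g"
    unfolding energy_def ennreal_mult'[OF powr_ge_zero, symmetric]
  proof (intro mult_left_mono nn_integral_mono ennreal_leI)
    fix z show "(\<delta> / 4) powr \<alpha> * (indicator (ball c (3 * r)) z * (cmod (g z))\<^sup>2) \<le> indicator unit_disk z * ((cmod (g z))\<^sup>2 * (1 - (cmod z)\<^sup>2) powr \<alpha>)"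
      using lo[of z] subsetD[OF sub, of z] by (cases "z \<in> ball c (3 * r)") (auto simp: mult.commute intro!: mult_left_mono)
  qed auto
  finally show ?thesis .
qed

lemma energy_union_le:
  assumes "finite I" "S \<subseteq> (\<Union>i\<in>I. A i)" "\<And>i. i \<in> I \<Longrightarrow> A i \<in> sets borel" "\<And>i. i \<in> I \<Longrightarrow> A i \<subseteq> unit_disk"
    and "g holomorphic_on unit_disk"
  shows "energy \<alpha> S g \<le> (\<Sum>i\<in>I. energy \<alpha> (A i) g)"
proof -
  have "energy \<alpha> S g \<le> (\<integral>\<^sup>+z. (\<Sum>i\<in>I. ennreal (indicator (A i) z * ((cmod (g z))\<^sup>2 * (1 - (cmod z)\<^sup>2) powr \<alpha>))) \<partial>lborel)"
    unfolding energy_def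
  proof (intro nn_integral_mono)
    fix z
    show "ennreal (indicator S z * ((cmod (g z))\<^sup>2 * (1 - (cmod z)\<^sup>2) powr \<alpha>)) \<le> (\<Sum>i\<in>I. ennreal (indicator (A i) z * ((cmod (g z))\<^sup>2 * (1 - (cmod z)\<^sup>2) powr \<alpha>)))"
    proof (cases "z \<in> S")
      case True
      then obtain i where i: "i \<in> I" "z \<in> A i" using assms(2) by auto
      then have "ennreal (indicator S z * ((cmod (g z))\<^sup>2 * (1 - (cmod z)\<^sup>2) powr \<alpha>)) = ennreal (indicator (A i) z * ((cmod (g z))\<^sup>2 * (1 - (cmod z)\<^sup>2) powr \<alpha>))"
        using True by simp
      also have "\<dots> \<le> (\<Sum>i\<in>I. ennreal (indicator (A i) z * ((cmod (g z))\<^sup>2 * (1 - (cmod z)\<^sup>2) powr \<alpha>)))"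
        using i assms(1) by (intro member_le_sum) auto
      finally show ?thesis .
    qed auto
  qed
  also have "\<dots> = (\<Sum>i\<in>I. energy \<alpha> (A i) g)"
    unfolding energy_def
    by (intro nn_integral_sum holomorphic_imp_measurable_energy assms)
  finally show ?thesis .
qed

text \<open>Overlaps of the disks are not analysed: each disk is charged with the energy of the
  whole unit disk, whence the factor \<open>card I\<close>.\<close>

lemma energy_vanishing_cover:
  assumes \<alpha>: "\<alpha> \<ge> 0" and I: "finite I" and S: "S \<subseteq> (\<Union>i\<in>I. ball (c i) (r i))"
    and r: "\<And>i. i \<in> I \<Longrightarrow> r i > 0" "\<And>i. i \<in> I \<Longrightarrow> 4 * r i \<le> 1 - cmod (c i)"
    and g: "g holomorphic_on unit_disk"
    and vanish: "\<And>i k. i \<in> I \<Longrightarrow> k < m \<Longrightarrow> (deriv ^^ k) g (c i) = 0"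
  shows "energy \<alpha> S g \<le> ennreal (real (card I) * (4 * 14 powr \<alpha> / 4 ^ m)) * energy \<alpha> unit_disk g"
proof -
  have "energy \<alpha> S g \<le> (\<Sum>i\<in>I. energy \<alpha> (ball (c i) (r i)) g)"
  proof (rule energy_union_le[OF I S _ _ g])
    fix i assume i: "i \<in> I"
    show "ball (c i) (r i) \<subseteq> unit_disk"
    proof
      fix z assume "z \<in> ball (c i) (r i)"
      then have "cmod z \<le> cmod (c i) + r i"
        using norm_triangle_ineq2[of z "c i"] by (auto simp: dist_norm norm_minus_commute)
      then show "z \<in> unit_disk" using r[OF i] by auto
    qed
  qed auto
  also have "\<dots> \<le> (\<Sum>i\<in>I. ennreal (4 * 14 powr \<alpha> / 4 ^ m) * energy \<alpha> unit_disk g)"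
    by (intro sum_mono energy_vanishing_disk \<alpha> r g vanish)
  also have "\<dots> = ennreal (real (card I) * (4 * 14 powr \<alpha> / 4 ^ m)) * energy \<alpha> unit_disk g"
    by (subst ennreal_mult) (auto simp: ennreal_of_nat_eq_real_of_nat mult.assoc)
  finally show ?thesis .
qed

text \<open>Mean value inequality on the disk about w of radius r = (1 - |w|) / 2, where the weight
  is at least \<open>r powr \<alpha>\<close>. The halving in r produces the constants 1/4 and
  \<open>2 powr (- \<alpha>)\<close>.\<close>

lemma pointwise_energy_bound:
  assumes \<alpha>: "\<alpha> \<ge> 0" and g: "g holomorphic_on unit_disk" and w: "w \<in> unit_disk"
  shows "ennreal ((cmod (g w))\<^sup>2 * (pi / 4 * 2 powr (- \<alpha>) * (1 - cmod w) powr (2 + \<alpha>))) \<le> energy \<alpha> unit_disk g"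
proof -
  define r where "r = (1 - cmod w) / 2"
  have r: "r > 0" using w by (auto simp: r_def)
  have near: "z \<in> unit_disk \<and> r \<le> 1 - (cmod z)\<^sup>2" if "z \<in> ball w r" for z
  proof -
    have "cmod z \<le> cmod w + r"
      using that norm_triangle_ineq2[of z w] by (auto simp: dist_norm norm_minus_commute)
    then have "1 - cmod z \<ge> r" by (simp add: r_def field_simps)
    then show ?thesis using r disk_weight_bounds[of z] by auto
  qed
  have sub: "ball w r \<subseteq> unit_disk" using near by auto
  have "ennreal (r powr \<alpha>) * ennreal ((cmod (g w))\<^sup>2 * (pi * r\<^sup>2)) \<le>
      ennreal (r powr \<alpha>) * (\<integral>\<^sup>+z. ennreal (indicator (ball w r) z * (cmod (g z))\<^sup>2) \<partial>lborel)"
    by (intro mult_left_mono area_mean_value r holomorphic_on_subset[OF g sub]) auto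
  also have "\<dots> = (\<integral>\<^sup>+z. ennreal (r powr \<alpha>) * ennreal (indicator (ball w r) z * (cmod (g z))\<^sup>2) \<partial>lborel)"
  proof (rule nn_integral_cmult[symmetric])
    have "continuous_on (ball w r) g"
      using holomorphic_on_imp_continuous_on[OF g] sub continuous_on_subset by blast
    from borel_measurable_indicator_comp[OF open_ball this, of "\<lambda>z. (cmod z)\<^sup>2"]
    show "(\<lambda>z. ennreal (indicator (ball w r) z * (cmod (g z))\<^sup>2)) \<in> borel_measurable lborel"
      by (simp add: measurable_compose[OF _ measurable_ennreal])
  qed
  also have "\<dots> \<le> energy \<alpha> unit_disk g"
    unfolding energy_def ennreal_mult'[OF powr_ge_zero, symmetric]
  proof (intro nn_integral_mono ennreal_leI)
    fix z show "r powr \<alpha> * (indicator (ball w r) z * (cmod (g z))\<^sup>2) \<le> indicator unit_disk z * ((cmod (g z))\<^sup>2 * (1 - (cmod z)\<^sup>2) powr \<alpha>)"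
      using near[of z] sub \<alpha> r powr_mono2[of \<alpha> r "1 - (cmod z)\<^sup>2"]
      by (cases "z \<in> ball w r") (auto simp: mult.commute[of _ "(cmod (g z))\<^sup>2"] intro!: mult_left_mono)
  qed
  also have "ennreal (r powr \<alpha>) * ennreal ((cmod (g w))\<^sup>2 * (pi * r\<^sup>2)) =
      ennreal ((cmod (g w))\<^sup>2 * (pi / 4 * 2 powr (- \<alpha>) * (1 - cmod w) powr (2 + \<alpha>)))"
  proof -
    have "r powr \<alpha> = (1 - cmod w) powr \<alpha> * 2 powr (- \<alpha>)"
      using w unfolding r_def by (simp add: powr_divide powr_minus_divide)
    moreover have "(1 - cmod w) powr (2 + \<alpha>) = (1 - cmod w)\<^sup>2 * (1 - cmod w) powr \<alpha>"
      using w by (simp add: powr_add)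
    moreover have "r\<^sup>2 = (1 - cmod w)\<^sup>2 / 4" by (simp add: r_def power_divide)
    ultimately have "r powr \<alpha> * ((cmod (g w))\<^sup>2 * (pi * r\<^sup>2)) =
        (cmod (g w))\<^sup>2 * (pi / 4 * 2 powr (- \<alpha>) * (1 - cmod w) powr (2 + \<alpha>))"
      by (simp only:) simp
    then show ?thesis by (simp only: ennreal_mult'[OF powr_ge_zero, symmetric])
  qed
  finally show ?thesis .
qed

section \<open>Geometry of the cusp map\<close>

text \<open>The factor \<open>deriv \<phi> z\<close> supplies the Jacobian of the substitution w =
  \<phi> z, so only the two weights have to be compared, at the price of \<open>K\<close>, and only
  where \<phi> z lies in \<open>B\<close>.\<close>

lemma energy_composition_le:
  assumes \<phi>: "\<phi> holomorphic_on unit_disk" "inj_on \<phi> unit_disk" "\<phi> ` unit_disk \<subseteq> unit_disk"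
    and g: "g holomorphic_on unit_disk" and B: "B \<in> sets borel" and K: "K \<ge> 0"
    and weight: "\<And>z. z \<in> unit_disk \<Longrightarrow> \<phi> z \<in> B \<Longrightarrow>
      (1 - (cmod z)\<^sup>2) powr \<alpha> \<le> K * (1 - (cmod (\<phi> z))\<^sup>2) powr \<alpha>"
  shows "energy \<alpha> (unit_disk \<inter> \<phi> -` B) (\<lambda>z. g (\<phi> z) * deriv \<phi> z) \<le> ennreal K * energy \<alpha> (\<phi> ` unit_disk \<inter> B) g"
proof -
  define f where "f = (\<lambda>w. indicator (unit_disk \<inter> B) w * ((cmod (g w))\<^sup>2 * (1 - (cmod w)\<^sup>2) powr \<alpha>))"
  have f: "f \<in> borel_measurable borel"
    unfolding f_def using B by (intro energy_measurable holomorphic_on_imp_continuous_on g) auto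
  have f0: "f w \<ge> 0" for w by (simp add: f_def)
  have "open (\<phi> ` unit_disk)" by (rule open_mapping_thm3[OF \<phi>(1) open_ball \<phi>(2)])
  then have im: "\<phi> ` unit_disk \<in> sets borel" by simp
  have "energy \<alpha> (unit_disk \<inter> \<phi> -` B) (\<lambda>z. g (\<phi> z) * deriv \<phi> z) \<le>
      (\<integral>\<^sup>+z. ennreal (indicator unit_disk z * ((cmod (deriv \<phi> z))\<^sup>2 * (K * f (\<phi> z)))) \<partial>lborel)"
    unfolding energy_def
  proof (intro nn_integral_mono ennreal_leI)
    fix z
    show "indicator (unit_disk \<inter> \<phi> -` B) z * ((cmod (g (\<phi> z) * deriv \<phi> z))\<^sup>2 * (1 - (cmod z)\<^sup>2) powr \<alpha>) \<le>
       indicator unit_disk z * ((cmod (deriv \<phi> z))\<^sup>2 * (K * f (\<phi> z)))"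
    proof (cases "z \<in> unit_disk \<and> \<phi> z \<in> B")
      case True
      then have "\<phi> z \<in> unit_disk" using \<phi>(3) by blast
      have "((cmod (g (\<phi> z)))\<^sup>2 * (cmod (deriv \<phi> z))\<^sup>2) * (1 - (cmod z)\<^sup>2) powr \<alpha> \<le>
         ((cmod (g (\<phi> z)))\<^sup>2 * (cmod (deriv \<phi> z))\<^sup>2) * (K * (1 - (cmod (\<phi> z))\<^sup>2) powr \<alpha>)"
        using True by (intro mult_left_mono weight) auto
      then show ?thesis
        using True \<open>\<phi> z \<in> unit_disk\<close> by (simp add: f_def norm_mult power_mult_distrib mult_ac)
    next
      case False
      then show ?thesis using K f0 by (auto simp: indicator_def)
    qed
  qed
  also have "\<dots> = (\<integral>\<^sup>+w. ennreal (indicator (\<phi> ` unit_disk) w * (K * f w)) \<partial>lborel)"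
    by (rule nn_integral_holomorphic_image[symmetric, OF _ \<phi>(1,2)]) (use f f0 K in auto)
  also have "\<dots> = (\<integral>\<^sup>+w. ennreal K * ennreal (indicator (\<phi> ` unit_disk \<inter> B) w * ((cmod (g w))\<^sup>2 * (1 - (cmod w)\<^sup>2) powr \<alpha>)) \<partial>lborel)"
    using \<phi>(3) K by (intro nn_integral_cong) (auto simp: f_def indicator_def ennreal_mult)
  also have "\<dots> = ennreal K * energy \<alpha> (\<phi> ` unit_disk \<inter> B) g"
    unfolding energy_def using im B \<phi>(3)
    by (intro nn_integral_cmult holomorphic_imp_measurable_energy g) auto
  finally show ?thesis .
qed

lemma sqrt_2_bounds: "1.4 < sqrt 2" "sqrt 2 < 1.5"
proof -
  have "sqrt (1.4\<^sup>2) < sqrt 2" "sqrt 2 < sqrt (1.5\<^sup>2)"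
    by (rule real_sqrt_less_mono, simp add: power2_eq_square)+
  then show "1.4 < sqrt 2" "sqrt 2 < 1.5" by simp_all
qed

text \<open>Re \<zeta> > 1 confines 1 - a / \<zeta> to the disk with diameter from 1 - a to 1; a < 2
  keeps this disk inside the unit disk, touching the circle at 1 only. The upper bound comes from
  exp 1 >= 2.5, sqrt 2 - 1 > 0.4 and pi > 3.\<close>

lemma cusp_const_bounds: "1 < cusp_const" "cusp_const < 2"
proof -
  note s = sqrt_2_bounds
  have "ln (sqrt 2 - 1) < 0" using s by simp
  then show "1 < cusp_const" by (simp add: cusp_const_def divide_less_0_iff mult_less_0_iff)
  have "exp (1::real) \<ge> 2.5"
    using exp_lower_Taylor_quadratic[of 1] by simp
  then have "exp (- 1 :: real) \<le> 0.4"
    by (simp add: exp_minus inverse_eq_divide divide_simps)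
  then have "exp (- 1) \<le> sqrt 2 - 1" using s by simp
  then have "-1 \<le> ln (sqrt 2 - 1)" using s by (subst ln_ge_iff) auto
  then have "- (2 / pi * ln (sqrt 2 - 1)) \<le> 2 / pi"
    using mult_left_mono[of "-1" "ln (sqrt 2 - 1)" "2 / pi"] pi_gt_zero by simp
  also have "2 / pi < 1" using pi_gt3 by simp
  finally show "cusp_const < 2" by (simp add: cusp_const_def)
qed

text \<open>The point is followed through the upper half-plane (\<open>p\<close>), the first
  quadrant (\<open>v\<close>) and the right half-disk (\<open>x\<close>). The last claim is z = (1 -
  x^2 - 2 x) / (1 - x^2 + 2 x), the rational inverse of \<open>cusp_map0\<close>, cleared of its
  denominator; later arguments use it in place of the square root.\<close>

lemma cusp_map0_facts:
  assumes z: "z \<in> unit_disk"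
  defines "x \<equiv> cusp_map0 z"
  shows "(z - \<i>) / (\<i> * z - 1) \<notin> \<real>\<^sub>\<le>\<^sub>0" "\<i> * z - 1 \<noteq> 0"
    "- \<i> * csqrt ((z - \<i>) / (\<i> * z - 1)) + 1 \<noteq> 0"
    "cmod x < 1" "Re x > 0" "z * (1 - x\<^sup>2 + 2 * x) = 1 - x\<^sup>2 - 2 * x"
proof -
  define p where "p = (z - \<i>) / (\<i> * z - 1)"
  define v where "v = csqrt p"
  show nz: "\<i> * z - 1 \<noteq> 0"
  proof
    assume "\<i> * z - 1 = 0"
    then have "cmod (\<i> * z) = 1" by simp
    then show False using z by (simp add: norm_mult)
  qed
  have "(Re z)\<^sup>2 + (Im z)\<^sup>2 < 1"
    using z by (simp add: cmod_power2[symmetric] abs_square_less_1)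
  moreover have "Im p = (1 - ((Re z)\<^sup>2 + (Im z)\<^sup>2)) / (cmod (\<i> * z - 1))\<^sup>2"
    unfolding p_def Im_divide cmod_power2 by (simp add: algebra_simps power2_eq_square)
  ultimately have Imp: "Im p > 0" using nz by simp
  show "(z - \<i>) / (\<i> * z - 1) \<notin> \<real>\<^sub>\<le>\<^sub>0"
    using Imp by (auto simp: p_def[symmetric] complex_nonpos_Reals_iff)
  have v2: "v\<^sup>2 = p" by (simp add: v_def)
  \<comment> \<open>Im p = 2 Re v Im v is positive and the principal root has nonnegative real part,
    so both coordinates of \<open>v\<close> are positive.\<close>
  have Im2: "2 * (Re v * Im v) > 0"
    using Imp unfolding v2[symmetric] by (simp add: power2_eq_square algebra_simps)
  have Rev: "Re v > 0"
    using csqrt_principal[of p] Im2 by (auto simp: v_def)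
  then have Imv: "Im v > 0" using Im2 by (simp add: zero_less_mult_iff)
  have d0: "1 - \<i> * v \<noteq> 0" using Imv by (auto simp: complex_eq_iff)
  then show "- \<i> * csqrt ((z - \<i>) / (\<i> * z - 1)) + 1 \<noteq> 0"
    by (simp add: p_def[symmetric] v_def[symmetric])
  have x: "x = (v - \<i>) / (1 - \<i> * v)"
    by (simp add: x_def cusp_map0_def p_def[symmetric] v_def[symmetric])
  have "(cmod (v - \<i>))\<^sup>2 < (cmod (1 - \<i> * v))\<^sup>2"
    using Imv unfolding cmod_power2 by (simp add: power2_eq_square algebra_simps)
  then have "cmod (v - \<i>) < cmod (1 - \<i> * v)" by (rule power2_less_imp_less) simp
  then show "cmod x < 1" using d0 by (simp add: x norm_divide)
  have "Re x = 2 * Re v / (cmod (1 - \<i> * v))\<^sup>2"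
    unfolding x Re_divide cmod_power2 by (simp add: algebra_simps)
  then show "Re x > 0" using Rev d0 by simp
  have pz: "v\<^sup>2 * (\<i> * z - 1) = z - \<i>" using nz by (simp add: v2 p_def)
  have xd: "x * (1 - \<i> * v) = v - \<i>" using d0 by (simp add: x)
  have e1: "(1 - x\<^sup>2) * (1 - \<i> * v)\<^sup>2 = 2 - 2 * v\<^sup>2"
  proof -
    have "(1 - x\<^sup>2) * (1 - \<i> * v)\<^sup>2 = (1 - \<i> * v)\<^sup>2 - (x * (1 - \<i> * v))\<^sup>2"
      by (simp only: power_mult_distrib left_diff_distrib mult_1)
    also have "\<dots> = 2 - 2 * v\<^sup>2" unfolding xd by (simp add: power2_eq_square algebra_simps)
    finally show ?thesis .
  qed
  have e2: "2 * x * (1 - \<i> * v)\<^sup>2 = - 2 * \<i> * (v\<^sup>2 + 1)"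
  proof -
    have "2 * x * (1 - \<i> * v)\<^sup>2 = 2 * (x * (1 - \<i> * v)) * (1 - \<i> * v)" by (simp add: power2_eq_square)
    also have "\<dots> = - 2 * \<i> * (v\<^sup>2 + 1)" unfolding xd by (simp add: power2_eq_square algebra_simps)
    finally show ?thesis .
  qed
  have "(z * (1 - x\<^sup>2 + 2 * x) - (1 - x\<^sup>2 - 2 * x)) * (1 - \<i> * v)\<^sup>2 =
     (z - 1) * ((1 - x\<^sup>2) * (1 - \<i> * v)\<^sup>2) + (z + 1) * (2 * x * (1 - \<i> * v)\<^sup>2)"
    by (simp add: algebra_simps)
  also have "\<dots> = 2 * (\<i> - 1) * (v\<^sup>2 * (\<i> * z - 1) - (z - \<i>))"
    unfolding e1 e2 by (simp add: algebra_simps)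
  also have "\<dots> = 0" using pz by simp
  finally show "z * (1 - x\<^sup>2 + 2 * x) = 1 - x\<^sup>2 - 2 * x" using d0 by simp
qed

text \<open>Numerator and denominator of the rational inverse differ by 4 x, so a common zero would
  be x = 0, where both are 1.\<close>

lemma cusp_denominator_nonzero:
  fixes x z :: complex
  assumes "z * (1 - x\<^sup>2 + 2 * x) = 1 - x\<^sup>2 - 2 * x"
  shows "1 - x\<^sup>2 + 2 * x \<noteq> 0"
proof
  assume *: "1 - x\<^sup>2 + 2 * x = 0"
  then have "1 - x\<^sup>2 - 2 * x = 0" using assms by simp
  with * have "x = 0" by algebra
  with * show False by simp
qed

text \<open>The two relations combine to 4 (x - y) (1 + x y) = 0. The only other solution for the
  same z is thus -1 / x, which lies outside the disk.\<close>

lemma cusp_map0_unique: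
  assumes "z * (1 - x\<^sup>2 + 2 * x) = 1 - x\<^sup>2 - 2 * x" "z * (1 - y\<^sup>2 + 2 * y) = 1 - y\<^sup>2 - 2 * y"
    "cmod x < 1" "cmod y < 1"
  shows "x = (y :: complex)"
proof -
  have "4 * (x - y) * (1 + x * y) = 0"
    using assms(1,2) cusp_denominator_nonzero[OF assms(1)] cusp_denominator_nonzero[OF assms(2)] by algebra
  moreover have "1 + x * y \<noteq> 0"
  proof
    assume "1 + x * y = 0"
    then have "x * y = -1" by (simp add: eq_neg_iff_add_eq_0 add.commute)
    then have "cmod x * cmod y = 1" by (metis norm_minus_cancel norm_mult norm_one)
    moreover have "cmod x * cmod y < 1 * 1"
      using assms by (intro mult_strict_mono') auto
    ultimately show False by simp
  qed
  ultimately show ?thesis by simp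
qed

lemma cusp_map2_facts:
  assumes z: "z \<in> unit_disk"
  shows "Re (cusp_map2 z) > 1" "\<bar>Im (cusp_map2 z)\<bar> < 1"
    "cmod (cusp_map0 z) = exp (- (pi / 2) * (Re (cusp_map2 z) - 1))" "cusp_map2 z \<noteq> 0"
proof -
  note x = cusp_map0_facts[OF z]
  have x0: "cusp_map0 z \<noteq> 0" using x(5) by auto
  have Re2: "Re (cusp_map2 z) = 1 - 2 / pi * ln (cmod (cusp_map0 z))"
    using x0 by (simp add: cusp_map2_def cusp_map1_def)
  have "ln (cmod (cusp_map0 z)) < 0" using x(4) x0 by simp
  then show "Re (cusp_map2 z) > 1" unfolding Re2 using pi_gt_zero by (simp add: divide_less_0_iff mult_less_0_iff)
  then show "cusp_map2 z \<noteq> 0" by auto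
  have "\<bar>Im (Ln (cusp_map0 z))\<bar> < pi / 2" using x(5) x0 Re_Ln_pos_lt by blast
  then have "\<bar>2 / pi * Im (Ln (cusp_map0 z))\<bar> < 1"
    using pi_gt_zero by (simp add: abs_mult field_simps)
  then show "\<bar>Im (cusp_map2 z)\<bar> < 1" by (simp add: cusp_map2_def cusp_map1_def)
  show "cmod (cusp_map0 z) = exp (- (pi / 2) * (Re (cusp_map2 z) - 1))"
    unfolding Re2 using x0 by simp
qed

lemma cusp_map_holomorphic: "cusp_map holomorphic_on unit_disk"
proof -
  have 0: "cusp_map0 holomorphic_on unit_disk"
    unfolding cusp_map0_def using cusp_map0_facts by (intro holomorphic_intros) auto
  have "cusp_map0 z \<notin> \<real>\<^sub>\<le>\<^sub>0" if "z \<in> unit_disk" for z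
    using cusp_map0_facts(5)[OF that] by (auto simp: complex_nonpos_Reals_iff)
  then have 1: "cusp_map1 holomorphic_on unit_disk"
    unfolding cusp_map1_def using 0 by (intro holomorphic_intros) auto
  have 2: "cusp_map2 holomorphic_on unit_disk"
    unfolding cusp_map2_def using 1 by (intro holomorphic_intros) auto
  show ?thesis
    unfolding cusp_map_def cusp_map3_def using 2 cusp_map2_facts by (intro holomorphic_intros) auto
qed

lemma cusp_map_inj: "inj_on cusp_map unit_disk"
proof (rule inj_onI)
  fix z w assume zw: "z \<in> unit_disk" "w \<in> unit_disk" "cusp_map z = cusp_map w"
  have a: "cusp_const \<noteq> 0" using cusp_const_bounds by simp
  have "cusp_map2 z = cusp_map2 w"
    using zw a cusp_map2_facts(4)[OF zw(1)] cusp_map2_facts(4)[OF zw(2)]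
    by (simp add: cusp_map_def cusp_map3_def field_simps)
  then have "Ln (cusp_map0 z) = Ln (cusp_map0 w)"
    by (simp add: cusp_map2_def cusp_map1_def)
  moreover have "cusp_map0 z \<noteq> 0" "cusp_map0 w \<noteq> 0"
    using cusp_map0_facts(5)[OF zw(1)] cusp_map0_facts(5)[OF zw(2)] by auto
  ultimately have eq: "cusp_map0 z = cusp_map0 w" by (metis exp_Ln)
  show "z = w"
    using cusp_map0_facts(6)[OF zw(1)] cusp_map0_facts(6)[OF zw(2)]
      cusp_denominator_nonzero[OF cusp_map0_facts(6)[OF zw(1)]]
    unfolding eq by (metis mult_cancel_right)
qed

text \<open>Everything is read off from s = a / \<zeta>. From |Im \<zeta>| < 1 < Re \<zeta> follow
  |\<zeta>| <= 2 Re \<zeta> and, as a > 1, |Im s| <= |s|^2; from Re \<zeta> > 1 follows |s|^2 <= a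
  Re s, so that 1 - |1 - s|^2 = 2 Re s - |s|^2 >= (2 - a) Re s. The last claim combines |x| = exp (-
  (pi / 2) (Re \<zeta> - 1)) with 1 - |z|^2 = O(|x|).\<close>

lemma cusp_map_geometry:
  assumes z: "z \<in> unit_disk"
  defines "s \<equiv> 1 - cusp_map z"
  shows "s \<noteq> 0" "cmod s \<le> 2 * Re s" "cmod s \<le> cusp_const" "\<bar>Im s\<bar> \<le> 4 * (Re s)\<^sup>2"
    "(2 - cusp_const) / 4 * cmod s \<le> 1 - cmod (cusp_map z)" "cusp_map z \<in> unit_disk"
    "1 - (cmod z)\<^sup>2 \<le> 19 * exp (pi / 2) * exp (- 1 / (2 * cmod s))"
proof -
  define \<zeta> where "\<zeta> = cusp_map2 z"
  define a where "a = cusp_const"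
  have a: "1 < a" "a < 2" using cusp_const_bounds by (auto simp: a_def)
  have \<zeta>: "Re \<zeta> > 1" "\<bar>Im \<zeta>\<bar> < 1" "\<zeta> \<noteq> 0" using cusp_map2_facts[OF z] by (auto simp: \<zeta>_def)
  have s: "s = of_real a / \<zeta>" by (simp add: s_def cusp_map_def cusp_map3_def a_def \<zeta>_def)
  show s0: "s \<noteq> 0" using s a \<zeta> by auto
  have n\<zeta>: "cmod \<zeta> > 0" using \<zeta> by simp
  have ns: "cmod s = a / cmod \<zeta>" using a by (simp add: s norm_divide)
  have Re: "Re s = a * Re \<zeta> / (cmod \<zeta>)\<^sup>2" and Im: "Im s = - a * Im \<zeta> / (cmod \<zeta>)\<^sup>2"
    unfolding s by (simp_all add: Re_divide Im_divide cmod_power2)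
  have le2: "cmod \<zeta> \<le> 2 * Re \<zeta>"
    using cmod_le[of \<zeta>] \<zeta> by auto
  have "a * cmod \<zeta> / (cmod \<zeta>)\<^sup>2 \<le> 2 * (a * Re \<zeta>) / (cmod \<zeta>)\<^sup>2"
    using mult_left_mono[OF le2, of a] a by (intro divide_right_mono) auto
  then show sRe: "cmod s \<le> 2 * Re s"
    unfolding ns Re using n\<zeta> by (simp add: power2_eq_square)
  have "1 \<le> cmod \<zeta>" using complex_Re_le_cmod[of \<zeta>] \<zeta> by linarith
  then have "a / cmod \<zeta> \<le> a / 1" using a by (intro divide_left_mono) auto
  then show "cmod s \<le> cusp_const" by (simp add: ns a_def)
  have "\<bar>Im s\<bar> \<le> a * 1 / (cmod \<zeta>)\<^sup>2"
    unfolding Im using a \<zeta> by (simp add: abs_mult divide_right_mono)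
  also have "\<dots> \<le> (cmod s)\<^sup>2"
    unfolding ns power_divide using a n\<zeta> by (intro divide_right_mono) (auto simp: power2_eq_square)
  also have "\<dots> \<le> (2 * Re s)\<^sup>2" using sRe by (intro power_mono) auto
  finally show "\<bar>Im s\<bar> \<le> 4 * (Re s)\<^sup>2" by (simp add: power_mult_distrib)
  have "a * 1 \<le> a * Re \<zeta>" using a \<zeta> by (intro mult_left_mono) auto
  then have "a * (a * 1) / (cmod \<zeta>)\<^sup>2 \<le> a * (a * Re \<zeta>) / (cmod \<zeta>)\<^sup>2"
    using a by (intro divide_right_mono mult_left_mono) auto
  then have sa: "(cmod s)\<^sup>2 \<le> a * Re s"
    unfolding ns Re by (simp add: power_divide power2_eq_square)
  have w: "cusp_map z = 1 - s" by (simp add: s_def)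
  have "(cmod (1 - s))\<^sup>2 = 1 - 2 * Re s + (cmod s)\<^sup>2"
    unfolding cmod_power2 by (simp add: power2_eq_square algebra_simps)
  then have gap: "(2 - a) * Re s \<le> 1 - (cmod (cusp_map z))\<^sup>2"
    using sa by (simp add: w algebra_simps)
  have gap2: "(2 - a) / 2 * cmod s \<le> 1 - (cmod (cusp_map z))\<^sup>2"
  proof -
    have "(2 - a) / 2 * cmod s \<le> (2 - a) / 2 * (2 * Re s)"
      using a by (intro mult_left_mono sRe) auto
    also have "\<dots> = (2 - a) * Re s" by (simp add: field_simps)
    finally show ?thesis using gap by linarith
  qed
  have "0 < (2 - a) / 2 * cmod s" using a s0 by simp
  then have "(cmod (cusp_map z))\<^sup>2 < 1" using gap2 by linarith
  then show disk: "cusp_map z \<in> unit_disk" by (simp add: abs_square_less_1)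
  show "(2 - cusp_const) / 4 * cmod s \<le> 1 - cmod (cusp_map z)"
    using gap2 disk_weight_bounds(2)[OF disk] by (simp add: a_def)
  define x where "x = cusp_map0 z"
  note xz = cusp_map0_facts[OF z, folded x_def]
  \<comment> \<open>From (1 - z) (1 - x^2 + 2 x) = 4 x. For |x| <= 1/4 the second factor is at least
    7/16 in modulus, and 2 * 4 * 16/7 < 19; for larger |x| the right-hand side exceeds 1.\<close>
  have bx: "1 - (cmod z)\<^sup>2 \<le> 19 * cmod x"
  proof (cases "cmod x \<le> 1 / 4")
    case True
    have d0: "1 - x\<^sup>2 + 2 * x \<noteq> 0" by (rule cusp_denominator_nonzero[OF xz(6)])
    have "(1 - z) * (1 - x\<^sup>2 + 2 * x) = 4 * x" using xz(6) by (simp add: algebra_simps)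
    then have e: "cmod (1 - z) * cmod (1 - x\<^sup>2 + 2 * x) = 4 * cmod x"
      by (metis norm_mult norm_numeral)
    have "cmod (x\<^sup>2 - 2 * x) \<le> (cmod x)\<^sup>2 + 2 * cmod x"
      by (rule order_trans[OF norm_triangle_ineq4]) (simp add: norm_mult norm_power)
    also have "\<dots> \<le> (1/4)\<^sup>2 + 2 * (1 / 4)" using True by (intro add_mono power_mono) auto
    finally have "7 / 16 \<le> cmod (1 - (x\<^sup>2 - 2 * x))"
      using norm_triangle_ineq2[of 1 "x\<^sup>2 - 2 * x"] by (simp add: power2_eq_square)
    also have "1 - (x\<^sup>2 - 2 * x) = 1 - x\<^sup>2 + 2 * x" by simp
    finally have "7 / 16 * cmod (1 - z) \<le> 4 * cmod x"
      using e mult_left_mono[of "7 / 16" "cmod (1 - x\<^sup>2 + 2 * x)" "cmod (1 - z)"] by (simp add: mult.commute)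
    moreover have "1 - cmod z \<le> cmod (1 - z)" using norm_triangle_ineq2[of 1 z] by simp
    ultimately show ?thesis using disk_weight_bounds(2)[OF z] norm_ge_zero[of x] by argo
  next
    case False
    then show ?thesis using zero_le_power2[of "cmod z"] by linarith
  qed
  have "pi / 2 * Re \<zeta> \<ge> 1 / (2 * cmod s)"
  proof -
    have "1 / (2 * cmod s) = cmod \<zeta> / (2 * a)" using a n\<zeta> by (simp add: ns)
    also have "\<dots> \<le> cmod \<zeta> / 2" using a n\<zeta> by (intro divide_left_mono) auto
    also have "\<dots> \<le> 1 * Re \<zeta>" using le2 by simp
    also have "\<dots> \<le> pi / 2 * Re \<zeta>" using \<zeta> pi_gt3 by (intro mult_right_mono) auto
    finally show ?thesis .
  qed
  then have "cmod x \<le> exp (pi / 2 + - 1 / (2 * cmod s))"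
    unfolding x_def cusp_map2_facts(3)[OF z] by (simp add: \<zeta>_def field_simps)
  then show "1 - (cmod z)\<^sup>2 \<le> 19 * exp (pi / 2) * exp (- 1 / (2 * cmod s))"
    using bx unfolding exp_add by linarith
qed

text \<open>The chain of maps is inverted explicitly on the real axis, and
  \<open>cusp_map0_unique\<close> certifies that \<open>x\<close> is the value of
  \<open>cusp_map0\<close> at \<open>u\<close>. The exponent 4 bounds (pi / 2) a, since pi < 4 and a
  < 2.\<close>

lemma cusp_map_real_preimage:
  assumes w: "0 \<le> w" "w < 1"
  obtains u :: real where "0 \<le> u" "u < 1" "cusp_map (of_real u) = of_real w" "exp (- 4 / (1 - w)) \<le> 1 - u"
proof -
  define a where "a = cusp_const"
  have a: "1 < a" "a < 2" using cusp_const_bounds by (auto simp: a_def)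
  define s where "s = 1 - w"
  have s: "0 < s" "s \<le> 1" using w by (auto simp: s_def)
  define \<zeta> where "\<zeta> = a / s"
  have \<zeta>: "\<zeta> \<ge> a" using a s by (simp add: \<zeta>_def field_simps)
  define x where "x = exp (- (pi / 2) * (\<zeta> - 1))"
  have x0: "x > 0" by (simp add: x_def)
  have sq: "sqrt 2 > 1" "sqrt 2 < 1.5" using sqrt_2_bounds by auto
  \<comment> \<open>Here w >= 0 enters: \<zeta> >= a amounts to x <= sqrt 2 - 1, where the numerator
    of \<open>u\<close> vanishes, and so u >= 0.\<close>
  have "(pi / 2) * (\<zeta> - 1) \<ge> (pi / 2) * (a - 1)" using \<zeta> by (intro mult_left_mono) auto
  then have "x \<le> exp (- (pi / 2) * (a - 1))" by (simp add: x_def)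
  also have "- (pi / 2) * (a - 1) = ln (sqrt 2 - 1)" by (simp add: a_def cusp_const_def)
  also have "exp (ln (sqrt 2 - 1)) = sqrt 2 - 1" using sq by simp
  finally have x1: "x \<le> sqrt 2 - 1" .
  then have xh: "x < 1 / 2" using sq by simp
  have "(x + 1)\<^sup>2 \<le> (sqrt 2)\<^sup>2" using x0 x1 by (intro power_mono) auto
  then have num: "1 - x\<^sup>2 - 2 * x \<ge> 0" by (simp add: power2_eq_square algebra_simps)
  have x2: "x\<^sup>2 \<le> 1 / 4" using x0 xh power_mono[of x "1/2" 2] by (simp add: power2_eq_square)
  have den: "1 - x\<^sup>2 + 2 * x > 0" "1 - x\<^sup>2 + 2 * x \<le> 2" using x0 x2 xh zero_le_power2[of x] by linarith+
  define u where "u = (1 - x\<^sup>2 - 2 * x) / (1 - x\<^sup>2 + 2 * x)"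
  have u: "0 \<le> u" "u < 1" using num den x0 by (auto simp: u_def)
  have uD: "of_real u \<in> unit_disk" using u by simp
  have ueq: "u * (1 - x\<^sup>2 + 2 * x) = 1 - x\<^sup>2 - 2 * x" using den by (simp add: u_def)
  then have "complex_of_real (u * (1 - x\<^sup>2 + 2 * x)) = of_real (1 - x\<^sup>2 - 2 * x)"
    by (rule arg_cong)
  then have eq: "of_real u * (1 - (of_real x)\<^sup>2 + 2 * of_real x) = 1 - (of_real x)\<^sup>2 - 2 * (of_real x :: complex)"
    by simp
  have nx: "cmod (of_real x) < 1" using x0 xh by simp
  have "cusp_map0 (of_real u) = of_real x"
    by (rule cusp_map0_unique[OF cusp_map0_facts(6)[OF uD] eq cusp_map0_facts(4)[OF uD] nx])
  then have "cusp_map2 (of_real u) = of_real \<zeta>"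
    using x0 by (simp add: cusp_map2_def cusp_map1_def Ln_of_real) (simp add: x_def)
  then have chi: "cusp_map (of_real u) = of_real w"
    using a s by (simp add: cusp_map_def cusp_map3_def a_def[symmetric] \<zeta>_def s_def)
  have "(1 - u) * (1 - x\<^sup>2 + 2 * x) = 4 * x" using ueq by (simp add: algebra_simps)
  moreover have "(1 - u) * (1 - x\<^sup>2 + 2 * x) \<le> (1 - u) * 2" using u den by (intro mult_left_mono) auto
  ultimately have "4 * x \<le> (1 - u) * 2" by simp
  moreover have "x \<le> 2 * x" using x0 by simp
  ultimately have ux: "x \<le> 1 - u" by simp
  have "pi / 2 * a \<le> 2 * 2" using a pi_less_4 by (intro mult_mono) auto
  then have "(pi / 2 * a) / s \<le> 4 / s" using s by (intro divide_right_mono) auto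
  moreover have "- (pi / 2) * (\<zeta> - 1) = pi / 2 - (pi / 2 * a) / s" by (simp add: \<zeta>_def field_simps)
  ultimately have "- 4 / s \<le> - (pi / 2) * (\<zeta> - 1)" using pi_gt_zero by linarith
  then have "exp (- 4 / s) \<le> x" by (simp add: x_def)
  with ux have "exp (- 4 / (1 - w)) \<le> 1 - u" by (simp add: s_def)
  with u chi show ?thesis using that by blast
qed

lemma cusp_map_0: "cusp_map 0 = 0"
proof -
  define x where "x = cusp_map0 0"
  note f = cusp_map0_facts[of 0, folded x_def]
  have sq: "sqrt 2 > 1" "sqrt 2 < 1.5" using sqrt_2_bounds by auto
  \<comment> \<open>The root in the disk of 1 - y^2 - 2 y, to which the relation of
    \<open>cusp_map0_facts\<close> reduces at z = 0.\<close>
  define y where "y = sqrt 2 - 1"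
  have "1 - y\<^sup>2 - 2 * y = 0" by (simp add: y_def power2_eq_square algebra_simps)
  then have "complex_of_real (1 - y\<^sup>2 - 2 * y) = of_real 0"
    by (rule arg_cong)
  then have eq: "0 * (1 - (of_real y)\<^sup>2 + 2 * of_real y) = 1 - (of_real y)\<^sup>2 - 2 * (of_real y :: complex)"
    by simp
  have "cmod (of_real y) < 1" using sq by (simp add: y_def del: of_real_diff)
  then have "x = of_real y"
    using cusp_map0_unique[OF f(6) eq f(4)] by simp
  moreover have "y > 0" using sq by (simp add: y_def)
  ultimately have "Ln (cusp_map0 0) = of_real (ln y)"
    by (simp add: x_def[symmetric] Ln_of_real)
  then have "cusp_map2 0 = of_real cusp_const"
    by (simp add: cusp_map2_def cusp_map1_def cusp_const_def y_def)
  then show ?thesis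
    using cusp_const_bounds by (simp add: cusp_map_def cusp_map3_def)
qed

lemma cusp_map_schwarz: "z \<in> unit_disk \<Longrightarrow> cmod (cusp_map z) \<le> cmod z"
  using Schwarz_Lemma(1)[OF cusp_map_holomorphic cusp_map_0] cusp_map_geometry(6) by auto

section \<open>Energies pulled back by the cusp map\<close>

lemma distr_Complex: "distr (lborel \<Otimes>\<^sub>M lborel) borel (\<lambda>(x, y). Complex x y) = lborel"
proof (rule lborel_eqI[symmetric])
  have cont: "continuous_on UNIV (\<lambda>p::real \<times> real. Complex (fst p) (snd p))"
    unfolding Complex_eq by (intro continuous_intros)
  then have [measurable]: "(\<lambda>p::real \<times> real. Complex (fst p) (snd p)) \<in> borel_measurable borel"
    by (rule borel_measurable_continuous_onI)
  fix l u :: complex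
  assume le: "\<And>b. b \<in> Basis \<Longrightarrow> l \<bullet> b \<le> u \<bullet> b"
  have le': "Re l \<le> Re u" "Im l \<le> Im u"
    using le[of 1] le[of \<i>] by (auto simp: Basis_complex_def)
  have "(\<lambda>p. Complex (fst p) (snd p)) -` box l u = box (Re l, Im l) (Re u, Im u)"
    by (auto simp: mem_box Basis_complex_def Basis_prod_def)
  moreover have "emeasure lborel (box (Re l, Im l) (Re u, Im u)) = ennreal ((Re u - Re l) * (Im u - Im l))"
    using le' by (subst emeasure_lborel_box) (auto simp: Basis_prod_def)
  ultimately show "emeasure (distr (lborel \<Otimes>\<^sub>M lborel) borel (\<lambda>(x, y). Complex x y)) (box l u) = (\<Prod>b\<in>Basis. (u - l) \<bullet> b)"
    by (simp add: lborel_prod split_beta' emeasure_distr Basis_complex_def)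
qed simp

text \<open>Tonelli in real coordinates, for slicing the cusp vertically.\<close>

lemma nn_integral_Complex:
  assumes [measurable]: "f \<in> borel_measurable borel"
  shows "(\<integral>\<^sup>+z. f z \<partial>lborel) = (\<integral>\<^sup>+x. (\<integral>\<^sup>+y. f (Complex x y) \<partial>lborel) \<partial>lborel)"
proof -
  have "continuous_on UNIV (\<lambda>p::real \<times> real. Complex (fst p) (snd p))"
    unfolding Complex_eq by (intro continuous_intros)
  then have "(\<lambda>p::real \<times> real. Complex (fst p) (snd p)) \<in> borel_measurable borel"
    by (rule borel_measurable_continuous_onI)
  then have [measurable]: "(\<lambda>(x, y). Complex x y) \<in> lborel \<Otimes>\<^sub>M lborel \<rightarrow>\<^sub>M borel"
    by (simp add: lborel_prod split_beta')
  have "(\<integral>\<^sup>+z. f z \<partial>lborel) = (\<integral>\<^sup>+p. f (case p of (x, y) \<Rightarrow> Complex x y) \<partial>(lborel \<Otimes>\<^sub>M lborel))"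
    by (subst distr_Complex[symmetric], subst nn_integral_distr) auto
  also have "\<dots> = (\<integral>\<^sup>+x. (\<integral>\<^sup>+y. f (case (x, y) of (x, y) \<Rightarrow> Complex x y) \<partial>lborel) \<partial>lborel)"
    by (rule lborel.nn_integral_fst[symmetric]) measurable
  finally show ?thesis by simp
qed

text \<open>The vertical slice at abscissa x has length 8 (1 - x)^2, which cancels the singular
  factor; what is left is 8 on an interval of length h.\<close>

lemma cusp_area_estimate:
  assumes h: "h > 0"
  shows "(\<integral>\<^sup>+w. ennreal (indicator {w. 0 < 1 - Re w \<and> 1 - Re w < h \<and> \<bar>Im w\<bar> \<le> 4 * (1 - Re w)\<^sup>2} w / (1 - Re w)\<^sup>2) \<partial>lborel) \<le> ennreal (8 * h)"
    (is "(\<integral>\<^sup>+w. ennreal (indicator ?S w / _) \<partial>lborel) \<le> _")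
proof -
  have [measurable]: "Re \<in> borel_measurable borel" "Im \<in> borel_measurable borel"
    by (intro borel_measurable_continuous_onI continuous_intros)+
  have "(\<integral>\<^sup>+w. ennreal (indicator ?S w / (1 - Re w)\<^sup>2) \<partial>lborel) =
     (\<integral>\<^sup>+x. (\<integral>\<^sup>+y. ennreal (indicator ?S (Complex x y) / (1 - x)\<^sup>2) \<partial>lborel) \<partial>lborel)"
    by (subst nn_integral_Complex) auto
  also have "\<dots> \<le> (\<integral>\<^sup>+x. 8 * indicator {1 - h..1} x \<partial>lborel)"
  proof (intro nn_integral_mono)
    fix x :: real
    show "(\<integral>\<^sup>+y. ennreal (indicator ?S (Complex x y) / (1 - x)\<^sup>2) \<partial>lborel) \<le> 8 * indicator {1 - h..1} x"
    proof (cases "0 < 1 - x \<and> 1 - x < h")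
      case True
      have "(\<integral>\<^sup>+y. ennreal (indicator ?S (Complex x y) / (1 - x)\<^sup>2) \<partial>lborel) =
         (\<integral>\<^sup>+y. ennreal (1 / (1 - x)\<^sup>2) * indicator {- (4 * (1 - x)\<^sup>2)..4 * (1 - x)\<^sup>2} y \<partial>lborel)"
        using True by (intro nn_integral_cong) (auto simp: indicator_def)
      also have "\<dots> = ennreal (1 / (1 - x)\<^sup>2) * ennreal (8 * (1 - x)\<^sup>2)"
        by (subst nn_integral_cmult_indicator) (auto simp: mult.commute)
      also have "\<dots> = 8"
        using True by (subst ennreal_mult[symmetric]) auto
      finally show ?thesis using True by simp
    next
      case False
      then have "indicator ?S (Complex x y) = (0::real)" for y
        by (auto simp: indicator_def)
      then show ?thesis by simp
    qed
  qed
  also have "\<dots> = ennreal (8 * h)"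
    using h by (subst nn_integral_cmult_indicator) (auto simp: ennreal_mult)
  finally show ?thesis .
qed

text \<open>With g = f' this is the energy of the derivative of f composed with
  \<open>cusp_map\<close>, taken over those z whose image lies in \<open>B\<close>.\<close>

abbreviation pull_energy :: "real \<Rightarrow> complex set \<Rightarrow> (complex \<Rightarrow> complex) \<Rightarrow> ennreal" where
  "pull_energy \<alpha> B g \<equiv> energy \<alpha> (unit_disk \<inter> cusp_map -` B) (\<lambda>z. g (cusp_map z) * deriv cusp_map z)"

lemmas cusp_energy_composition_le =
  energy_composition_le[OF cusp_map_holomorphic cusp_map_inj]

lemma cusp_map_image_disk: "cusp_map ` unit_disk \<subseteq> unit_disk"
  using cusp_map_geometry(6) by blast

lemma cusp_weight_le:
  assumes \<alpha>: "\<alpha> \<ge> 0" and z: "z \<in> unit_disk"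
  shows "(1 - (cmod z)\<^sup>2) powr \<alpha> \<le> 1 * (1 - (cmod (cusp_map z))\<^sup>2) powr \<alpha>"
proof -
  have "(cmod (cusp_map z))\<^sup>2 \<le> (cmod z)\<^sup>2"
    by (intro power_mono cusp_map_schwarz z) auto
  then show ?thesis
    using \<alpha> disk_weight_bounds[OF z] by (simp add: powr_mono2)
qed

lemma pull_energy_le_image:
  assumes "\<alpha> \<ge> 0" "g holomorphic_on unit_disk" "B \<in> sets borel"
  shows "pull_energy \<alpha> B g \<le> energy \<alpha> (cusp_map ` unit_disk \<inter> B) g"
  using cusp_energy_composition_le[OF cusp_map_image_disk assms(2,3), of 1 \<alpha>] cusp_weight_le[OF assms(1)] by simp

text \<open>With \<sigma> = |1 - w| < h, the factor exp (-1 / (2 \<sigma>)) that bounds 1 - |z|^2 is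
  split into two equal factors exp (-1 / (4 \<sigma>)). One is at most 4 \<sigma> and pays for the
  passage to 1 - |w|^2 >= c \<sigma>; the other is at most exp (-1 / (4 h)) and is the gain.\<close>

lemma pull_energy_tail_positive:
  assumes \<alpha>: "\<alpha> \<ge> 0"
  obtains C where "C > 0" "\<And>h g. h > 0 \<Longrightarrow> g holomorphic_on unit_disk \<Longrightarrow>
    pull_energy \<alpha> {w. cmod (1 - w) < h} g \<le> ennreal (C * exp (- \<alpha> / (4 * h))) * energy \<alpha> unit_disk g"
proof -
  define M where "M = 19 * exp (pi / 2)"
  define c where "c = (2 - cusp_const) / 4"
  have c: "c > 0" using cusp_const_bounds by (simp add: c_def)
  have M: "M > 0" by (simp add: M_def)
  define C where "C = (4 * M / c) powr \<alpha>"
  have "C > 0" using c M by (simp add: C_def)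
  moreover have "pull_energy \<alpha> {w. cmod (1 - w) < h} g \<le> ennreal (C * exp (- \<alpha> / (4 * h))) * energy \<alpha> unit_disk g"
    if h: "h > 0" and g: "g holomorphic_on unit_disk" for h g
  proof -
    have "(1 - (cmod z)\<^sup>2) powr \<alpha> \<le> (C * exp (- \<alpha> / (4 * h))) * (1 - (cmod (cusp_map z))\<^sup>2) powr \<alpha>"
      if z: "z \<in> unit_disk" and zh: "cmod (1 - cusp_map z) < h" for z
    proof -
      define \<sigma> where "\<sigma> = cmod (1 - cusp_map z)"
      note geo = cusp_map_geometry[OF z]
      have \<sigma>: "0 < \<sigma>" "\<sigma> < h" using geo(1) zh by (auto simp: \<sigma>_def)
      have "exp (1 / (4 * \<sigma>)) \<ge> 1 / (4 * \<sigma>)" using exp_ge_add_one_self[of "1 / (4 * \<sigma>)"] by linarith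
      then have "1 / exp (1 / (4 * \<sigma>)) \<le> 1 / (1 / (4 * \<sigma>))" using \<sigma> by (intro divide_left_mono) auto
      then have e1: "exp (- 1 / (4 * \<sigma>)) \<le> 4 * \<sigma>" by (simp add: exp_minus inverse_eq_divide)
      have e2: "exp (- 1 / (4 * \<sigma>)) \<le> exp (- 1 / (4 * h))" using \<sigma> by (simp add: frac_le)
      have "1 - (cmod z)\<^sup>2 \<le> M * exp (- 1 / (2 * \<sigma>))" using geo(7) by (simp add: M_def \<sigma>_def)
      also have "exp (- 1 / (2 * \<sigma>)) = exp (- 1 / (4 * \<sigma>)) * exp (- 1 / (4 * \<sigma>))"
        by (simp add: exp_add[symmetric])
      also have "M * \<dots> \<le> M * (4 * \<sigma> * exp (- 1 / (4 * h)))"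
        using M e1 e2 \<sigma> by (intro mult_left_mono mult_mono) auto
      also have "\<dots> = 4 * M / c * exp (- 1 / (4 * h)) * (c * \<sigma>)" using c by simp
      also have "\<dots> \<le> 4 * M / c * exp (- 1 / (4 * h)) * (1 - (cmod (cusp_map z))\<^sup>2)"
        using geo(5) disk_weight_bounds(1)[OF geo(6)] c M by (intro mult_left_mono) (auto simp: c_def \<sigma>_def)
      finally have "(1 - (cmod z)\<^sup>2) powr \<alpha> \<le> (4 * M / c * exp (- 1 / (4 * h)) * (1 - (cmod (cusp_map z))\<^sup>2)) powr \<alpha>"
        using \<alpha> disk_weight_bounds[OF z] by (intro powr_mono2) auto
      also have "\<dots> = (C * exp (- \<alpha> / (4 * h))) * (1 - (cmod (cusp_map z))\<^sup>2) powr \<alpha>"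
      proof -
        have "(4 * M / c * exp (- 1 / (4 * h)) * (1 - (cmod (cusp_map z))\<^sup>2)) powr \<alpha> =
          (4 * M / c) powr \<alpha> * exp (- 1 / (4 * h)) powr \<alpha> * (1 - (cmod (cusp_map z))\<^sup>2) powr \<alpha>"
          unfolding powr_mult ..
        also have "exp (- 1 / (4 * h)) powr \<alpha> = exp (- \<alpha> / (4 * h))"
          by (simp add: exp_powr_real)
        finally show ?thesis by (simp add: C_def)
      qed
      finally show ?thesis .
    qed
    then have "pull_energy \<alpha> {w. cmod (1 - w) < h} g \<le>
       ennreal (C * exp (- \<alpha> / (4 * h))) * energy \<alpha> (cusp_map ` unit_disk \<inter> {w. cmod (1 - w) < h}) g"
      using \<open>C > 0\<close> g by (intro cusp_energy_composition_le[OF cusp_map_image_disk]) auto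
    also have "\<dots> \<le> ennreal (C * exp (- \<alpha> / (4 * h))) * energy \<alpha> unit_disk g"
      using cusp_map_image_disk by (intro mult_left_mono energy_mono_set) auto
    finally show ?thesis .
  qed
  ultimately show ?thesis using that by blast
qed

text \<open>With exponent 0 the weight yields no gain, so the area has to: the pointwise bound and 1
  - |w| >= c Re (1 - w) give \<open>(cmod (g w))\<^sup>2 \<le> A * E / (1 - Re w)\<^sup>2\<close>,
  and \<open>cusp_area_estimate\<close> integrates this over the thin cusp.\<close>

lemma pull_energy_tail_zero:
  obtains C where "C > 0" "\<And>h g. h > 0 \<Longrightarrow> g holomorphic_on unit_disk \<Longrightarrow>
    pull_energy 0 {w. cmod (1 - w) < h} g \<le> ennreal (C * h) * energy 0 unit_disk g"
proof -
  define c where "c = (2 - cusp_const) / 4"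
  have c: "c > 0" using cusp_const_bounds by (simp add: c_def)
  define A where "A = 4 / (pi * c\<^sup>2)"
  have A: "A > 0" using c by (simp add: A_def)
  have "pull_energy 0 {w. cmod (1 - w) < h} g \<le> ennreal ((8 * A) * h) * energy 0 unit_disk g"
    if h: "h > 0" and g: "g holomorphic_on unit_disk" for h g
  proof (cases "energy 0 unit_disk g = \<infinity>")
    case True
    then show ?thesis using h A by (simp add: ennreal_mult_top)
  next
    case False
    then obtain E where E: "energy 0 unit_disk g = ennreal E" "E \<ge> 0"
      by (cases "energy 0 unit_disk g" rule: ennreal_cases) auto
    let ?B = "{w. cmod (1 - w) < h}"
    let ?S = "{w. 0 < 1 - Re w \<and> 1 - Re w < h \<and> \<bar>Im w\<bar> \<le> 4 * (1 - Re w)\<^sup>2}"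
    have "pull_energy 0 ?B g \<le> energy 0 (cusp_map ` unit_disk \<inter> ?B) g"
      by (intro pull_energy_le_image g) auto
    also have "\<dots> \<le> (\<integral>\<^sup>+w. ennreal (A * E) * ennreal (indicator ?S w / (1 - Re w)\<^sup>2) \<partial>lborel)"
      unfolding energy_def
    proof (intro nn_integral_mono)
      fix w
      show "ennreal (indicator (cusp_map ` unit_disk \<inter> ?B) w * ((cmod (g w))\<^sup>2 * (1 - (cmod w)\<^sup>2) powr 0))
         \<le> ennreal (A * E) * ennreal (indicator ?S w / (1 - Re w)\<^sup>2)"
      proof (cases "w \<in> cusp_map ` unit_disk \<inter> ?B")
        case True
        then obtain z where z: "z \<in> unit_disk" "w = cusp_map z" "cmod (1 - w) < h" by auto
        note geo = cusp_map_geometry[OF z(1), folded z(2)]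
        have s: "cmod (1 - w) > 0" "Re (1 - w) > 0" using geo(1,2) zero_less_norm_iff[of "1 - w"] by linarith+
        have S: "w \<in> ?S" using geo(4) s z(3) complex_Re_le_cmod[of "1 - w"] by simp
        have "ennreal ((cmod (g w))\<^sup>2 * (pi / 4 * (1 - cmod w) powr 2)) \<le> ennreal E"
          using pointwise_energy_bound[OF order_refl g geo(6)] E by simp
        then have "(cmod (g w))\<^sup>2 * (pi / 4 * (1 - cmod w)\<^sup>2) \<le> E"
          using E(2) disk_weight_bounds(3)[OF geo(6)] by simp
        moreover have "(c * Re (1 - w))\<^sup>2 \<le> (1 - cmod w)\<^sup>2"
        proof (rule power_mono)
          have "c * Re (1 - w) \<le> c * cmod (1 - w)" using c by (intro mult_left_mono complex_Re_le_cmod) auto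
          then show "c * Re (1 - w) \<le> 1 - cmod w" using geo(5) unfolding c_def by linarith
        qed (use c s in auto)
        then have "(cmod (g w))\<^sup>2 * (pi / 4 * (c * Re (1 - w))\<^sup>2) \<le> (cmod (g w))\<^sup>2 * (pi / 4 * (1 - cmod w)\<^sup>2)"
          by (intro mult_left_mono) auto
        ultimately have "(cmod (g w))\<^sup>2 * (pi / 4 * (c * Re (1 - w))\<^sup>2) \<le> E" by linarith
        then have "(cmod (g w))\<^sup>2 \<le> A * E * (1 / (1 - Re w)\<^sup>2)"
          using s c unfolding power_mult_distrib by (simp add: A_def field_simps)
        then have "(cmod (g w))\<^sup>2 * (1 - (cmod w)\<^sup>2) powr 0 \<le> A * E * (1 / (1 - Re w)\<^sup>2)"
          using disk_weight_bounds[OF geo(6)] by simp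
        then have "indicator (cusp_map ` unit_disk \<inter> ?B) w * ((cmod (g w))\<^sup>2 * (1 - (cmod w)\<^sup>2) powr 0) \<le> A * E * (indicator ?S w / (1 - Re w)\<^sup>2)"
          using True S by simp
        then show ?thesis
          using A E(2) by (subst ennreal_mult[symmetric]) (auto intro: ennreal_leI)
      qed auto
    qed
    also have "\<dots> = ennreal (A * E) * (\<integral>\<^sup>+w. ennreal (indicator ?S w / (1 - Re w)\<^sup>2) \<partial>lborel)"
    proof (rule nn_integral_cmult)
      have [measurable]: "Re \<in> borel_measurable borel" "Im \<in> borel_measurable borel"
        by (intro borel_measurable_continuous_onI continuous_intros)+
      show "(\<lambda>w. ennreal (indicator ?S w / (1 - Re w)\<^sup>2)) \<in> borel_measurable lborel" by measurable
    qed
    also have "\<dots> \<le> ennreal (A * E) * ennreal (8 * h)"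
      by (intro mult_left_mono cusp_area_estimate h) auto
    also have "\<dots> = ennreal ((8 * A) * h) * energy 0 unit_disk g"
      unfolding E(1) using A E(2) h by (simp add: ennreal_mult[symmetric] mult_ac)
    finally show ?thesis .
  qed
  moreover have "8 * A > 0" using A by simp
  ultimately show ?thesis using that by blast
qed

lemma dyadic_shell:
  fixes a \<sigma> :: real
  assumes "a / 2 ^ J \<le> \<sigma>" "\<sigma> \<le> a" "a > 0"
  shows "\<exists>j\<le>J. a / 2 ^ (j + 1) \<le> \<sigma> \<and> \<sigma> \<le> a / 2 ^ j"
  using assms(1)
proof (induction J)
  case 0
  then show ?case using assms(2,3) by (intro exI[of _ 0]) auto
next
  case (Suc J)
  show ?case
  proof (cases "a / 2 ^ J \<le> \<sigma>")
    case True
    then show ?thesis using Suc.IH le_SucI by blast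
  next
    case False
    then show ?thesis using Suc.prems by (intro exI[of _ J]) auto
  qed
qed

text \<open>The shell a / 2^(j+1) <= |1 - w| <= a / 2^j is blown up by 2^j into one fixed compact
  ball; a single finite net \<open>N\<close> there serves all shells, so each costs the same number
  of disks. An index (p, j) is a net point together with a shell.\<close>

lemma cusp_cover:
  obtains K :: nat where "K > 0" "\<And>J. \<exists>(I :: (complex \<times> nat) set) c r. finite I \<and> card I \<le> K * (J + 1) \<and>
     (\<forall>i\<in>I. r i > 0 \<and> 4 * r i \<le> 1 - cmod (c i)) \<and>
     {w \<in> cusp_map ` unit_disk. cusp_const / 2 ^ J \<le> cmod (1 - w)} \<subseteq> (\<Union>i\<in>I. ball (c i) (r i))"
proof -
  define a where "a = cusp_const"
  have a: "1 < a" "a < 2" using cusp_const_bounds by (auto simp: a_def)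
  define c1 where "c1 = (2 - a) / 4"
  have c1: "c1 > 0" using a by (simp add: c1_def)
  \<comment> \<open>Chosen so that 5 \<epsilon> / 2^j <= 1 - |w| for image points w in shell j;
    moving from w to the centre of its disk costs one \<epsilon> / 2^j and leaves the required
    four.\<close>
  define \<epsilon> where "\<epsilon> = c1 * a / 10"
  have \<epsilon>: "\<epsilon> > 0" using c1 a by (simp add: \<epsilon>_def)
  obtain N where N: "finite N" "cball (0::complex) a \<subseteq> (\<Union>p\<in>N. ball p \<epsilon>)"
    using compact_eq_totally_bounded[of "cball (0::complex) a"] \<epsilon> by (metis compact_cball)
  define c where "c = (\<lambda>(p::complex, j::nat). 1 - p / 2 ^ j)"
  define r where "r = (\<lambda>(p::complex, j::nat). \<epsilon> / 2 ^ j)"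
  have "\<exists>(I :: (complex \<times> nat) set) c r. finite I \<and> card I \<le> (card N + 1) * (J + 1) \<and>
     (\<forall>i\<in>I. r i > 0 \<and> 4 * r i \<le> 1 - cmod (c i)) \<and>
     {w \<in> cusp_map ` unit_disk. cusp_const / 2 ^ J \<le> cmod (1 - w)} \<subseteq> (\<Union>i\<in>I. ball (c i) (r i))" for J
  proof -
    \<comment> \<open>Disks too close to the circle are discarded; a disk that contains an image
      point of its own shell always survives.\<close>
    define I where "I = {i \<in> N \<times> {..J}. 4 * r i \<le> 1 - cmod (c i)}"
    have fin: "finite I" using N by (simp add: I_def)
    have "card I \<le> card (N \<times> {..J})" using N by (intro card_mono) (auto simp: I_def)
    also have "\<dots> \<le> (card N + 1) * (J + 1)" by (simp add: card_cartesian_product)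
    finally have card: "card I \<le> (card N + 1) * (J + 1)" .
    have r0: "\<forall>i\<in>I. r i > 0 \<and> 4 * r i \<le> 1 - cmod (c i)"
      using \<epsilon> by (auto simp: I_def r_def)
    have cov: "w \<in> (\<Union>i\<in>I. ball (c i) (r i))" if z: "z \<in> unit_disk" and w: "w = cusp_map z" "a / 2 ^ J \<le> cmod (1 - w)" for w z
    proof -
      note geo = cusp_map_geometry[OF z, folded w(1) a_def]
      obtain j where j: "j \<le> J" "a / 2 ^ (j + 1) \<le> cmod (1 - w)" "cmod (1 - w) \<le> a / 2 ^ j"
        using dyadic_shell[OF w(2) geo(3)] a by auto
      have "cmod (2 ^ j * (1 - w)) \<le> a"
        using j(3) unfolding norm_mult norm_power by (simp add: pos_le_divide_eq mult.commute)
      then obtain p where p: "p \<in> N" "2 ^ j * (1 - w) \<in> ball p \<epsilon>" using N(2) by (auto simp: subset_iff)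
      have "c (p, j) - w = (2 ^ j * (1 - w) - p) / 2 ^ j"
        by (simp add: c_def field_simps)
      then have "cmod (c (p, j) - w) = cmod (2 ^ j * (1 - w) - p) / 2 ^ j"
        by (simp add: norm_divide norm_power)
      also have "\<dots> < \<epsilon> / 2 ^ j"
        using p(2) by (intro divide_strict_right_mono) (auto simp: dist_norm norm_minus_commute)
      finally have d: "cmod (c (p, j) - w) < \<epsilon> / 2 ^ j" .
      have "cmod (c (p, j)) \<le> cmod w + \<epsilon> / 2 ^ j"
        using d norm_triangle_ineq2[of "c (p, j)" w] by linarith
      have "c1 * (a / 2 ^ (j + 1)) \<le> c1 * cmod (1 - w)"
        using j c1 by (intro mult_left_mono) auto
      moreover have "5 * (\<epsilon> / 2 ^ j) = c1 * (a / 2 ^ (j + 1))" by (simp add: \<epsilon>_def)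
      moreover have "c1 * cmod (1 - w) \<le> 1 - cmod w" using geo(5) by (simp add: c1_def)
      ultimately have "5 * (\<epsilon> / 2 ^ j) \<le> 1 - cmod w" by linarith
      with \<open>cmod (c (p, j)) \<le> cmod w + \<epsilon> / 2 ^ j\<close> have "4 * (\<epsilon> / 2 ^ j) \<le> 1 - cmod (c (p, j))" by linarith
      then have "(p, j) \<in> I" using p j by (simp add: I_def r_def)
      moreover have "w \<in> ball (c (p, j)) (r (p, j))" using d by (simp add: r_def dist_norm)
      ultimately show ?thesis by blast
    qed
    show ?thesis
      using fin card r0 cov by (intro exI[of _ I] exI[of _ c] exI[of _ r]) (auto simp: a_def)
  qed
  then show ?thesis using that[of "card N + 1"] by simp
qed

text \<open>The two parts are left in different coordinates: near 1 a gain can come from the weight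
  in z, while away from 1 the covering disks live in w. There the weight in z is at most the weight
  in w, by the Schwarz lemma.\<close>

lemma pull_energy_split:
  assumes \<alpha>: "\<alpha> \<ge> 0" and g: "g holomorphic_on unit_disk"
  shows "pull_energy \<alpha> UNIV g \<le> pull_energy \<alpha> {w. cmod (1 - w) < h} g +
    energy \<alpha> {w \<in> cusp_map ` unit_disk. h \<le> cmod (1 - w)} g"
proof -
  let ?B = "{w. cmod (1 - w) < h}"
  let ?G = "\<lambda>z. g (cusp_map z) * deriv cusp_map z"
  have B: "?B \<in> sets borel" by measurable
  then have B': "- ?B \<in> sets borel" by auto
  have open1: "open (unit_disk \<inter> cusp_map -` ?B)"
    by (intro continuous_open_preimage holomorphic_on_imp_continuous_on cusp_map_holomorphic)
       (auto intro!: open_Collect_less continuous_intros)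
  have bor: "unit_disk \<inter> cusp_map -` ?B \<in> sets borel" using open1 by auto
  have bor2: "unit_disk \<inter> cusp_map -` (- ?B) \<in> sets borel"
  proof -
    have "unit_disk \<inter> cusp_map -` (- ?B) = unit_disk - (unit_disk \<inter> cusp_map -` ?B)" by auto
    then show ?thesis using bor by (metis borel_open open_ball sets.Diff)
  qed
  have G: "?G holomorphic_on unit_disk"
    using holomorphic_on_compose_gen[OF cusp_map_holomorphic g cusp_map_image_disk]
      deriv_holomorphic_disk[OF cusp_map_holomorphic]
    by (auto simp: comp_def intro!: holomorphic_on_mult)
  have "pull_energy \<alpha> UNIV g \<le> (\<Sum>b\<in>{True, False}. energy \<alpha> (unit_disk \<inter> cusp_map -` (if b then ?B else - ?B)) ?G)"
    using bor bor2 G by (intro energy_union_le) (auto split: if_splits)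
  also have "\<dots> = pull_energy \<alpha> ?B g + pull_energy \<alpha> (- ?B) g" by simp
  also have "pull_energy \<alpha> (- ?B) g \<le> energy \<alpha> (cusp_map ` unit_disk \<inter> - ?B) g"
    by (intro pull_energy_le_image \<alpha> g B')
  also have "cusp_map ` unit_disk \<inter> - ?B = {w \<in> cusp_map ` unit_disk. h \<le> cmod (1 - w)}"
    by auto
  finally show ?thesis by (simp add: add_left_mono)
qed

lemma pull_energy_vanishing:
  assumes \<alpha>: "\<alpha> \<ge> 0" and g: "g holomorphic_on unit_disk"
    and I: "finite I" "\<And>i. i \<in> I \<Longrightarrow> r i > 0" "\<And>i. i \<in> I \<Longrightarrow> 4 * r i \<le> 1 - cmod (c i)"
    and cover: "{w \<in> cusp_map ` unit_disk. h \<le> cmod (1 - w)} \<subseteq> (\<Union>i\<in>I. ball (c i) (r i))"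
    and vanish: "\<And>i k. i \<in> I \<Longrightarrow> k < m \<Longrightarrow> (deriv ^^ k) g (c i) = 0"
    and tail: "pull_energy \<alpha> {w. cmod (1 - w) < h} g \<le> ennreal \<tau> * energy \<alpha> unit_disk g" and \<tau>: "\<tau> \<ge> 0"
  shows "pull_energy \<alpha> UNIV g \<le> ennreal (real (card I) * (4 * 14 powr \<alpha> / 4 ^ m) + \<tau>) * energy \<alpha> unit_disk g"
proof -
  have "pull_energy \<alpha> UNIV g \<le> pull_energy \<alpha> {w. cmod (1 - w) < h} g +
      energy \<alpha> {w \<in> cusp_map ` unit_disk. h \<le> cmod (1 - w)} g"
    by (rule pull_energy_split[OF \<alpha> g])
  also have "\<dots> \<le> ennreal \<tau> * energy \<alpha> unit_disk g +
      ennreal (real (card I) * (4 * 14 powr \<alpha> / 4 ^ m)) * energy \<alpha> unit_disk g"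
    by (intro add_mono tail energy_vanishing_cover[OF \<alpha> I(1) cover I(2,3) g vanish])
  finally show ?thesis
    using \<tau> by (simp add: ennreal_plus distrib_right add.commute)
qed

section \<open>The Dirichlet space and the composition operator\<close>

lemma dirichlet_normE:
  assumes "f \<in> dirichlet_space \<alpha>" "\<alpha> \<ge> 0"
  obtains E where "E \<ge> 0" "energy \<alpha> unit_disk (deriv f) = ennreal E"
    "(dirichlet_norm \<alpha> f)\<^sup>2 = (cmod (f 0))\<^sup>2 + (\<alpha> + 1) / pi * E"
proof -
  have "energy \<alpha> unit_disk (deriv f) < \<infinity>" using assms by (simp add: dirichlet_space_iff)
  then obtain E where E: "E \<ge> 0" "energy \<alpha> unit_disk (deriv f) = ennreal E"
    by (cases "energy \<alpha> unit_disk (deriv f)" rule: ennreal_cases) auto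
  then show ?thesis using that[of E] dirichlet_norm_sq[OF assms] by simp
qed

lemma energy_add_le:
  assumes f: "f holomorphic_on unit_disk" and g: "g holomorphic_on unit_disk"
  shows "energy \<alpha> unit_disk (\<lambda>z. f z + g z) \<le> 2 * energy \<alpha> unit_disk f + 2 * energy \<alpha> unit_disk g"
proof -
  let ?F = "\<lambda>f z. ennreal (indicator unit_disk z * ((cmod (f z))\<^sup>2 * (1 - (cmod z)\<^sup>2) powr \<alpha>))"
  have m: "?F f \<in> borel_measurable lborel" "?F g \<in> borel_measurable lborel"
    using f g by (intro holomorphic_imp_measurable_energy; auto)+
  have "energy \<alpha> unit_disk (\<lambda>z. f z + g z) \<le> (\<integral>\<^sup>+z. 2 * ?F f z + 2 * ?F g z \<partial>lborel)"
    unfolding energy_def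
  proof (intro nn_integral_mono)
    fix z
    let ?w = "indicator unit_disk z * (1 - (cmod z)\<^sup>2) powr \<alpha> :: real"
    have "(cmod (f z + g z))\<^sup>2 \<le> (cmod (f z) + cmod (g z))\<^sup>2"
      by (intro power_mono norm_triangle_ineq) auto
    also have "\<dots> \<le> 2 * (cmod (f z))\<^sup>2 + 2 * (cmod (g z))\<^sup>2"
      using sum_squares_bound[of "cmod (f z)" "cmod (g z)"] by (simp add: power2_sum)
    finally have "?w * (cmod (f z + g z))\<^sup>2 \<le> ?w * (2 * (cmod (f z))\<^sup>2 + 2 * (cmod (g z))\<^sup>2)"
      by (intro mult_left_mono) auto
    then have "indicator unit_disk z * ((cmod (f z + g z))\<^sup>2 * (1 - (cmod z)\<^sup>2) powr \<alpha>) \<le>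
      2 * (indicator unit_disk z * ((cmod (f z))\<^sup>2 * (1 - (cmod z)\<^sup>2) powr \<alpha>)) +
      2 * (indicator unit_disk z * ((cmod (g z))\<^sup>2 * (1 - (cmod z)\<^sup>2) powr \<alpha>))"
      by (simp add: algebra_simps)
    from ennreal_leI[OF this]
    show "?F (\<lambda>z. f z + g z) z \<le> 2 * ?F f z + 2 * ?F g z"
      by (simp add: ennreal_plus ennreal_mult)
  qed
  also have "\<dots> = 2 * energy \<alpha> unit_disk f + 2 * energy \<alpha> unit_disk g"
    unfolding energy_def using m by (subst nn_integral_add) (auto simp: nn_integral_cmult)
  finally show ?thesis .
qed

lemma energy_scale:
  assumes f: "f holomorphic_on unit_disk"
  shows "energy \<alpha> unit_disk (\<lambda>z. c * f z) = ennreal ((cmod c)\<^sup>2) * energy \<alpha> unit_disk f"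
proof -
  have "energy \<alpha> unit_disk (\<lambda>z. c * f z) = (\<integral>\<^sup>+z. ennreal ((cmod c)\<^sup>2) *
      ennreal (indicator unit_disk z * ((cmod (f z))\<^sup>2 * (1 - (cmod z)\<^sup>2) powr \<alpha>)) \<partial>lborel)"
    unfolding energy_def
    by (intro nn_integral_cong) (simp add: ennreal_mult[symmetric] norm_mult power_mult_distrib mult_ac)
  then show ?thesis
    unfolding energy_def
    by (subst (asm) nn_integral_cmult) (use holomorphic_imp_measurable_energy[OF f] in auto)
qed

lemma dirichlet_space_holomorphic: "f \<in> dirichlet_space \<alpha> \<Longrightarrow> f holomorphic_on unit_disk"
  by (simp add: dirichlet_space_iff)

text \<open>The factor 2 comes from |a + b|^2 <= 2 |a|^2 + 2 |b|^2 applied pointwise; this weak form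
  of the triangle inequality is all that is used later.\<close>

lemma dirichlet_add:
  assumes f: "f \<in> dirichlet_space \<alpha>" and g: "g \<in> dirichlet_space \<alpha>" and \<alpha>: "\<alpha> \<ge> 0"
  shows "f + g \<in> dirichlet_space \<alpha>"
    "(dirichlet_norm \<alpha> (f + g))\<^sup>2 \<le> 2 * (dirichlet_norm \<alpha> f)\<^sup>2 + 2 * (dirichlet_norm \<alpha> g)\<^sup>2"
proof -
  note hol = dirichlet_space_holomorphic[OF f] dirichlet_space_holomorphic[OF g]
  have d: "deriv (f + g) z = deriv f z + deriv g z" if "z \<in> unit_disk" for z
    unfolding plus_fun_def using that hol
    by (intro deriv_add holomorphic_on_imp_differentiable_at[OF _ open_ball])
  have "energy \<alpha> unit_disk (deriv (f + g)) = energy \<alpha> unit_disk (\<lambda>z. deriv f z + deriv g z)"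
    by (intro energy_cong d)
  then have e: "energy \<alpha> unit_disk (deriv (f + g)) \<le> 2 * energy \<alpha> unit_disk (deriv f) + 2 * energy \<alpha> unit_disk (deriv g)"
    using energy_add_le deriv_holomorphic_disk hol by metis
  obtain E where E: "E \<ge> 0" "energy \<alpha> unit_disk (deriv f) = ennreal E"
    "(dirichlet_norm \<alpha> f)\<^sup>2 = (cmod (f 0))\<^sup>2 + (\<alpha> + 1) / pi * E"
    using dirichlet_normE[OF f \<alpha>] .
  obtain G where G: "G \<ge> 0" "energy \<alpha> unit_disk (deriv g) = ennreal G"
    "(dirichlet_norm \<alpha> g)\<^sup>2 = (cmod (g 0))\<^sup>2 + (\<alpha> + 1) / pi * G"
    using dirichlet_normE[OF g \<alpha>] .
  have e2: "energy \<alpha> unit_disk (deriv (f + g)) \<le> ennreal (2 * E + 2 * G)"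
    using e E G by (simp add: ennreal_plus ennreal_mult)
  have "(f + g) holomorphic_on unit_disk"
    unfolding plus_fun_def using hol by (intro holomorphic_intros)
  moreover have "energy \<alpha> unit_disk (deriv (f + g)) < \<infinity>"
    using e2 by (auto intro: le_less_trans)
  ultimately show mem: "f + g \<in> dirichlet_space \<alpha>"
    using f g by (auto simp: dirichlet_space_iff)
  obtain H where H: "H \<ge> 0" "energy \<alpha> unit_disk (deriv (f + g)) = ennreal H"
    "(dirichlet_norm \<alpha> (f + g))\<^sup>2 = (cmod ((f + g) 0))\<^sup>2 + (\<alpha> + 1) / pi * H"
    using dirichlet_normE[OF mem \<alpha>] .
  have "H \<le> 2 * E + 2 * G" using e2 E(1) G(1) unfolding H(2) by (subst (asm) ennreal_le_iff) auto
  then have "(\<alpha> + 1) / pi * H \<le> (\<alpha> + 1) / pi * (2 * E + 2 * G)" using \<alpha> by (intro mult_left_mono) auto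
  moreover have "(cmod ((f + g) 0))\<^sup>2 \<le> (cmod (f 0) + cmod (g 0))\<^sup>2"
    by (intro power_mono) (auto intro: norm_triangle_ineq)
  then have "(cmod ((f + g) 0))\<^sup>2 \<le> 2 * (cmod (f 0))\<^sup>2 + 2 * (cmod (g 0))\<^sup>2"
    using sum_squares_bound[of "cmod (f 0)" "cmod (g 0)"] unfolding power2_sum by linarith
  moreover have "(\<alpha> + 1) / pi * (2 * E + 2 * G) = 2 * ((\<alpha> + 1) / pi * E) + 2 * ((\<alpha> + 1) / pi * G)"
    by (simp add: algebra_simps)
  ultimately show "(dirichlet_norm \<alpha> (f + g))\<^sup>2 \<le> 2 * (dirichlet_norm \<alpha> f)\<^sup>2 + 2 * (dirichlet_norm \<alpha> g)\<^sup>2"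
    unfolding E(3) G(3) H(3) by argo
qed

lemma dirichlet_scale:
  assumes f: "f \<in> dirichlet_space \<alpha>" and \<alpha>: "\<alpha> \<ge> 0"
  shows "(\<lambda>z. c * f z) \<in> dirichlet_space \<alpha>"
    "dirichlet_norm \<alpha> (\<lambda>z. c * f z) = cmod c * dirichlet_norm \<alpha> f"
proof -
  note hol = dirichlet_space_holomorphic[OF f]
  have "energy \<alpha> unit_disk (deriv (\<lambda>z. c * f z)) = energy \<alpha> unit_disk (\<lambda>z. c * deriv f z)"
    using hol by (intro energy_cong deriv_cmult holomorphic_on_imp_differentiable_at[OF _ open_ball])
  then have e: "energy \<alpha> unit_disk (deriv (\<lambda>z. c * f z)) = ennreal ((cmod c)\<^sup>2) * energy \<alpha> unit_disk (deriv f)"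
    using energy_scale deriv_holomorphic_disk hol by metis
  obtain E where E: "E \<ge> 0" "energy \<alpha> unit_disk (deriv f) = ennreal E"
    "(dirichlet_norm \<alpha> f)\<^sup>2 = (cmod (f 0))\<^sup>2 + (\<alpha> + 1) / pi * E"
    using dirichlet_normE[OF f \<alpha>] .
  have e2: "energy \<alpha> unit_disk (deriv (\<lambda>z. c * f z)) = ennreal ((cmod c)\<^sup>2 * E)"
    unfolding e E by (simp add: E(1) ennreal_mult)
  show mem: "(\<lambda>z. c * f z) \<in> dirichlet_space \<alpha>"
    using f e2 by (auto simp: dirichlet_space_iff intro: holomorphic_intros)
  have "(dirichlet_norm \<alpha> (\<lambda>z. c * f z))\<^sup>2 = (cmod c * dirichlet_norm \<alpha> f)\<^sup>2"
    unfolding dirichlet_norm_sq[OF mem \<alpha>] power_mult_distrib E(3) e2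
    using E(1) by (simp add: norm_mult power_mult_distrib algebra_simps)
  then show "dirichlet_norm \<alpha> (\<lambda>z. c * f z) = cmod c * dirichlet_norm \<alpha> f"
    using dirichlet_norm_nonneg[OF \<alpha>] by (simp add: power2_eq_iff_nonneg)
qed

lemma dirichlet_diff:
  assumes f: "f \<in> dirichlet_space \<alpha>" and g: "g \<in> dirichlet_space \<alpha>" and \<alpha>: "\<alpha> \<ge> 0"
  shows "f - g \<in> dirichlet_space \<alpha>"
    "(dirichlet_norm \<alpha> (f - g))\<^sup>2 \<le> 2 * (dirichlet_norm \<alpha> f)\<^sup>2 + 2 * (dirichlet_norm \<alpha> g)\<^sup>2"
proof -
  define g' where "g' = (\<lambda>z. (-1) * g z)"
  have g': "g' \<in> dirichlet_space \<alpha>" "dirichlet_norm \<alpha> g' = dirichlet_norm \<alpha> g"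
    unfolding g'_def using dirichlet_scale[OF g \<alpha>, of "-1"] by (simp_all del: mult_minus1)
  have fg: "f - g = f + g'" by (auto simp: fun_eq_iff g'_def)
  show "f - g \<in> dirichlet_space \<alpha>"
    "(dirichlet_norm \<alpha> (f - g))\<^sup>2 \<le> 2 * (dirichlet_norm \<alpha> f)\<^sup>2 + 2 * (dirichlet_norm \<alpha> g)\<^sup>2"
    using dirichlet_add[OF f g'(1) \<alpha>] unfolding fg g'(2) .
qed

lemma dirichlet_zero: "(\<lambda>z. 0) \<in> dirichlet_space \<alpha>" "dirichlet_norm \<alpha> (\<lambda>z. 0) = 0"
  by (auto simp: dirichlet_space_iff energy_def dirichlet_norm_def set_lebesgue_integral_def)

abbreviation cusp_operator :: operator where
  "cusp_operator \<equiv> composition_operator cusp_map"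

lemma deriv_cusp_operator:
  assumes f: "f holomorphic_on unit_disk" and z: "z \<in> unit_disk"
  shows "cusp_operator f holomorphic_on unit_disk"
    "deriv (cusp_operator f) z = deriv f (cusp_map z) * deriv cusp_map z"
proof -
  have h: "(\<lambda>z. f (cusp_map z)) holomorphic_on unit_disk"
    using holomorphic_on_compose_gen[OF cusp_map_holomorphic f cusp_map_image_disk] by (simp add: comp_def)
  then show "cusp_operator f holomorphic_on unit_disk"
    by (rule holomorphic_transform) (simp add: composition_operator_def)
  have "deriv (cusp_operator f) z = deriv (\<lambda>z. f (cusp_map z)) z"
    by (rule deriv_cong_ev[OF eventually_nhds_in_open[OF open_ball z, THEN eventually_mono]])
       (auto simp: composition_operator_def)
  also have "\<dots> = deriv (f \<circ> cusp_map) z" by (simp add: comp_def)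
  also have "\<dots> = deriv f (cusp_map z) * deriv cusp_map z"
    using f z cusp_map_geometry(6)[OF z] cusp_map_holomorphic
    by (intro deriv_chain holomorphic_on_imp_differentiable_at[OF _ open_ball])
  finally show "deriv (cusp_operator f) z = deriv f (cusp_map z) * deriv cusp_map z" .
qed

lemma energy_cusp_operator:
  assumes f: "f holomorphic_on unit_disk"
  shows "energy \<alpha> unit_disk (deriv (cusp_operator f)) = pull_energy \<alpha> UNIV (deriv f)"
  unfolding vimage_UNIV Int_UNIV_right by (intro energy_cong deriv_cusp_operator(2)[OF f])

text \<open>Since \<open>cusp_map 0 = 0\<close>, composition keeps the value at 0, and
  \<open>K\<close> only has to control the derivative.\<close>

lemma cusp_operator_le:
  assumes f: "f \<in> dirichlet_space \<alpha>" and \<alpha>: "\<alpha> \<ge> 0"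
    and K: "K \<ge> 0" "pull_energy \<alpha> UNIV (deriv f) \<le> ennreal K * energy \<alpha> unit_disk (deriv f)"
  shows "cusp_operator f \<in> dirichlet_space \<alpha>"
    "(dirichlet_norm \<alpha> (cusp_operator f))\<^sup>2 \<le> (cmod (f 0))\<^sup>2 + K * (dirichlet_norm \<alpha> f)\<^sup>2"
proof -
  note hol = dirichlet_space_holomorphic[OF f]
  obtain E where E: "E \<ge> 0" "energy \<alpha> unit_disk (deriv f) = ennreal E"
    "(dirichlet_norm \<alpha> f)\<^sup>2 = (cmod (f 0))\<^sup>2 + (\<alpha> + 1) / pi * E"
    using dirichlet_normE[OF f \<alpha>] .
  have le: "energy \<alpha> unit_disk (deriv (cusp_operator f)) \<le> ennreal (K * E)"
    using K E unfolding energy_cusp_operator[OF hol] by (simp add: ennreal_mult)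
  show mem: "cusp_operator f \<in> dirichlet_space \<alpha>"
    using deriv_cusp_operator(1)[OF hol, of 0] le_less_trans[OF le]
    by (auto simp: dirichlet_space_iff composition_operator_def)
  obtain H where H: "H \<ge> 0" "energy \<alpha> unit_disk (deriv (cusp_operator f)) = ennreal H"
    "(dirichlet_norm \<alpha> (cusp_operator f))\<^sup>2 = (cmod (cusp_operator f 0))\<^sup>2 + (\<alpha> + 1) / pi * H"
    using dirichlet_normE[OF mem \<alpha>] .
  have "H \<le> K * E" using le H E K by simp
  then have "(\<alpha> + 1) / pi * H \<le> (\<alpha> + 1) / pi * (K * E)" using \<alpha> by (intro mult_left_mono) auto
  also have "\<dots> \<le> K * (dirichlet_norm \<alpha> f)\<^sup>2"
    unfolding E(3) using K by (simp add: algebra_simps)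
  finally show "(dirichlet_norm \<alpha> (cusp_operator f))\<^sup>2 \<le> (cmod (f 0))\<^sup>2 + K * (dirichlet_norm \<alpha> f)\<^sup>2"
    unfolding H(3) by (simp add: composition_operator_def cusp_map_0)
qed

text \<open>\<open>K = 1\<close> is admissible by the substitution and the Schwarz lemma. Value at 0
  and energy are each estimated by the full squared norm, whence the factor 2.\<close>

lemma cusp_operator_contraction:
  assumes f: "f \<in> dirichlet_space \<alpha>" and \<alpha>: "\<alpha> \<ge> 0"
  shows "cusp_operator f \<in> dirichlet_space \<alpha>"
    "(dirichlet_norm \<alpha> (cusp_operator f))\<^sup>2 \<le> 2 * (dirichlet_norm \<alpha> f)\<^sup>2"
proof -
  note hol = deriv_holomorphic_disk[OF dirichlet_space_holomorphic[OF f]]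
  have "pull_energy \<alpha> UNIV (deriv f) \<le> energy \<alpha> (cusp_map ` unit_disk \<inter> UNIV) (deriv f)"
    by (intro pull_energy_le_image \<alpha> hol) auto
  also have "\<dots> \<le> ennreal 1 * energy \<alpha> unit_disk (deriv f)"
    using energy_mono_set[OF cusp_map_image_disk] by simp
  finally have K: "pull_energy \<alpha> UNIV (deriv f) \<le> ennreal 1 * energy \<alpha> unit_disk (deriv f)" .
  show "cusp_operator f \<in> dirichlet_space \<alpha>"
    using cusp_operator_le(1)[OF f \<alpha> _ K] by simp
  have "(cmod (f 0))\<^sup>2 \<le> (dirichlet_norm \<alpha> f)\<^sup>2"
    using dirichlet_norm_sq[OF f \<alpha>] \<alpha> by simp
  then show "(dirichlet_norm \<alpha> (cusp_operator f))\<^sup>2 \<le> 2 * (dirichlet_norm \<alpha> f)\<^sup>2"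
    using cusp_operator_le(2)[OF f \<alpha> _ K] by simp
qed

lemma cusp_operator_linear:
  "cusp_operator (f + g) = cusp_operator f + cusp_operator g"
  "cusp_operator (f - g) = cusp_operator f - cusp_operator g"
  "cusp_operator (\<lambda>z. c * f z) = (\<lambda>z. c * cusp_operator f z)"
  by (auto simp: composition_operator_def fun_eq_iff)

lemma dirichlet_norm_bound_sqrt:
  assumes "(dirichlet_norm \<alpha> f)\<^sup>2 \<le> K * (dirichlet_norm \<alpha> g)\<^sup>2" "\<alpha> \<ge> 0" "K \<ge> 0"
  shows "dirichlet_norm \<alpha> f \<le> sqrt K * dirichlet_norm \<alpha> g"
proof -
  have "dirichlet_norm \<alpha> f \<le> sqrt (K * (dirichlet_norm \<alpha> g)\<^sup>2)"
    using assms(1) by (rule real_le_rsqrt)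
  then show ?thesis
    using dirichlet_norm_nonneg[OF assms(2), of g] by (simp add: real_sqrt_mult)
qed

text \<open>A supremum of reals dominates its members only if the set is bounded above; boundedness
  of \<open>R\<close> and of the composition operator supplies this.\<close>

lemma operator_norm_ge:
  assumes R: "bounded_operator \<alpha> R" and \<alpha>: "\<alpha> \<ge> 0"
    and f: "f \<in> dirichlet_space \<alpha>" "dirichlet_norm \<alpha> f \<le> 1"
  shows "dirichlet_norm \<alpha> ((cusp_operator - R) f) \<le> operator_norm \<alpha> (cusp_operator - R)"
proof -
  have "\<exists>K. \<forall>f\<in>dirichlet_space \<alpha>. dirichlet_norm \<alpha> (R f) \<le> K * dirichlet_norm \<alpha> f"
    using R unfolding bounded_operator_def by (elim conjE)
  then obtain K where K: "\<forall>f\<in>dirichlet_space \<alpha>. dirichlet_norm \<alpha> (R f) \<le> K * dirichlet_norm \<alpha> f" ..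
  have "R ` dirichlet_space \<alpha> \<subseteq> dirichlet_space \<alpha>"
    using R unfolding bounded_operator_def by (elim conjE)
  then have RD: "\<And>f. f \<in> dirichlet_space \<alpha> \<Longrightarrow> R f \<in> dirichlet_space \<alpha>" by blast
  have "dirichlet_norm \<alpha> ((cusp_operator - R) g) \<le> sqrt (4 + 2 * \<bar>K\<bar>\<^sup>2)"
    if g: "g \<in> dirichlet_space \<alpha>" "dirichlet_norm \<alpha> g \<le> 1" for g
  proof (rule real_le_rsqrt)
    have g0: "0 \<le> dirichlet_norm \<alpha> g" by (rule dirichlet_norm_nonneg[OF \<alpha>])
    have "dirichlet_norm \<alpha> (R g) \<le> \<bar>K\<bar> * 1"
      using bspec[OF K g(1)] mult_mono[OF abs_ge_self[of K] g(2) abs_ge_zero g0] by linarith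
    then have "(dirichlet_norm \<alpha> (R g))\<^sup>2 \<le> \<bar>K\<bar>\<^sup>2"
      using dirichlet_norm_nonneg[OF \<alpha>] by (intro power_mono) auto
    moreover have "(dirichlet_norm \<alpha> g)\<^sup>2 \<le> 1" using g g0 by (simp add: power_le_one)
    then have "(dirichlet_norm \<alpha> (cusp_operator g))\<^sup>2 \<le> 2"
      using cusp_operator_contraction(2)[OF g(1) \<alpha>] by linarith
    ultimately show "(dirichlet_norm \<alpha> ((cusp_operator - R) g))\<^sup>2 \<le> 4 + 2 * \<bar>K\<bar>\<^sup>2"
      using dirichlet_diff(2)[OF cusp_operator_contraction(1)[OF g(1) \<alpha>] RD[OF g(1)] \<alpha>]
      by (simp add: fun_diff_def)
  qed
  then have "bdd_above ((\<lambda>f. dirichlet_norm \<alpha> ((cusp_operator - R) f)) ` {f \<in> dirichlet_space \<alpha>. dirichlet_norm \<alpha> f \<le> 1})"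
    by (intro bdd_aboveI) auto
  then show ?thesis
    unfolding operator_norm_def using f by (intro cSUP_upper) auto
qed

text \<open>The infimum lies below its members because all operator norms involved are nonnegative,
  so that the set is bounded below.\<close>

lemma approx_number_le:
  assumes \<alpha>: "\<alpha> \<ge> 0" and R: "bounded_operator \<alpha> R" "rank_less \<alpha> R n"
    and le: "\<And>f. f \<in> dirichlet_space \<alpha> \<Longrightarrow> dirichlet_norm \<alpha> f \<le> 1 \<Longrightarrow> dirichlet_norm \<alpha> ((cusp_operator - R) f) \<le> B"
  shows "approx_number \<alpha> n cusp_operator \<le> B"
proof -
  have "0 \<le> operator_norm \<alpha> (cusp_operator - S)" if "bounded_operator \<alpha> S" for S
    using operator_norm_ge[OF that \<alpha> dirichlet_zero(1)] dirichlet_norm_nonneg[OF \<alpha>] dirichlet_zero(2)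
    by (smt (verit))
  then have "bdd_below ((\<lambda>R. operator_norm \<alpha> (cusp_operator - R)) ` {R. bounded_operator \<alpha> R \<and> rank_less \<alpha> R n})"
    by (intro bdd_belowI[of _ 0]) auto
  then have "approx_number \<alpha> n cusp_operator \<le> operator_norm \<alpha> (cusp_operator - R)"
    unfolding approx_number_def using R by (intro cINF_lower) auto
  also have "\<dots> \<le> B"
    unfolding operator_norm_def
  proof (rule cSUP_least)
    have "(\<lambda>z. 0) \<in> {f \<in> dirichlet_space \<alpha>. dirichlet_norm \<alpha> f \<le> 1}"
      using dirichlet_zero[of \<alpha>] by simp
    then show "{f \<in> dirichlet_space \<alpha>. dirichlet_norm \<alpha> f \<le> 1} \<noteq> {}" by blast
  qed (use le in blast)
  finally show ?thesis .
qed

section \<open>Approximation by operators of finite rank\<close>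

text \<open>With \<open>W = coeff_weight \<alpha>\<close> this is the inner product of the Dirichlet
  space on polynomials of degree below \<open>N\<close>, written in coefficients; entries from
  \<open>N\<close> on are not seen.\<close>

definition weighted_inner :: "(nat \<Rightarrow> real) \<Rightarrow> nat \<Rightarrow> (nat \<Rightarrow> complex) \<Rightarrow> (nat \<Rightarrow> complex) \<Rightarrow> complex" where
  "weighted_inner W N a b = (\<Sum>k<N. of_real (W k) * a k * cnj (b k))"

lemma weighted_inner_diff_left:
  "weighted_inner W N (\<lambda>k. a k - c * b k) d = weighted_inner W N a d - c * weighted_inner W N b d"
  by (simp add: weighted_inner_def sum_subtractf sum_distrib_left algebra_simps)

lemma weighted_inner_cnj: "cnj (weighted_inner W N a b) = weighted_inner W N b a"
  by (simp add: weighted_inner_def mult_ac)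

lemma weighted_inner_diff_right:
  "weighted_inner W N d (\<lambda>k. a k - c * b k) = weighted_inner W N d a - cnj c * weighted_inner W N d b"
  by (simp add: weighted_inner_def sum_subtractf sum_distrib_left algebra_simps)

lemma weighted_inner_self:
  "weighted_inner W N a a = of_real (\<Sum>k<N. W k * (cmod (a k))\<^sup>2)"
  by (simp only: weighted_inner_def of_real_sum of_real_mult mult.assoc complex_norm_square[symmetric])

text \<open>Gram--Schmidt; self-adjointness and idempotence of the projection \<open>Q\<close> are carried along for
  the induction only.\<close>
lemma orthogonal_projection:
  fixes d :: nat
  assumes W: "\<And>k. k < N \<Longrightarrow> W k > 0"
  defines "ip \<equiv> weighted_inner W N"
  shows "\<exists>Q u. (\<forall>a. Q a = (\<lambda>k. a k - (\<Sum>i<d. ip a (u i) * u i k))) \<and>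
    (\<forall>a. \<forall>i<d. ip (Q a) (l i) = 0) \<and> (\<forall>a. Re (ip (Q a) (Q a)) \<le> Re (ip a a)) \<and>
    (\<forall>a b. ip (Q a) b = ip a (Q b)) \<and> (\<forall>a b. ip (Q a) (Q b) = ip (Q a) b)"
proof (induction d)
  case 0
  show ?case by (intro exI[of _ "\<lambda>a. a"]) auto
next
  case (Suc d)
  then obtain Q u where Q: "\<And>a. Q a = (\<lambda>k. a k - (\<Sum>i<d. ip a (u i) * u i k))"
    and kill: "\<And>a i. i < d \<Longrightarrow> ip (Q a) (l i) = 0"
    and contr: "\<And>a. Re (ip (Q a) (Q a)) \<le> Re (ip a a)"
    and sa: "\<And>a b. ip (Q a) b = ip a (Q b)" and idem: "\<And>a b. ip (Q a) (Q b) = ip (Q a) b"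
    by blast
  \<comment> \<open>The component of the new functional orthogonal to the earlier ones. If its norm
    is zero, \<open>Q\<close> already kills \<open>l d\<close> and a zero vector pads the family;
    otherwise the projection onto \<open>r\<close> is subtracted.\<close>
  define r where "r = Q (l d)"
  define S where "S = (\<Sum>k<N. W k * (cmod (r k))\<^sup>2)"
  have rr: "ip r r = of_real S" by (simp add: ip_def S_def weighted_inner_self)
  have nn: "W k * (cmod (r k))\<^sup>2 \<ge> 0" if "k < N" for k using W[OF that] by simp
  have S0: "S \<ge> 0" unfolding S_def by (intro sum_nonneg nn) auto
  have A: "ip (Q a) (l d) = ip a r" for a by (simp add: sa r_def)
  have B: "ip (Q a) r = ip a r" for a using idem[of a "l d"] A by (simp add: r_def)
  have E: "ip r (Q b) = ip r b" for b
    using B[of b] weighted_inner_cnj unfolding ip_def by metis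
  show ?case
  proof (cases "S = 0")
    case True
    then have r0: "r k = 0" if "k < N" for k
      using sum_nonneg_eq_0_iff[of "{..<N}" "\<lambda>k. W k * (cmod (r k))\<^sup>2"] nn W[OF that] that
      by (force simp: S_def)
    have "ip a r = 0" for a unfolding ip_def weighted_inner_def using r0 by simp
    then have kd: "ip (Q a) (l d) = 0" for a using A by simp
    have Q': "Q a = (\<lambda>k. a k - (\<Sum>i<Suc d. ip a ((u(d := \<lambda>_. 0)) i) * (u(d := \<lambda>_. 0)) i k))" for a
      by (simp add: Q)
    show ?thesis
      using Q' kill kd contr sa idem by (intro exI[of _ Q] exI[of _ "u(d := \<lambda>_. 0)"]) (auto simp: less_Suc_eq)
  next
    case False
    then have S: "S > 0" using S0 by simp
    define c where "c = (\<lambda>a. ip a r / of_real S)"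
    define Q' where "Q' = (\<lambda>a k. Q a k - c a * r k)"
    have left: "ip (Q' a) b = ip (Q a) b - c a * ip r b" for a b
      by (simp add: Q'_def ip_def weighted_inner_diff_left)
    have right: "ip b (Q' a) = ip b (Q a) - cnj (c a) * ip b r" for a b
      by (simp add: Q'_def ip_def weighted_inner_diff_right)
    have rl: "ip r (l i) = (if i = d then of_real S else 0)" if "i \<le> d" for i
      using A[of "l d"] B[of "l d"] kill[of i "l d"] that by (auto simp: r_def[symmetric] rr)
    have zero: "ip (Q' a) r = 0" for a
      using S by (simp add: left B rr c_def)
    have cc: "cnj (c b) = ip r b / of_real S" for b
      by (simp add: c_def ip_def weighted_inner_cnj)
    have 1: "Q' a = (\<lambda>k. a k - (\<Sum>i<Suc d. ip a ((u(d := \<lambda>k. r k / of_real (sqrt S))) i) * (u(d := \<lambda>k. r k / of_real (sqrt S))) i k))" for a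
    proof -
      have "ip a (\<lambda>k. r k / of_real (sqrt S)) = ip a r / of_real (sqrt S)"
        unfolding ip_def weighted_inner_def by (simp add: sum_divide_distrib)
      moreover have "of_real (sqrt S) * of_real (sqrt S) = (of_real S :: complex)"
        using S by (simp flip: of_real_mult)
      ultimately have "ip a (\<lambda>k. r k / of_real (sqrt S)) * (r k / of_real (sqrt S)) = c a * r k" for k
        by (simp add: c_def)
      then show ?thesis by (simp add: Q'_def Q fun_eq_iff)
    qed
    have 2: "ip (Q' a) (l i) = 0" if "i < Suc d" for a i
      using that S kill[of i a] rl[of i] A[of a] by (cases "i = d") (auto simp: left c_def)
    have 3: "Re (ip (Q' a) (Q' a)) \<le> Re (ip a a)" for a
    proof -
      have "ip (Q' a) (Q' a) = ip (Q' a) (Q a)"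
        by (simp only: right[of "Q' a"] zero) simp
      also have "\<dots> = ip (Q a) (Q a) - c a * ip r a"
        by (simp add: left E)
      also have "c a * ip r a = of_real ((cmod (ip a r))\<^sup>2 / S)"
        unfolding of_real_divide complex_norm_square by (simp add: c_def ip_def weighted_inner_cnj)
      finally have "Re (ip (Q' a) (Q' a)) = Re (ip (Q a) (Q a)) - (cmod (ip a r))\<^sup>2 / S"
        by (simp del: of_real_divide of_real_power)
      moreover have "(cmod (ip a r))\<^sup>2 / S \<ge> 0" using S by simp
      ultimately show ?thesis using contr[of a] by linarith
    qed
    have 4: "ip (Q' a) b = ip a (Q' b)" for a b
      by (simp add: left right sa cc) (simp add: c_def)
    have 5: "ip (Q' a) (Q' b) = ip (Q' a) b" for a b
    proof -
      have "ip (Q' a) (Q' b) = ip (Q' a) (Q b)"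
        by (simp only: right[of "Q' a"] zero) simp
      also have "\<dots> = ip (Q' a) b"
        by (simp add: left E idem)
      finally show ?thesis .
    qed
    show ?thesis
      using 1 2 3 4 5 by blast
  qed
qed


section \<open>Taylor polynomials and the finite rank approximation\<close>

definition disk_poly :: "nat \<Rightarrow> (nat \<Rightarrow> complex) \<Rightarrow> complex \<Rightarrow> complex" where
  "disk_poly N a z = (if z \<in> unit_disk then \<Sum>k<N. a k * z ^ k else 0)"

definition taylor :: "(complex \<Rightarrow> complex) \<Rightarrow> nat \<Rightarrow> complex" where
  "taylor f k = (deriv ^^ k) f 0 / fact k"

text \<open>The squared norm of \<open>z ^ k\<close> in the Dirichlet space.\<close>
definition coeff_weight :: "real \<Rightarrow> nat \<Rightarrow> real" where
  "coeff_weight \<alpha> k = (if k = 0 then 1 else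
     (\<alpha> + 1) / pi * (real k)\<^sup>2 * enn2real (energy \<alpha> unit_disk (\<lambda>z. z ^ (k - 1))))"

lemma energy_monomial:
  assumes "\<alpha> \<ge> 0"
  shows "energy \<alpha> unit_disk (\<lambda>z. z ^ k) < \<infinity>" "energy \<alpha> unit_disk (\<lambda>z. z ^ k) > 0"
proof -
  have "energy \<alpha> unit_disk (\<lambda>z. z ^ k) \<le> (\<integral>\<^sup>+z. indicator unit_disk z \<partial>lborel)"
    unfolding energy_def
  proof (intro nn_integral_mono)
    fix z :: complex
    have "(cmod (z ^ k))\<^sup>2 * (1 - (cmod z)\<^sup>2) powr \<alpha> \<le> 1 * 1" if "z \<in> unit_disk"
      using that weight_le_1[OF assms that]
      by (intro mult_mono) (auto simp: norm_power power_le_one)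
    then have "indicator unit_disk z * ((cmod (z ^ k))\<^sup>2 * (1 - (cmod z)\<^sup>2) powr \<alpha>) \<le> indicator unit_disk z"
      by (auto simp: indicator_def)
    then show "ennreal (indicator unit_disk z * ((cmod (z ^ k))\<^sup>2 * (1 - (cmod z)\<^sup>2) powr \<alpha>)) \<le> indicator unit_disk z"
      by (metis ennreal_indicator ennreal_leI)
  qed
  also have "\<dots> < \<infinity>" by (simp add: emeasure_ball)
  finally show "energy \<alpha> unit_disk (\<lambda>z. z ^ k) < \<infinity>" .
  \<comment> \<open>Positivity is obtained from the pointwise bound at 1/2, where the monomial does
    not vanish.\<close>
  have "ennreal ((cmod ((1/2) ^ k))\<^sup>2 * (pi / 4 * 2 powr (- \<alpha>) * (1 - cmod (1/2)) powr (2 + \<alpha>))) \<le> energy \<alpha> unit_disk (\<lambda>z. z ^ k)"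
    by (rule pointwise_energy_bound[OF assms]) (auto intro: holomorphic_intros)
  moreover have "(cmod ((1/2) ^ k))\<^sup>2 * (pi / 4 * 2 powr (- \<alpha>) * (1 - cmod (1/2)) powr (2 + \<alpha>)) > 0"
    by (simp add: norm_power norm_divide)
  ultimately show "energy \<alpha> unit_disk (\<lambda>z. z ^ k) > 0"
    by (metis ennreal_less_zero_iff order_less_le_trans)
qed

lemma coeff_weight_pos: "\<alpha> \<ge> 0 \<Longrightarrow> coeff_weight \<alpha> k > 0"
  using energy_monomial[of \<alpha> "k - 1"] by (auto simp: coeff_weight_def enn2real_positive_iff)

lemma disk_poly_holomorphic: "disk_poly N a holomorphic_on unit_disk"
proof -
  have "(\<lambda>z. \<Sum>k<N. a k * z ^ k) holomorphic_on unit_disk" by (intro holomorphic_intros)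
  then show ?thesis by (rule holomorphic_transform) (simp add: disk_poly_def)
qed

text \<open>Shows that every vanishing condition is linear in the coefficients, so that it is given
  by a vector to which \<open>orthogonal_projection\<close> applies.\<close>

lemma higher_deriv_disk_poly:
  assumes c: "c \<in> unit_disk"
  shows "(deriv ^^ k) (disk_poly N a) c = (\<Sum>j<N. a j * (deriv ^^ k) (\<lambda>z. z ^ j) c)"
proof -
  have "(deriv ^^ k) (disk_poly N a) c = (deriv ^^ k) (\<lambda>z. \<Sum>j<N. a j * z ^ j) c"
    by (rule higher_deriv_transform_within_open[OF disk_poly_holomorphic _ open_ball c])
       (auto simp: disk_poly_def intro!: holomorphic_intros)
  also have "\<dots> = (\<Sum>j<N. a j * (deriv ^^ k) (\<lambda>z. z ^ j) c)"
  proof (induction N)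
    case (Suc N)
    have "(deriv ^^ k) (\<lambda>z. (\<Sum>j<N. a j * z ^ j) + a N * z ^ N) c =
        (deriv ^^ k) (\<lambda>z. \<Sum>j<N. a j * z ^ j) c + (deriv ^^ k) (\<lambda>z. a N * z ^ N) c"
      by (rule higher_deriv_add[of _ UNIV]) (auto intro!: holomorphic_intros)
    also have "(deriv ^^ k) (\<lambda>z. a N * z ^ N) c = a N * (deriv ^^ k) (\<lambda>z. z ^ N) c"
      by (rule higher_deriv_cmult[of _ UNIV]) (auto intro!: holomorphic_intros)
    finally show ?case using Suc by simp
  qed simp
  finally show ?thesis .
qed

lemma taylor_disk_poly:
  assumes "k < N"
  shows "taylor (disk_poly N a) k = a k"
proof -
  have *: "(deriv ^^ k) (\<lambda>z. z ^ j) (0::complex) = (if j = k then fact k else 0)" for j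
    using higher_deriv_power[of k 0 j "0::complex"]
    by (cases j k rule: linorder_cases) (auto simp: pochhammer_fact pochhammer_0_left)
  show ?thesis
    using assms by (simp add: taylor_def higher_deriv_disk_poly * if_distrib cong: if_cong)
qed

lemma deriv_power_id: "deriv (\<lambda>z. z ^ j) z = of_nat j * z ^ (j - 1)" for z :: complex
  by (rule DERIV_imp_deriv) (auto intro!: derivative_eq_intros)

lemma deriv_disk_poly:
  assumes z: "z \<in> unit_disk"
  shows "deriv (disk_poly (Suc N) a) z = (\<Sum>k<N. (of_nat (Suc k) * a (Suc k)) * z ^ k)"
proof -
  have "deriv (disk_poly (Suc N) a) z = (\<Sum>j<Suc N. a j * (of_nat j * z ^ (j - 1)))"
    using higher_deriv_disk_poly[OF z, of 1 "Suc N" a] by (simp add: deriv_power_id del: sum.lessThan_Suc)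
  then show ?thesis
    by (simp add: sum.lessThan_Suc_shift mult_ac del: sum.lessThan_Suc)
qed

lemma disk_poly_dirichlet:
  assumes \<alpha>: "\<alpha> \<ge> 0"
  shows "disk_poly N a \<in> dirichlet_space \<alpha>"
    "(dirichlet_norm \<alpha> (disk_poly N a))\<^sup>2 = (\<Sum>k<N. coeff_weight \<alpha> k * (cmod (a k))\<^sup>2)"
proof -
  have "disk_poly N a \<in> dirichlet_space \<alpha> \<and>
    (dirichlet_norm \<alpha> (disk_poly N a))\<^sup>2 = (\<Sum>k<N. coeff_weight \<alpha> k * (cmod (a k))\<^sup>2)"
  proof (cases N)
    case 0
    then have "disk_poly N a = (\<lambda>z. 0)" by (auto simp: disk_poly_def)
    then show ?thesis using dirichlet_zero 0 by simp
  next
    case (Suc M)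
    define e where "e = (\<lambda>k. enn2real (energy \<alpha> unit_disk (\<lambda>z. z ^ k)))"
    have e: "energy \<alpha> unit_disk (\<lambda>z. z ^ k) = ennreal (e k)" "e k \<ge> 0" for k
      using energy_monomial[OF \<alpha>, of k] by (auto simp: e_def less_top)
    have "energy \<alpha> unit_disk (deriv (disk_poly N a)) = energy \<alpha> unit_disk (\<lambda>z. \<Sum>k<M. (of_nat (Suc k) * a (Suc k)) * z ^ k)"
      unfolding Suc by (intro energy_cong deriv_disk_poly)
    also have "\<dots> = (\<Sum>k<M. ennreal ((cmod (of_nat (Suc k) * a (Suc k)))\<^sup>2) * energy \<alpha> unit_disk (\<lambda>z. z ^ k))"
      by (rule energy_polynomial[OF \<alpha> order_refl])
    also have "\<dots> = (\<Sum>k<M. ennreal ((cmod (of_nat (Suc k) * a (Suc k)))\<^sup>2 * e k))"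
      using e by (simp add: ennreal_mult)
    also have "\<dots> = ennreal (\<Sum>k<M. (cmod (of_nat (Suc k) * a (Suc k)))\<^sup>2 * e k)"
      using e by (intro sum_ennreal) auto
    finally have E: "energy \<alpha> unit_disk (deriv (disk_poly N a)) = ennreal (\<Sum>k<M. (cmod (of_nat (Suc k) * a (Suc k)))\<^sup>2 * e k)" .
    have mem: "disk_poly N a \<in> dirichlet_space \<alpha>"
      using disk_poly_holomorphic by (auto simp: dirichlet_space_iff E disk_poly_def)
    have "disk_poly N a 0 = a 0" by (simp add: disk_poly_def Suc sum.lessThan_Suc_shift del: sum.lessThan_Suc)
    moreover have "(\<Sum>k<M. (cmod (of_nat (Suc k) * a (Suc k)))\<^sup>2 * e k) \<ge> 0" using e by (intro sum_nonneg) auto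
    ultimately have "(dirichlet_norm \<alpha> (disk_poly N a))\<^sup>2 =
        (cmod (a 0))\<^sup>2 + (\<alpha> + 1) / pi * (\<Sum>k<M. (cmod (of_nat (Suc k) * a (Suc k)))\<^sup>2 * e k)"
      unfolding dirichlet_norm_sq[OF mem \<alpha>] E by simp
    also have "\<dots> = (\<Sum>k<N. coeff_weight \<alpha> k * (cmod (a k))\<^sup>2)"
      unfolding Suc sum.lessThan_Suc_shift sum_distrib_left
      by (simp add: coeff_weight_def e_def norm_mult power_mult_distrib mult_ac del: of_nat_Suc)
    finally show ?thesis using mem by simp
  qed
  then show "disk_poly N a \<in> dirichlet_space \<alpha>"
    "(dirichlet_norm \<alpha> (disk_poly N a))\<^sup>2 = (\<Sum>k<N. coeff_weight \<alpha> k * (cmod (a k))\<^sup>2)" by auto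
qed

text \<open>This is \<open>bessel\<close> for f', whose k-th Taylor coefficient is k + 1 times the
  coefficient of f with index k + 1.\<close>

lemma taylor_bessel:
  assumes f: "f \<in> dirichlet_space \<alpha>" and \<alpha>: "\<alpha> \<ge> 0"
  shows "(\<Sum>k<N. coeff_weight \<alpha> k * (cmod (taylor f k))\<^sup>2) \<le> (dirichlet_norm \<alpha> f)\<^sup>2"
proof (cases N)
  case (Suc M)
  obtain E where E: "E \<ge> 0" "energy \<alpha> unit_disk (deriv f) = ennreal E"
    "(dirichlet_norm \<alpha> f)\<^sup>2 = (cmod (f 0))\<^sup>2 + (\<alpha> + 1) / pi * E"
    using dirichlet_normE[OF f \<alpha>] .
  define e where "e = (\<lambda>k. enn2real (energy \<alpha> unit_disk (\<lambda>z. z ^ k)))"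
  have e: "energy \<alpha> unit_disk (\<lambda>z. z ^ k) = ennreal (e k)" "e k \<ge> 0" for k
    using energy_monomial[OF \<alpha>, of k] by (auto simp: e_def less_top)
  have t: "(deriv ^^ k) (deriv f) 0 / fact k = of_nat (Suc k) * taylor f (Suc k)" for k
  proof -
    have "(deriv ^^ k) (deriv f) 0 = (deriv ^^ Suc k) f 0"
      by (simp only: funpow_Suc_right comp_def)
    then show ?thesis by (simp add: taylor_def field_simps del: funpow.simps of_nat_Suc)
  qed
  have "ennreal (\<Sum>k<M. (cmod (of_nat (Suc k) * taylor f (Suc k)))\<^sup>2 * e k) =
     (\<Sum>k<M. ennreal ((cmod (of_nat (Suc k) * taylor f (Suc k)))\<^sup>2 * e k))"
    using e by (intro sum_ennreal[symmetric]) auto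
  also have "\<dots> = (\<Sum>k<M. ennreal ((cmod ((deriv ^^ k) (deriv f) 0 / fact k))\<^sup>2) * energy \<alpha> unit_disk (\<lambda>z. z ^ k))"
    unfolding t using e by (simp add: ennreal_mult)
  also have "\<dots> \<le> ennreal E"
    unfolding E(2)[symmetric]
    by (intro bessel \<alpha> deriv_holomorphic_disk dirichlet_space_holomorphic[OF f])
  finally have "(\<Sum>k<M. (cmod (of_nat (Suc k) * taylor f (Suc k)))\<^sup>2 * e k) \<le> E" using E by simp
  then have "(\<alpha> + 1) / pi * (\<Sum>k<M. (cmod (of_nat (Suc k) * taylor f (Suc k)))\<^sup>2 * e k) \<le> (\<alpha> + 1) / pi * E"
    using \<alpha> by (intro mult_left_mono) auto
  moreover have "(\<Sum>k<N. coeff_weight \<alpha> k * (cmod (taylor f k))\<^sup>2) =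
     (cmod (f 0))\<^sup>2 + (\<alpha> + 1) / pi * (\<Sum>k<M. (cmod (of_nat (Suc k) * taylor f (Suc k)))\<^sup>2 * e k)"
    unfolding Suc sum.lessThan_Suc_shift sum_distrib_left
    by (simp add: coeff_weight_def e_def norm_mult power_mult_distrib mult_ac del: of_nat_Suc) (simp add: taylor_def)
  ultimately show ?thesis unfolding E(3) by simp
qed simp

lemma taylor_linear:
  assumes f: "f \<in> dirichlet_space \<alpha>" and g: "g \<in> dirichlet_space \<alpha>"
  shows "taylor (f + g) k = taylor f k + taylor g k" "taylor (f - g) k = taylor f k - taylor g k"
    "taylor (\<lambda>z. c * f z) k = c * taylor f k"
proof -
  note hol = dirichlet_space_holomorphic[OF f] dirichlet_space_holomorphic[OF g]
  have 0: "(0::complex) \<in> unit_disk" by simp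
  show "taylor (f + g) k = taylor f k + taylor g k"
    unfolding taylor_def plus_fun_def using higher_deriv_add[OF hol open_ball 0] by (simp add: add_divide_distrib)
  show "taylor (f - g) k = taylor f k - taylor g k"
    unfolding taylor_def fun_diff_def using higher_deriv_diff[OF hol open_ball 0] by (simp add: diff_divide_distrib)
  show "taylor (\<lambda>z. c * f z) k = c * taylor f k"
    unfolding taylor_def using higher_deriv_cmult[OF hol(1) 0 open_ball] by simp
qed

lemma sum_fun_apply: "finite S \<Longrightarrow> (\<Sum>i\<in>S. F i) z = (\<Sum>i\<in>S. F i z)"
  for F :: "'i \<Rightarrow> 'a \<Rightarrow> 'b::comm_monoid_add"
  by (induction S rule: finite_induct) auto

lemma cusp_operator_sum:
  "cusp_operator (\<lambda>z. \<Sum>i\<in>S. c i * F i z) = (\<lambda>z. \<Sum>i\<in>S. c i * cusp_operator (F i) z)"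
  by (auto simp: composition_operator_def fun_eq_iff)

lemma taylor_truncation:
  assumes f: "f \<in> dirichlet_space \<alpha>" and \<alpha>: "\<alpha> \<ge> 0"
  shows "(dirichlet_norm \<alpha> (disk_poly N (taylor f)))\<^sup>2 \<le> (dirichlet_norm \<alpha> f)\<^sup>2"
    "f - disk_poly N (taylor f) \<in> dirichlet_space \<alpha>"
    "(dirichlet_norm \<alpha> (f - disk_poly N (taylor f)))\<^sup>2 \<le> 4 * (dirichlet_norm \<alpha> f)\<^sup>2"
    "\<And>k. k < N \<Longrightarrow> (deriv ^^ k) (f - disk_poly N (taylor f)) 0 = 0"
proof -
  note p = disk_poly_dirichlet[OF \<alpha>, of N "taylor f"]
  show 1: "(dirichlet_norm \<alpha> (disk_poly N (taylor f)))\<^sup>2 \<le> (dirichlet_norm \<alpha> f)\<^sup>2"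
    unfolding p(2) by (rule taylor_bessel[OF f \<alpha>])
  show "f - disk_poly N (taylor f) \<in> dirichlet_space \<alpha>"
    by (rule dirichlet_diff(1)[OF f p(1) \<alpha>])
  show "(dirichlet_norm \<alpha> (f - disk_poly N (taylor f)))\<^sup>2 \<le> 4 * (dirichlet_norm \<alpha> f)\<^sup>2"
    using dirichlet_diff(2)[OF f p(1) \<alpha>] 1 by linarith
  show "(deriv ^^ k) (f - disk_poly N (taylor f)) 0 = 0" if "k < N" for k
  proof -
    have "taylor (f - disk_poly N (taylor f)) k = 0"
      using taylor_linear(2)[OF f p(1), of k] taylor_disk_poly[OF that, of "taylor f"] by simp
    then show ?thesis by (simp add: taylor_def)
  qed
qed

text \<open>With p the Taylor polynomial of f of degree below \<open>N\<close>, f = (f - p) + Qp +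
  Pp, and \<open>R\<close> is the composition operator applied to Pp. The rank is at most
  \<open>card X\<close>, whatever \<open>N\<close> is; \<open>tail\<close> handles f - p, and
  \<open>vanish\<close> handles Qp, which satisfies all conditions in \<open>X\<close>. A pair in
  \<open>X\<close> is an order of differentiation with a point.\<close>

lemma finite_rank_approximation:
  assumes \<alpha>: "\<alpha> \<ge> 0" and X: "finite X" "X \<subseteq> UNIV \<times> unit_disk" and \<delta>: "\<delta> \<ge> 0"
    and vanish: "\<And>f. f \<in> dirichlet_space \<alpha> \<Longrightarrow> (\<And>k c. (k, c) \<in> X \<Longrightarrow> (deriv ^^ k) f c = 0) \<Longrightarrow>
      (dirichlet_norm \<alpha> (cusp_operator f))\<^sup>2 \<le> \<delta> * (dirichlet_norm \<alpha> f)\<^sup>2"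
    and tail: "\<And>f. f \<in> dirichlet_space \<alpha> \<Longrightarrow> (\<And>k. k < N \<Longrightarrow> (deriv ^^ k) f 0 = 0) \<Longrightarrow>
      (dirichlet_norm \<alpha> (cusp_operator f))\<^sup>2 \<le> \<delta> * (dirichlet_norm \<alpha> f)\<^sup>2"
    and n: "n > card X"
  shows "approx_number \<alpha> n cusp_operator \<le> sqrt (10 * \<delta>)"
proof -
  define d where "d = card X"
  obtain x where x: "bij_betw x {..<d} X"
    using ex_bij_betw_nat_finite[OF X(1)] by (auto simp: d_def lessThan_atLeast0)
  define L where "L = (\<lambda>i j. (deriv ^^ fst (x i)) (\<lambda>z. z ^ j) (snd (x i)))"
  define W where "W = coeff_weight \<alpha>"
  have W: "W k > 0" for k using coeff_weight_pos[OF \<alpha>] by (simp add: W_def)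
  \<comment> \<open>The Riesz vector of the i-th functional: conjugating and dividing by the weight
    undoes what \<open>weighted_inner\<close> inserts.\<close>
  define l where "l = (\<lambda>i j. cnj (L i j) / of_real (W j))"
  define ip where "ip = weighted_inner W N"
  obtain Q u where Q': "\<forall>a. Q a = (\<lambda>k. a k - (\<Sum>i<d. ip a (u i) * u i k))"
    and kill': "\<forall>a. \<forall>i<d. ip (Q a) (l i) = 0"
    and contr0: "\<forall>a. Re (ip (Q a) (Q a)) \<le> Re (ip a a)"
    using orthogonal_projection[of N W d l, OF W, folded ip_def] by (elim exE conjE) (rule that)
  have Q: "Q a = (\<lambda>k. a k - (\<Sum>i<d. ip a (u i) * u i k))" for a using Q' ..
  have kill: "ip (Q a) (l i) = 0" if "i < d" for a i using kill' that by blast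
  have contr: "Re (ip (Q a) (Q a)) \<le> Re (ip a a)" for a using contr0 ..
  have sq: "(dirichlet_norm \<alpha> (disk_poly N a))\<^sup>2 = Re (ip a a)" for a
    unfolding disk_poly_dirichlet(2)[OF \<alpha>] ip_def weighted_inner_self W_def by simp
  have contr': "(dirichlet_norm \<alpha> (disk_poly N (Q a)))\<^sup>2 \<le> (dirichlet_norm \<alpha> (disk_poly N a))\<^sup>2" for a
    unfolding sq by (rule contr)
  have killed: "(deriv ^^ k) (disk_poly N (Q a)) c = 0" if kc: "(k, c) \<in> X" for k c a
  proof -
    obtain i where i: "i < d" "x i = (k, c)"
      using kc x unfolding bij_betw_def by (metis imageE lessThan_iff)
    have "c \<in> unit_disk" using kc X(2) by auto
    then have "(deriv ^^ k) (disk_poly N (Q a)) c = (\<Sum>j<N. Q a j * L i j)"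
      by (simp add: higher_deriv_disk_poly L_def i)
    also have "\<dots> = ip (Q a) (l i)"
      unfolding ip_def weighted_inner_def l_def using W less_imp_neq[OF W]
      by (intro sum.cong refl) (auto simp: field_simps)
    finally show ?thesis using kill[OF i(1)] by simp
  qed
  define P where "P = (\<lambda>a k. \<Sum>i<d. ip a (u i) * u i k)"
  have P: "P a k = a k - Q a k" for a k by (simp add: P_def Q)
  define R where "R = (\<lambda>f. cusp_operator (disk_poly N (P (taylor f))))"
  have dp: "disk_poly N (P a) = disk_poly N a - disk_poly N (Q a)" for a
    by (auto simp: fun_eq_iff disk_poly_def P sum_subtractf algebra_simps)
  have R_eq: "R f = (\<lambda>z. \<Sum>i<d. ip (taylor f) (u i) * cusp_operator (disk_poly N (u i)) z)" for f
  proof -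
    have "disk_poly N (P a) z = (\<Sum>i<d. ip a (u i) * disk_poly N (u i) z)" for a z
      unfolding disk_poly_def P_def
      by (simp add: sum_distrib_left sum_distrib_right mult.assoc sum.swap[of _ "{..<N}" "{..<d}"])
    then have "disk_poly N (P (taylor f)) = (\<lambda>z. \<Sum>i<d. ip (taylor f) (u i) * disk_poly N (u i) z)"
      by (simp add: fun_eq_iff)
    then show ?thesis unfolding R_def by (simp only: cusp_operator_sum)
  qed
  have RD: "R f \<in> dirichlet_space \<alpha>" for f
    unfolding R_def by (intro cusp_operator_contraction(1) disk_poly_dirichlet \<alpha>)
  have Rbound: "(dirichlet_norm \<alpha> (R f))\<^sup>2 \<le> 8 * (dirichlet_norm \<alpha> f)\<^sup>2" if f: "f \<in> dirichlet_space \<alpha>" for f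
  proof -
    have "(dirichlet_norm \<alpha> (R f))\<^sup>2 \<le> 2 * (dirichlet_norm \<alpha> (disk_poly N (P (taylor f))))\<^sup>2"
      unfolding R_def by (intro cusp_operator_contraction(2) disk_poly_dirichlet \<alpha>)
    moreover have "(dirichlet_norm \<alpha> (disk_poly N (P (taylor f))))\<^sup>2 \<le>
       2 * (dirichlet_norm \<alpha> (disk_poly N (taylor f)))\<^sup>2 + 2 * (dirichlet_norm \<alpha> (disk_poly N (Q (taylor f))))\<^sup>2"
      unfolding dp by (intro dirichlet_diff(2) disk_poly_dirichlet \<alpha>)
    ultimately show ?thesis
      using contr'[of "taylor f"] taylor_truncation(1)[OF f \<alpha>, of N] by linarith
  qed
  have ip_add: "ip (\<lambda>k. a k + b k) c = ip a c + ip b c" for a b c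
    by (simp add: ip_def weighted_inner_def algebra_simps sum.distrib)
  have ip_scale: "ip (\<lambda>k. s * a k) c = s * ip a c" for a s c
    by (simp add: ip_def weighted_inner_def algebra_simps sum_distrib_left)
  have Radd: "R (f + g) = R f + R g" if "f \<in> dirichlet_space \<alpha>" "g \<in> dirichlet_space \<alpha>" for f g
  proof -
    have "taylor (f + g) = (\<lambda>k. taylor f k + taylor g k)"
      using taylor_linear(1)[OF that] by auto
    then have "ip (taylor (f + g)) v = ip (taylor f) v + ip (taylor g) v" for v
      using ip_add by metis
    then show ?thesis
      unfolding R_eq by (auto simp: fun_eq_iff distrib_right sum.distrib)
  qed
  have Rscale: "R (\<lambda>z. s * f z) = (\<lambda>z. s * R f z)" if "f \<in> dirichlet_space \<alpha>" for f s
  proof -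
    have "taylor (\<lambda>z. s * f z) = (\<lambda>k. s * taylor f k)"
      using taylor_linear(3)[OF that that] by auto
    then have "ip (taylor (\<lambda>z. s * f z)) v = s * ip (taylor f) v" for v
      using ip_scale by metis
    then show ?thesis
      unfolding R_eq by (auto simp: fun_eq_iff sum_distrib_left mult.assoc)
  qed
  have "bounded_operator \<alpha> R"
    unfolding bounded_operator_def
  proof (intro conjI ballI allI exI[of _ "sqrt 8"])
    show "R ` dirichlet_space \<alpha> \<subseteq> dirichlet_space \<alpha>" using RD by auto
    show "dirichlet_norm \<alpha> (R f) \<le> sqrt 8 * dirichlet_norm \<alpha> f" if "f \<in> dirichlet_space \<alpha>" for f
      using Rbound[OF that] \<alpha> by (intro dirichlet_norm_bound_sqrt) auto
  qed (use Radd Rscale in auto)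
  moreover have "rank_less \<alpha> R n"
  proof -
    define B where "B = (\<lambda>i. cusp_operator (disk_poly N (u i))) ` {..<d}"
    have "R f \<in> cfun.span B" for f
    proof -
      have "R f = (\<Sum>i<d. (\<lambda>z. ip (taylor f) (u i) * cusp_operator (disk_poly N (u i)) z))"
        unfolding R_eq by (simp add: fun_eq_iff sum_fun_apply)
      also have "\<dots> \<in> cfun.span B"
        by (intro cfun.span_sum cfun.span_scale cfun.span_base) (auto simp: B_def)
      finally show ?thesis .
    qed
    then have sub: "R ` dirichlet_space \<alpha> \<subseteq> cfun.span B" by auto
    have fin: "finite B" by (simp add: B_def)
    have "cfun.dim (R ` dirichlet_space \<alpha>) \<le> card B" by (rule cfun.dim_le_card[OF sub fin])
    also have "\<dots> \<le> d" using card_image_le[of "{..<d}"] by (simp add: B_def)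
    also have "\<dots> < n" using n by (simp add: d_def)
    finally show ?thesis
      using sub fin unfolding rank_less_def cfun_dim_def cfun_span_def by blast
  qed
  moreover have "dirichlet_norm \<alpha> ((cusp_operator - R) f) \<le> sqrt (10 * \<delta>)"
    if f: "f \<in> dirichlet_space \<alpha>" "dirichlet_norm \<alpha> f \<le> 1" for f
  proof -
    define g where "g = f - disk_poly N (taylor f)"
    define q where "q = disk_poly N (Q (taylor f))"
    note tt = taylor_truncation[OF f(1) \<alpha>, of N, folded g_def]
    have q: "q \<in> dirichlet_space \<alpha>" unfolding q_def by (rule disk_poly_dirichlet[OF \<alpha>])
    have "f - disk_poly N (P (taylor f)) = g + q" by (simp add: dp g_def q_def)
    then have "cusp_operator f - R f = cusp_operator g + cusp_operator q"
      unfolding R_def by (metis cusp_operator_linear(1,2))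
    then have "(cusp_operator - R) f = cusp_operator g + cusp_operator q"
      by (simp add: fun_diff_def)
    then have "(dirichlet_norm \<alpha> ((cusp_operator - R) f))\<^sup>2 \<le>
       2 * (dirichlet_norm \<alpha> (cusp_operator g))\<^sup>2 + 2 * (dirichlet_norm \<alpha> (cusp_operator q))\<^sup>2"
      using dirichlet_add(2)[OF cusp_operator_contraction(1)[OF tt(2) \<alpha>] cusp_operator_contraction(1)[OF q \<alpha>] \<alpha>] by simp
    moreover have "(dirichlet_norm \<alpha> (cusp_operator g))\<^sup>2 \<le> \<delta> * (dirichlet_norm \<alpha> g)\<^sup>2"
      by (rule tail[OF tt(2)]) (unfold g_def, rule taylor_truncation(4)[OF f(1) \<alpha>])
    moreover have "\<delta> * (dirichlet_norm \<alpha> g)\<^sup>2 \<le> \<delta> * (4 * (dirichlet_norm \<alpha> f)\<^sup>2)"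
      by (intro mult_left_mono tt \<delta>)
    moreover have "(dirichlet_norm \<alpha> (cusp_operator q))\<^sup>2 \<le> \<delta> * (dirichlet_norm \<alpha> q)\<^sup>2"
      by (rule vanish[OF q]) (simp add: q_def killed)
    moreover have "\<delta> * (dirichlet_norm \<alpha> q)\<^sup>2 \<le> \<delta> * (dirichlet_norm \<alpha> f)\<^sup>2"
      unfolding q_def using order_trans[OF contr' tt(1)] \<delta> by (intro mult_left_mono) auto
    \<comment> \<open>10 = 2 * 4 + 2 * 1: the squared norm of the remainder \<open>g\<close> may be
      four times that of f, while \<open>q\<close> is no larger than f.\<close>
    ultimately have "(dirichlet_norm \<alpha> ((cusp_operator - R) f))\<^sup>2 \<le> 10 * (\<delta> * (dirichlet_norm \<alpha> f)\<^sup>2)"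
      by argo
    also have "(dirichlet_norm \<alpha> f)\<^sup>2 \<le> 1"
      using f dirichlet_norm_nonneg[OF \<alpha>] by (simp add: power_le_one)
    then have "10 * (\<delta> * (dirichlet_norm \<alpha> f)\<^sup>2) \<le> 10 * (\<delta> * 1)"
      using \<delta> by (intro mult_left_mono) auto
    finally show ?thesis by (intro real_le_rsqrt) simp
  qed
  ultimately show ?thesis
    by (intro approx_number_le \<alpha>)
qed

section \<open>Interpolation at geometric nodes\<close>

text \<open>With s = sqrt (1 - t) the left side is 2 ln (1 / s) <= 2 (1 / s - 1) <= 2 (1 / s - s).
  The bound is shaped for telescoping: 1 / sqrt (1 - t) is, up to a factor, the derivative of sqrt
  (1 - t).\<close>

lemma neg_ln_one_minus_le:
  fixes t :: real
  assumes "0 \<le> t" "t < 1"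
  shows "- ln (1 - t) \<le> 2 * (t / sqrt (1 - t))"
proof -
  define s where "s = sqrt (1 - t)"
  have s: "0 < s" "s \<le> 1" "s\<^sup>2 = 1 - t" using assms by (auto simp: s_def)
  have "ln (s\<^sup>2) = 2 * ln s" using s(1) by (simp add: ln_realpow)
  then have "ln (1 - t) = 2 * ln s" unfolding s(3) .
  moreover have "- ln s = ln (1 / s)" using s by (simp add: ln_div)
  moreover have "ln (1 / s) \<le> 1 / s - 1" using s by (intro ln_le_minus_one) auto
  moreover have "t / s = 1 / s - s"
  proof -
    have "t = 1 - s\<^sup>2" using s by simp
    then show ?thesis using s by (simp add: power2_eq_square field_simps)
  qed
  ultimately show ?thesis using s unfolding s_def[symmetric] by linarith
qed

text \<open>The summands \<open>- ln (1 - q ^ k)\<close> are dominated by the telescoping differences of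
  \<open>4 * sqrt (1 - q ^ k) / (1 - q)\<close>.\<close>
lemma prod_one_minus_power_ge:
  fixes q :: real
  assumes q: "0 < q" "q < 1"
  shows "exp (- (4 * sqrt (1 - q ^ n) / (1 - q))) \<le> (\<Prod>k=1..n. 1 - q ^ k)"
proof (induction n)
  case 0
  show ?case by simp
next
  case (Suc n)
  define y where "y = q ^ n"
  have y: "0 < y" "y \<le> 1" using q by (auto simp: y_def power_le_one)
  define a where "a = sqrt (1 - q * y)"
  define b where "b = sqrt (1 - y)"
  have "q * y \<le> q" using mult_left_mono[of y 1 q] q y by simp
  then have qy: "q * y < 1" using q by linarith
  have ab: "0 < a" "0 \<le> b" "a\<^sup>2 = 1 - q * y" "b\<^sup>2 = 1 - y" using y qy by (auto simp: a_def b_def)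
  have "b \<le> a" unfolding a_def b_def using q y by (intro real_sqrt_le_mono) (simp add: mult_left_le_one_le)
  \<comment> \<open>This identity and b <= a bound (1 - q) y / a, the size of the next summand, by
    twice the telescoping difference a - b.\<close>
  have "(a - b) * (a + b) = (1 - q) * y"
    using ab(3,4) by (simp add: power2_eq_square algebra_simps)
  moreover have "(a - b) * (a + b) \<le> (a - b) * (2 * a)"
    using \<open>b \<le> a\<close> by (intro mult_left_mono) auto
  ultimately have "(1 - q) * y / a \<le> (a - b) * (2 * a) / a"
    using ab(1) by (intro divide_right_mono) auto
  then have d: "(1 - q) * (y / a) \<le> 2 * (a - b)" using ab(1) by simp
  have "- ln (1 - q * y) \<le> 2 * (q * y / a)"
    unfolding a_def using q y qy by (intro neg_ln_one_minus_le) auto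
  also have "\<dots> \<le> 2 * (y / a)" using q y ab by (intro mult_left_mono divide_right_mono) (auto simp: mult_left_le_one_le)
  finally have "(1 - q) * (- ln (1 - q * y)) \<le> (1 - q) * (2 * (y / a))" using q by (intro mult_left_mono) auto
  also have "(1 - q) * (2 * (y / a)) = 2 * ((1 - q) * (y / a))" by simp
  also have "\<dots> \<le> 2 * (2 * (a - b))" using d by (intro mult_left_mono) auto
  also have "\<dots> = 4 * (a - b)" by simp
  finally have "- ln (1 - q * y) \<le> (4 * (a - b)) / (1 - q)" using q by (simp add: pos_le_divide_eq mult.commute)
  then have "- (4 * a / (1 - q)) \<le> - (4 * b / (1 - q)) + ln (1 - q * y)"
    by (simp add: diff_divide_distrib algebra_simps)
  then have "exp (- (4 * a / (1 - q))) \<le> exp (- (4 * b / (1 - q))) * (1 - q * y)"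
    using qy by (metis exp_add exp_le_cancel_iff exp_ln diff_gt_0_iff_gt)
  also have "\<dots> \<le> (\<Prod>k=1..n. 1 - q ^ k) * (1 - q * y)"
    using Suc.IH qy by (intro mult_right_mono) (auto simp: b_def y_def)
  finally show ?case by (simp add: a_def y_def)
qed

definition blaschke :: "real \<Rightarrow> complex \<Rightarrow> complex" where
  "blaschke w z = (z - of_real w) / (1 - of_real w * z)"

lemma blaschke_facts:
  assumes w: "0 \<le> w" "w < 1" and z: "z \<in> unit_disk"
  shows "1 - of_real w * z \<noteq> 0" "cmod (blaschke w z) \<le> 1"
    "(blaschke w has_field_derivative of_real (1 - w\<^sup>2) / (1 - of_real w * z)\<^sup>2) (at z)"
    "cmod (of_real (1 - w\<^sup>2) / (1 - of_real w * z)\<^sup>2) \<le> 2 / (1 - w)"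
proof -
  have "w * cmod z \<le> w * 1" using w z by (intro mult_left_mono) auto
  then have lo: "1 - w \<le> cmod (1 - of_real w * z)"
    using norm_triangle_ineq2[of 1 "of_real w * z"] w by (simp add: norm_mult)
  then show nz: "1 - of_real w * z \<noteq> 0" using w by auto
  have zz: "(Re z)\<^sup>2 + (Im z)\<^sup>2 < 1"
    using z by (simp add: cmod_power2[symmetric] abs_square_less_1)
  have "(cmod (1 - of_real w * z))\<^sup>2 - (cmod (z - of_real w))\<^sup>2 = (1 - w\<^sup>2) * (1 - ((Re z)\<^sup>2 + (Im z)\<^sup>2))"
    unfolding cmod_power2 by (simp add: power2_eq_square algebra_simps)
  moreover have "\<dots> \<ge> 0" using w zz by (intro mult_nonneg_nonneg) (auto simp: power_le_one)
  ultimately have "(cmod (z - of_real w))\<^sup>2 \<le> (cmod (1 - of_real w * z))\<^sup>2" by linarith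
  then have "cmod (z - of_real w) \<le> cmod (1 - of_real w * z)" by (rule power2_le_imp_le) simp
  then show "cmod (blaschke w z) \<le> 1"
    using nz by (simp add: blaschke_def norm_divide divide_le_eq_1)
  show "(blaschke w has_field_derivative of_real (1 - w\<^sup>2) / (1 - of_real w * z)\<^sup>2) (at z)"
    unfolding blaschke_def using nz
    by (auto intro!: derivative_eq_intros simp: power2_eq_square algebra_simps)
  have "cmod (of_real (1 - w\<^sup>2) / (1 - of_real w * z)\<^sup>2) = (1 - w\<^sup>2) / (cmod (1 - of_real w * z))\<^sup>2"
    using w by (simp add: norm_divide norm_power abs_square_le_1 norm_of_real del: of_real_diff)
  also have "\<dots> \<le> (1 - w\<^sup>2) / (1 - w)\<^sup>2"
    using w lo by (intro divide_left_mono power_mono mult_pos_pos) (auto simp: abs_square_le_1)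
  also have "\<dots> = (1 + w) / (1 - w)"
  proof -
    have "1 - w\<^sup>2 = (1 - w) * (1 + w)" by (simp add: power2_eq_square algebra_simps)
    then show ?thesis using w by (simp add: power2_eq_square)
  qed
  also have "\<dots> \<le> 2 / (1 - w)" using w by (intro divide_right_mono) auto
  finally show "cmod (of_real (1 - w\<^sup>2) / (1 - of_real w * z)\<^sup>2) \<le> 2 / (1 - w)" .
qed

text \<open>These nodes are \<open>tanh (j * ln (1 / q) / 2)\<close>, equally spaced in the hyperbolic metric.\<close>
definition geometric_node :: "real \<Rightarrow> nat \<Rightarrow> real" where
  "geometric_node q j = (1 - q ^ j) / (1 + q ^ j)"

lemma geometric_node_bounds:
  assumes "0 < q" "q < 1"
  shows "0 \<le> geometric_node q j" "geometric_node q j < 1" "q ^ j \<le> 1 - geometric_node q j"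
proof -
  have p: "0 < q ^ j" "q ^ j \<le> 1" using assms by (auto simp: power_le_one)
  then show "0 \<le> geometric_node q j" "geometric_node q j < 1" by (auto simp: geometric_node_def)
  have "1 - geometric_node q j = 2 * q ^ j / (1 + q ^ j)"
    using p by (simp add: geometric_node_def field_simps)
  moreover have "q ^ j * (1 + q ^ j) \<le> q ^ j * 2" using p by (intro mult_left_mono) auto
  ultimately show "q ^ j \<le> 1 - geometric_node q j" using p by (simp add: pos_le_divide_eq mult.commute)
qed

text \<open>The pseudohyperbolic distance of two nodes depends on j - i alone: it is (1 - r) / (1 +
  r) with r = q ^ (j - i). It is at least (1 - r)^2 because (1 - r) (1 + r) <= 1.\<close>

lemma blaschke_geometric_node:
  assumes q: "0 < q" "q < 1" and ij: "i < j"
  shows "(1 - q ^ (j - i))\<^sup>2 \<le> cmod (blaschke (geometric_node q i) (of_real (geometric_node q j)))"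
    "cmod (blaschke (geometric_node q j) (of_real (geometric_node q i))) =
     cmod (blaschke (geometric_node q i) (of_real (geometric_node q j)))"
proof -
  let ?w = "geometric_node q"
  have eq: "blaschke (?w a) (of_real (?w b)) = of_real ((?w b - ?w a) / (1 - ?w a * ?w b))" for a b
    by (simp add: blaschke_def)
  show "cmod (blaschke (?w j) (of_real (?w i))) = cmod (blaschke (?w i) (of_real (?w j)))"
    unfolding eq norm_of_real by (simp add: abs_divide abs_minus_commute mult.commute)
  define s where "s = q ^ j" define t where "t = q ^ i" define r where "r = q ^ (j - i)"
  have st: "0 < s" "0 < t" "0 < r" "r < 1" "s = r * t" "t \<le> 1"
    using q ij by (auto simp: s_def t_def r_def power_add[symmetric] power_le_one power_Suc_less_one power_less_one_iff)
  have "?w j - ?w i = 2 * (t - s) / ((1 + s) * (1 + t))"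
    using st(1,2) by (simp add: geometric_node_def s_def[symmetric] t_def[symmetric] field_simps)
  moreover have "1 - ?w i * ?w j = 2 * (t + s) / ((1 + s) * (1 + t))"
  proof -
    have "1 - ?w i * ?w j = 1 - (1 - t) * (1 - s) / ((1 + s) * (1 + t))"
      by (simp add: geometric_node_def s_def[symmetric] t_def[symmetric] mult.commute)
    also have "\<dots> = ((1 + s) * (1 + t) - (1 - t) * (1 - s)) / ((1 + s) * (1 + t))"
      using st(1,2) by (simp add: diff_divide_distrib)
    also have "(1 + s) * (1 + t) - (1 - t) * (1 - s) = 2 * (t + s)" by (simp add: algebra_simps)
    finally show ?thesis .
  qed
  ultimately have "(?w j - ?w i) / (1 - ?w i * ?w j) =
      (2 * (t - s) / ((1 + s) * (1 + t))) / (2 * (t + s) / ((1 + s) * (1 + t)))"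
    by (simp only:)
  also have "\<dots> = (t - s) / (t + s)"
  proof -
    have "(2 * x / m) / (2 * y / m) = x / y" if "m \<noteq> 0" for x y m :: real
      using that by simp
    moreover have "(1 + s) * (1 + t) \<noteq> 0" using st(1,2) by simp
    ultimately show ?thesis by blast
  qed
  also have "\<dots> = ((1 - r) * t) / ((1 + r) * t)" using st by (simp add: algebra_simps)
  also have "\<dots> = (1 - r) / (1 + r)" using st by simp
  finally have v: "(?w j - ?w i) / (1 - ?w i * ?w j) = (1 - r) / (1 + r)" .
  have "(1 - r) * (1 + r) \<le> 1" using st by (simp add: algebra_simps)
  then have "(1 - r) * ((1 - r) * (1 + r)) \<le> (1 - r) * 1" using st by (intro mult_left_mono) auto
  then have "(1 - r)\<^sup>2 \<le> (1 - r) / (1 + r)" using st by (simp add: pos_le_divide_eq power2_eq_square mult.assoc)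
  then show "(1 - q ^ (j - i))\<^sup>2 \<le> cmod (blaschke (?w i) (of_real (?w j)))"
    unfolding eq v norm_of_real r_def[symmetric] using st by simp
qed

text \<open>The nodes below and above j each contribute at least the square of a product of factors
  1 - q^k with distinct k, hence at least exp (-8 / (1 - q)) per side, uniformly in n and j.\<close>

lemma blaschke_separation:
  assumes q: "0 < q" "q < 1" and j: "j < n"
  shows "exp (- (16 / (1 - q))) \<le>
    cmod (\<Prod>i\<in>{..<n} - {j}. blaschke (geometric_node q i) (of_real (geometric_node q j)))"
proof -
  let ?b = "\<lambda>i. cmod (blaschke (geometric_node q i) (of_real (geometric_node q j)))"
  let ?P = "\<lambda>m. \<Prod>k=1..m. 1 - q ^ k"
  have P: "exp (- (4 / (1 - q))) \<le> ?P m" for m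
  proof -
    have "sqrt (1 - q ^ m) \<le> 1" using q by simp
    then have "4 * sqrt (1 - q ^ m) / (1 - q) \<le> 4 / (1 - q)" using q by (intro divide_right_mono) auto
    then show ?thesis using order_trans[OF _ prod_one_minus_power_ge[OF q, of m]] by simp
  qed
  have nn: "0 \<le> 1 - q ^ k" for k using q by (simp add: power_le_one)
  have P2: "exp (- (8 / (1 - q))) \<le> (?P m)\<^sup>2" for m
  proof -
    have "exp (- (8 / (1 - q))) = (exp (- (4 / (1 - q))))\<^sup>2" by (simp add: exp_double[symmetric])
    also have "\<dots> \<le> (?P m)\<^sup>2" using P by (intro power_mono) auto
    finally show ?thesis .
  qed
  have "(\<Prod>i<j. ?b i) \<ge> (\<Prod>i<j. (1 - q ^ (j - i))\<^sup>2)"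
    using blaschke_geometric_node(1)[OF q] by (intro prod_mono) auto
  moreover have "(\<Prod>i<j. (1 - q ^ (j - i))\<^sup>2) = (?P j)\<^sup>2"
    unfolding prod_power_distrib[symmetric]
    by (rule arg_cong[where f = "\<lambda>x. x\<^sup>2"], rule prod.reindex_bij_witness[of _ "\<lambda>k. j - k" "\<lambda>i. j - i"]) auto
  ultimately have A: "exp (- (8 / (1 - q))) \<le> (\<Prod>i<j. ?b i)" using P2[of j] by linarith
  have "(\<Prod>i\<in>{j<..<n}. ?b i) \<ge> (\<Prod>i\<in>{j<..<n}. (1 - q ^ (i - j))\<^sup>2)"
  proof (intro prod_mono conjI)
    fix i assume "i \<in> {j<..<n}"
    then have "j < i" by simp
    from blaschke_geometric_node[OF q this] show "(1 - q ^ (i - j))\<^sup>2 \<le> ?b i" by simp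
  qed auto
  moreover have "(\<Prod>i\<in>{j<..<n}. (1 - q ^ (i - j))\<^sup>2) = (?P (n - 1 - j))\<^sup>2"
    unfolding prod_power_distrib[symmetric]
    by (rule arg_cong[where f = "\<lambda>x. x\<^sup>2"], rule prod.reindex_bij_witness[of _ "\<lambda>k. k + j" "\<lambda>i. i - j"]) (use j in auto)
  ultimately have B: "exp (- (8 / (1 - q))) \<le> (\<Prod>i\<in>{j<..<n}. ?b i)" using P2[of "n - 1 - j"] by linarith
  have "exp (- (16 / (1 - q))) = exp (- (8 / (1 - q))) * exp (- (8 / (1 - q)))"
    by (simp add: exp_add[symmetric])
  also have "\<dots> \<le> (\<Prod>i<j. ?b i) * (\<Prod>i\<in>{j<..<n}. ?b i)"
    using A B by (intro mult_mono prod_nonneg) auto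
  also have "\<dots> = (\<Prod>i\<in>{..<j} \<union> {j<..<n}. ?b i)"
    by (rule prod.union_disjoint[symmetric]) auto
  also have "{..<j} \<union> {j<..<n} = {..<n} - {j}" using j by auto
  finally show ?thesis by (simp add: prod_norm)
qed

section \<open>Point evaluations and linear dependence\<close>

lemma dirichlet_point_evaluation:
  assumes \<alpha>: "\<alpha> \<ge> 0" and f: "f \<in> dirichlet_space \<alpha>" and u: "0 \<le> u" "u < 1"
  shows "cmod (f (of_real u)) \<le> (1 + 2 * 2 powr (\<alpha> / 2) * (1 - u) powr (- \<alpha> / 2) * (- ln (1 - u))) * dirichlet_norm \<alpha> f"
proof -
  define D where "D = dirichlet_norm \<alpha> f"
  have D0: "D \<ge> 0" using dirichlet_norm_nonneg[OF \<alpha>] by (simp add: D_def)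
  note hol = dirichlet_space_holomorphic[OF f]
  obtain E where E: "E \<ge> 0" "energy \<alpha> unit_disk (deriv f) = ennreal E"
    "D\<^sup>2 = (cmod (f 0))\<^sup>2 + (\<alpha> + 1) / pi * E"
    using dirichlet_normE[OF f \<alpha>] unfolding D_def .
  have "(cmod (f 0))\<^sup>2 \<le> D\<^sup>2" unfolding E(3) using E \<alpha> by simp
  then have f0: "cmod (f 0) \<le> D" using D0 by (rule power2_le_imp_le)
  have "1 / pi * E \<le> (\<alpha> + 1) / pi * E" using E \<alpha> by (intro mult_right_mono divide_right_mono) auto
  then have "1 / pi * E \<le> D\<^sup>2" unfolding E(3) using zero_le_power2[of "cmod (f 0)"] by linarith
  then have ED: "E \<le> pi * D\<^sup>2" by (simp add: field_simps)
  \<comment> \<open>The factor \<open>(1 - t) powr (- \<alpha> / 2)\<close> in the bound for f' is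
    frozen at its largest value, attained at t = u; only 1 / (1 - t) is left to integrate from 0 to
    u, which gives the logarithm.\<close>
  define C where "C = 2 * 2 powr (\<alpha> / 2) * (1 - u) powr (- \<alpha> / 2)"
  have C0: "C \<ge> 0" by (simp add: C_def)
  have C_cancel: "x \<le> (C * D)\<^sup>2" if "x * y \<le> D\<^sup>2" "C\<^sup>2 * y = 1" for x y :: real
  proof -
    have "C\<^sup>2 * (x * y) \<le> C\<^sup>2 * D\<^sup>2" using that(1) by (intro mult_left_mono) auto
    moreover have "C\<^sup>2 * (x * y) = x" using that(2) by (simp add: mult.left_commute[of _ x])
    ultimately show ?thesis by (simp add: power_mult_distrib)
  qed
  have bound: "cmod (deriv f (of_real t)) \<le> C * D / (1 - t)" if t: "0 \<le> t" "t \<le> u" for t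
  proof -
    have tD: "of_real t \<in> unit_disk" using t u by simp
    have t1: "1 - t > 0" using t u by simp
    have "ennreal ((cmod (deriv f (of_real t)))\<^sup>2 * (pi / 4 * 2 powr (- \<alpha>) * (1 - cmod (of_real t)) powr (2 + \<alpha>))) \<le> ennreal E"
      using pointwise_energy_bound[OF \<alpha> deriv_holomorphic_disk[OF hol] tD] E by simp
    then have "(cmod (deriv f (of_real t)))\<^sup>2 * (pi / 4 * 2 powr (- \<alpha>) * (1 - t) powr (2 + \<alpha>)) \<le> E"
      using E(1) t by (subst (asm) ennreal_le_iff) auto
    then have "(cmod (deriv f (of_real t)))\<^sup>2 * (pi / 4 * 2 powr (- \<alpha>) * (1 - t) powr (2 + \<alpha>)) \<le> pi * D\<^sup>2"
      using ED by linarith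
    moreover have "(1 - t) powr (2 + \<alpha>) = (1 - t)\<^sup>2 * (1 - t) powr \<alpha>" using t1 by (simp add: powr_add)
    moreover have "(1 - u) powr \<alpha> \<le> (1 - t) powr \<alpha>" using t u \<alpha> by (intro powr_mono2) auto
    then have "(cmod (deriv f (of_real t)))\<^sup>2 * (pi / 4 * 2 powr (- \<alpha>) * ((1 - t)\<^sup>2 * (1 - u) powr \<alpha>)) \<le>
      (cmod (deriv f (of_real t)))\<^sup>2 * (pi / 4 * 2 powr (- \<alpha>) * ((1 - t)\<^sup>2 * (1 - t) powr \<alpha>))"
      by (intro mult_left_mono) auto
    ultimately have "(cmod (deriv f (of_real t)))\<^sup>2 * (pi / 4 * 2 powr (- \<alpha>) * ((1 - t)\<^sup>2 * (1 - u) powr \<alpha>)) \<le> pi * D\<^sup>2"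
      by (simp only:)
    also have "(cmod (deriv f (of_real t)))\<^sup>2 * (pi / 4 * 2 powr (- \<alpha>) * ((1 - t)\<^sup>2 * (1 - u) powr \<alpha>)) =
        pi * ((cmod (deriv f (of_real t)) * (1 - t))\<^sup>2 * (2 powr (- \<alpha>) * (1 - u) powr \<alpha> / 4))"
      unfolding power_mult_distrib by simp
    finally have "pi * ((cmod (deriv f (of_real t)) * (1 - t))\<^sup>2 * (2 powr (- \<alpha>) * (1 - u) powr \<alpha> / 4)) \<le> pi * D\<^sup>2" .
    then have "(cmod (deriv f (of_real t)) * (1 - t))\<^sup>2 * (2 powr (- \<alpha>) * (1 - u) powr \<alpha> / 4) \<le> D\<^sup>2"
      by (subst (asm) mult_le_cancel_left_pos) auto
    moreover have "C\<^sup>2 * (2 powr (- \<alpha>) * (1 - u) powr \<alpha> / 4) = 1"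
    proof -
      have "(2 powr (\<alpha> / 2))\<^sup>2 = 2 powr \<alpha>" "((1 - u) powr (- \<alpha> / 2))\<^sup>2 = (1 - u) powr (- \<alpha>)"
        using u by (simp_all add: powr_power)
      then have "C\<^sup>2 = 4 * (2 powr \<alpha> * (1 - u) powr (- \<alpha>))" by (simp add: C_def power_mult_distrib)
      moreover have "2 powr \<alpha> * 2 powr (- \<alpha>) = (1::real)" "(1 - u) powr (- \<alpha>) * (1 - u) powr \<alpha> = 1"
        using u by (simp_all add: powr_add[symmetric])
      moreover have "4 * (2 powr \<alpha> * (1 - u) powr (- \<alpha>)) * (2 powr (- \<alpha>) * (1 - u) powr \<alpha> / 4) =
          (2 powr \<alpha> * 2 powr (- \<alpha>)) * ((1 - u) powr (- \<alpha>) * (1 - u) powr \<alpha>)"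
        by simp
      ultimately show ?thesis by (simp only: mult_1)
    qed
    ultimately have "(cmod (deriv f (of_real t)) * (1 - t))\<^sup>2 \<le> (C * D)\<^sup>2"
      using C_cancel by blast
    then have "cmod (deriv f (of_real t)) * (1 - t) \<le> C * D"
      by (rule power2_le_imp_le) (intro mult_nonneg_nonneg C0 D0)
    then show ?thesis using t1 by (simp add: pos_le_divide_eq)
  qed
  have "cmod (f (of_real u) - f (of_real 0)) \<le> C * D * (- ln (1 - u)) - C * D * (- ln (1 - 0))"
  proof (cases "u = 0")
    case False
    show ?thesis
    proof (rule differentiable_bound_general[where f = "\<lambda>t. f (of_real t)" and \<phi> = "\<lambda>t. C * D * (- ln (1 - t))"
        and f' = "\<lambda>t. deriv f (of_real t)" and \<phi>' = "\<lambda>t. C * D / (1 - t)"])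
      show "0 < u" using False u by simp
      show "continuous_on {0..u} (\<lambda>t. f (of_real t))"
        using u by (intro continuous_on_compose2[OF holomorphic_on_imp_continuous_on[OF hol]] continuous_intros) auto
      show "continuous_on {0..u} (\<lambda>t. C * D * (- ln (1 - t)))"
        using u by (intro continuous_intros) auto
    next
      fix t :: real assume t: "0 < t" "t < u"
      have "(f has_field_derivative deriv f (of_real t)) (at (of_real t))"
        using t u by (intro holomorphic_derivI[OF hol open_ball]) auto
      then show "((\<lambda>t. f (of_real t)) has_vector_derivative deriv f (of_real t)) (at t)"
        by (rule has_vector_derivative_real_field)
      have "((\<lambda>t. C * D * (- ln (1 - t))) has_real_derivative C * D / (1 - t)) (at t)"
        using t u by (auto intro!: derivative_eq_intros simp: field_simps)
      then show "((\<lambda>t. C * D * (- ln (1 - t))) has_vector_derivative C * D / (1 - t)) (at t)"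
        by (simp add: has_real_derivative_iff_has_vector_derivative)
      show "cmod (deriv f (of_real t)) \<le> C * D / (1 - t)" using bound t by simp
    qed
  qed simp
  then have "cmod (f (of_real u) - f 0) \<le> C * D * (- ln (1 - u))" by simp
  then have "cmod (f (of_real u)) \<le> D + C * D * (- ln (1 - u))"
    using f0 norm_triangle_ineq2[of "f (of_real u)" "f 0"] by linarith
  then show ?thesis by (simp add: C_def D_def algebra_simps)
qed

text \<open>The finite spanning set \<open>B0\<close> makes \<open>cfun.dim V\<close> a genuine
  dimension: a basis of \<open>V\<close> is then finite, and n independent vectors would exceed it.
  If \<open>r\<close> takes a value twice, the difference of the two terms is the relation.\<close>

lemma linear_dependence_small_rank:
  fixes r :: "nat \<Rightarrow> complex \<Rightarrow> complex"
  assumes fin: "finite B0" "V \<subseteq> cfun.span B0" and dim: "cfun.dim V < n" and r: "\<And>j. j < n \<Longrightarrow> r j \<in> V"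
  obtains v j0 where "j0 < n" "v j0 \<noteq> 0" "\<And>z. (\<Sum>j<n. v j * r j z) = 0"
proof (cases "inj_on r {..<n}")
  case False
  then obtain i j where ij: "i < n" "j < n" "i \<noteq> j" "r i = r j" by (auto simp: inj_on_def)
  let ?v = "\<lambda>k. if k = i then 1 else if k = j then - 1 else (0::complex)"
  have "(\<Sum>k<n. ?v k * r k z) = 0" for z
  proof -
    have "(\<Sum>k<n. ?v k * r k z) = (\<Sum>k\<in>{i, j}. ?v k * r k z)"
      using ij by (intro sum.mono_neutral_right) auto
    then show ?thesis using ij by simp
  qed
  then show ?thesis using that[of i ?v] ij by simp
next
  case True
  let ?S = "r ` {..<n}"
  have card: "card ?S = n" using True by (simp add: card_image)
  have "cfun.dependent ?S"
  proof (rule ccontr)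
    assume ind: "cfun.independent ?S"
    obtain B where B: "B \<subseteq> V" "cfun.independent B" "V \<subseteq> cfun.span B" "card B = cfun.dim V"
      using cfun.basis_exists[of V] by blast
    have "finite B" using cfun.independent_span_bound[OF fin(1) B(2)] B(1) fin(2) by auto
    then have "card ?S \<le> card B"
      using cfun.independent_span_bound[OF _ ind, of B] B(3) r by blast
    then show False using card dim B(4) by simp
  qed
  then obtain c where c: "\<exists>v\<in>?S. c v \<noteq> 0" "(\<Sum>v\<in>?S. (\<lambda>z. c v * v z)) = 0"
    using cfun.dependent_finite[of ?S] by auto
  then obtain j0 where j0: "j0 < n" "c (r j0) \<noteq> 0" by auto
  have "(\<Sum>j<n. c (r j) * r j z) = 0" for z
  proof -
    have "(\<Sum>j<n. c (r j) * r j z) = (\<Sum>v\<in>?S. c v * v z)"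
      using True by (simp add: sum.reindex)
    also have "\<dots> = (\<Sum>v\<in>?S. (\<lambda>z. c v * v z)) z" by (simp add: sum_fun_apply)
    finally show ?thesis using c(2) by simp
  qed
  then show ?thesis using that[of j0 "\<lambda>j. c (r j)"] j0 by simp
qed

lemma dirichlet_combination:
  fixes n :: nat
  assumes \<alpha>: "\<alpha> \<ge> 0" and l: "\<And>j. j < n \<Longrightarrow> l j \<in> dirichlet_space \<alpha>"
  shows "(\<lambda>z. \<Sum>j<n. v j * l j z) \<in> dirichlet_space \<alpha>"
    "bounded_operator \<alpha> R \<Longrightarrow> R (\<lambda>z. \<Sum>j<n. v j * l j z) = (\<lambda>z. \<Sum>j<n. v j * R (l j) z)"
proof -
  have "(\<lambda>z. \<Sum>j<n. v j * l j z) \<in> dirichlet_space \<alpha> \<and>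
    (bounded_operator \<alpha> R \<longrightarrow> R (\<lambda>z. \<Sum>j<n. v j * l j z) = (\<lambda>z. \<Sum>j<n. v j * R (l j) z))"
    using l
  proof (induction n)
    case 0
    have "R (\<lambda>z. 0) = (\<lambda>z. 0)" if "bounded_operator \<alpha> R"
    proof -
      have "\<forall>c. \<forall>f\<in>dirichlet_space \<alpha>. R (\<lambda>z. c * f z) = (\<lambda>z. c * R f z)"
        using that unfolding bounded_operator_def by (elim conjE)
      from this[rule_format, OF dirichlet_zero(1), of 0] show ?thesis by simp
    qed
    then show ?case using dirichlet_zero by auto
  next
    case (Suc n)
    let ?f = "\<lambda>z. \<Sum>j<n. v j * l j z" and ?g = "\<lambda>z. v n * l n z"
    have f: "?f \<in> dirichlet_space \<alpha>" and g: "?g \<in> dirichlet_space \<alpha>" and ln: "l n \<in> dirichlet_space \<alpha>"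
      using Suc dirichlet_scale(1)[OF _ \<alpha>] by auto
    have eq: "(\<lambda>z. \<Sum>j<Suc n. v j * l j z) = ?f + ?g" by (auto simp: fun_eq_iff)
    have "R (?f + ?g) = (\<lambda>z. \<Sum>j<Suc n. v j * R (l j) z)" if R: "bounded_operator \<alpha> R"
    proof -
      have a: "\<forall>f\<in>dirichlet_space \<alpha>. \<forall>g\<in>dirichlet_space \<alpha>. R (f + g) = R f + R g"
        using R unfolding bounded_operator_def by (elim conjE)
      have s: "\<forall>c. \<forall>f\<in>dirichlet_space \<alpha>. R (\<lambda>z. c * f z) = (\<lambda>z. c * R f z)"
        using R unfolding bounded_operator_def by (elim conjE)
      have "R (?f + ?g) = R ?f + R ?g" using a f g by blast
      moreover have "R ?g = (\<lambda>z. v n * R (l n) z)" using s ln by blast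
      moreover have "R ?f = (\<lambda>z. \<Sum>j<n. v j * R (l j) z)" using Suc R by auto
      ultimately show ?thesis by (auto simp: fun_eq_iff)
    qed
    then show ?case unfolding eq using dirichlet_add(1)[OF f g \<alpha>] by auto
  qed
  then show "(\<lambda>z. \<Sum>j<n. v j * l j z) \<in> dirichlet_space \<alpha>"
    "bounded_operator \<alpha> R \<Longrightarrow> R (\<lambda>z. \<Sum>j<n. v j * l j z) = (\<lambda>z. \<Sum>j<n. v j * R (l j) z)" by auto
qed

text \<open>Shows that the infimum in \<open>approx_number\<close> runs over a nonempty set; it is
  also the competitor used for n = 1.\<close>

lemma zero_operator:
  assumes "n \<ge> 1"
  shows "bounded_operator \<alpha> (\<lambda>f z. 0)" "rank_less \<alpha> (\<lambda>f z. 0) n"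
proof -
  show "bounded_operator \<alpha> (\<lambda>f z. 0)"
    unfolding bounded_operator_def using dirichlet_zero by (auto simp: fun_eq_iff intro!: exI[of _ 0])
  have sub: "(\<lambda>f z. 0) ` dirichlet_space \<alpha> \<subseteq> cfun.span {}"
    by (auto simp: fun_eq_iff)
  have "cfun.dim ((\<lambda>f z. 0) ` dirichlet_space \<alpha>) \<le> card ({} :: (complex \<Rightarrow> complex) set)"
    by (rule cfun.dim_le_card[OF sub]) simp
  then show "rank_less \<alpha> (\<lambda>f z. 0) n"
    unfolding rank_less_def using sub assms by (intro conjI exI[of _ "{}"]) auto
qed

text \<open>An operator of rank below \<open>n\<close> vanishes on some normalised combination of the \<open>n\<close>
  interpolating functions, and there the composition operator is bounded from below by a point
  evaluation.\<close>
lemma approx_number_ge: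
  assumes \<alpha>: "\<alpha> \<ge> 0" and n: "n \<ge> 1"
    and l: "\<And>j. j < n \<Longrightarrow> l j \<in> dirichlet_space \<alpha>" and u: "\<And>j. j < n \<Longrightarrow> u j \<in> unit_disk"
    and delta: "\<And>i j. i < n \<Longrightarrow> j < n \<Longrightarrow> l j (cusp_map (u i)) = (if i = j then 1 else 0)"
    and A: "A > 0" "\<And>v. (\<And>j. j < n \<Longrightarrow> cmod (v j) \<le> 1) \<Longrightarrow> dirichlet_norm \<alpha> (\<lambda>z. \<Sum>j<n. v j * l j z) \<le> A"
    and \<kappa>: "\<kappa> > 0" "\<And>F j. F \<in> dirichlet_space \<alpha> \<Longrightarrow> j < n \<Longrightarrow> cmod (F (u j)) \<le> \<kappa> * dirichlet_norm \<alpha> F"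
  shows "1 / (A * \<kappa>) \<le> approx_number \<alpha> n cusp_operator"
  unfolding approx_number_def
proof (rule cINF_greatest)
  show "{R. bounded_operator \<alpha> R \<and> rank_less \<alpha> R n} \<noteq> {}"
    using zero_operator[OF n] by blast
next
  fix R assume "R \<in> {R. bounded_operator \<alpha> R \<and> rank_less \<alpha> R n}"
  then have R: "bounded_operator \<alpha> R" "rank_less \<alpha> R n" by auto
  obtain B where B: "finite B" "R ` dirichlet_space \<alpha> \<subseteq> cfun.span B" "cfun.dim (R ` dirichlet_space \<alpha>) < n"
    using R(2) unfolding rank_less_def by (elim conjE exE) (rule that)
  have Rl: "R (l j) \<in> R ` dirichlet_space \<alpha>" if "j < n" for j by (rule imageI[OF l[OF that]])
  obtain v j0 where v: "j0 < n" "v j0 \<noteq> 0" "\<And>z. (\<Sum>j<n. v j * R (l j) z) = 0"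
    by (rule linear_dependence_small_rank[where r = "\<lambda>j. R (l j)", OF B(1,2,3) Rl]) (assumption, rule that)
  \<comment> \<open>Dividing by the largest modulus puts all coefficients in the closed unit disk
    and gives the one with index \<open>j1\<close> modulus 1; the combination takes that value at
    node \<open>j1\<close>, where the point evaluation is applied.\<close>
  define M where "M = Max ((\<lambda>j. cmod (v j)) ` {..<n})"
  have Mge: "cmod (v j) \<le> M" if "j < n" for j unfolding M_def using that by (intro Max_ge) auto
  have M0: "M > 0" using Mge[OF v(1)] v(2) by (smt (verit) zero_less_norm_iff)
  have "M \<in> (\<lambda>j. cmod (v j)) ` {..<n}" unfolding M_def using v(1) by (intro Max_in) auto
  then obtain j1 where j1: "j1 < n" "cmod (v j1) = M" by auto
  define v' where "v' = (\<lambda>j. v j / of_real M)"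
  define f where "f = (\<lambda>z. \<Sum>j<n. v' j * l j z)"
  have f: "f \<in> dirichlet_space \<alpha>" unfolding f_def by (rule dirichlet_combination(1)[OF \<alpha> l])
  have fA: "dirichlet_norm \<alpha> f \<le> A" unfolding f_def
    using Mge M0 by (intro A(2)) (auto simp: v'_def norm_divide)
  have Rf: "R f = (\<lambda>z. 0)"
  proof -
    have "R f = (\<lambda>z. \<Sum>j<n. v' j * R (l j) z)"
      unfolding f_def by (rule dirichlet_combination(2)[OF \<alpha> l R(1)])
    also have "\<dots> = (\<lambda>z. (\<Sum>j<n. v j * R (l j) z) / of_real M)"
      by (simp add: v'_def sum_divide_distrib)
    finally show ?thesis using v(3) by simp
  qed
  have "f (cusp_map (u j1)) = (\<Sum>j<n. if j = j1 then v' j else 0)"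
    unfolding f_def using delta[OF j1(1)] by (intro sum.cong) auto
  then have "f (cusp_map (u j1)) = v' j1" using j1 by simp
  then have "cmod (cusp_operator f (u j1)) = 1"
    using u[OF j1(1)] j1(2) M0 by (simp add: composition_operator_def v'_def norm_divide)
  then have T: "1 \<le> \<kappa> * dirichlet_norm \<alpha> (cusp_operator f)"
    using \<kappa>(2)[OF cusp_operator_contraction(1)[OF f \<alpha>] j1(1)] by simp
  \<comment> \<open>Rescaling to the unit ball, over which \<open>operator_norm\<close> is
    taken.\<close>
  define g where "g = (\<lambda>z. of_real (1 / A) * f z)"
  have g: "g \<in> dirichlet_space \<alpha>" "dirichlet_norm \<alpha> g \<le> 1"
    unfolding g_def using dirichlet_scale[OF f \<alpha>, of "of_real (1 / A)"] fA A(1) by (auto simp: norm_divide)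
  have "\<forall>c. \<forall>f\<in>dirichlet_space \<alpha>. R (\<lambda>z. c * f z) = (\<lambda>z. c * R f z)"
    using R(1) unfolding bounded_operator_def by (elim conjE)
  from this[rule_format, OF f] have "R g = (\<lambda>z. of_real (1 / A) * R f z)"
    unfolding g_def .
  moreover have "cusp_operator g = (\<lambda>z. of_real (1 / A) * cusp_operator f z)"
    unfolding g_def by (rule cusp_operator_linear(3))
  ultimately have "(cusp_operator - R) g = (\<lambda>z. of_real (1 / A) * cusp_operator f z)"
    by (simp add: fun_diff_def Rf)
  then have "dirichlet_norm \<alpha> ((cusp_operator - R) g) = 1 / A * dirichlet_norm \<alpha> (cusp_operator f)"
    using dirichlet_scale(2)[OF cusp_operator_contraction(1)[OF f \<alpha>] \<alpha>, of "of_real (1 / A)"] A(1)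
    by (simp add: norm_divide)
  moreover have "1 / A * (1 / \<kappa>) \<le> 1 / A * dirichlet_norm \<alpha> (cusp_operator f)"
    using T A(1) \<kappa>(1) by (intro mult_left_mono) (auto simp: pos_divide_le_eq mult.commute)
  ultimately show "1 / (A * \<kappa>) \<le> operator_norm \<alpha> (cusp_operator - R)"
    using operator_norm_ge[OF R(1) \<alpha> g] by simp
qed

text \<open>The energy is at most B^2 times the area pi, which contributes (\<alpha> + 1) B^2 to the
  squared norm; the value at 0 adds one more B^2.\<close>

lemma dirichlet_norm_le_sup:
  assumes \<alpha>: "\<alpha> \<ge> 0" and f: "f holomorphic_on unit_disk" "\<And>z. z \<notin> unit_disk \<Longrightarrow> f z = 0"
    and B: "B \<ge> 0" "cmod (f 0) \<le> B" "\<And>z. z \<in> unit_disk \<Longrightarrow> cmod (deriv f z) \<le> B"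
  shows "f \<in> dirichlet_space \<alpha>" "dirichlet_norm \<alpha> f \<le> sqrt (\<alpha> + 2) * B"
proof -
  have "energy \<alpha> unit_disk (deriv f) \<le> (\<integral>\<^sup>+z. ennreal (B\<^sup>2) * indicator unit_disk z \<partial>lborel)"
    unfolding energy_def
  proof (intro nn_integral_mono)
    fix z
    have "(cmod (deriv f z))\<^sup>2 * (1 - (cmod z)\<^sup>2) powr \<alpha> \<le> B\<^sup>2 * 1" if "z \<in> unit_disk"
      using B(3)[OF that] weight_le_1[OF \<alpha> that] by (intro mult_mono power_mono) auto
    then show "ennreal (indicator unit_disk z * ((cmod (deriv f z))\<^sup>2 * (1 - (cmod z)\<^sup>2) powr \<alpha>)) \<le> ennreal (B\<^sup>2) * indicator unit_disk z"
      by (auto simp: indicator_def intro: ennreal_leI)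
  qed
  also have "\<dots> = ennreal (B\<^sup>2) * emeasure lborel unit_disk" by (simp add: nn_integral_cmult_indicator)
  also have "\<dots> = ennreal (B\<^sup>2 * pi)" by (simp add: emeasure_ball unit_ball_vol_2 ennreal_mult)
  finally have e: "energy \<alpha> unit_disk (deriv f) \<le> ennreal (B\<^sup>2 * pi)" .
  show mem: "f \<in> dirichlet_space \<alpha>"
    using f le_less_trans[OF e] by (auto simp: dirichlet_space_iff)
  obtain E where E: "E \<ge> 0" "energy \<alpha> unit_disk (deriv f) = ennreal E"
    "(dirichlet_norm \<alpha> f)\<^sup>2 = (cmod (f 0))\<^sup>2 + (\<alpha> + 1) / pi * E"
    using dirichlet_normE[OF mem \<alpha>] .
  have "E \<le> B\<^sup>2 * pi" using e E by simp
  then have "(\<alpha> + 1) / pi * E \<le> (\<alpha> + 1) / pi * (B\<^sup>2 * pi)" using \<alpha> by (intro mult_left_mono) auto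
  moreover have "(\<alpha> + 1) / pi * (B\<^sup>2 * pi) = (\<alpha> + 1) * B\<^sup>2" by simp
  moreover have "(cmod (f 0))\<^sup>2 \<le> B\<^sup>2" using B by (intro power_mono) auto
  moreover have "(\<alpha> + 2) * B\<^sup>2 = (\<alpha> + 1) * B\<^sup>2 + B\<^sup>2" by (simp add: algebra_simps)
  ultimately have "(dirichlet_norm \<alpha> f)\<^sup>2 \<le> (\<alpha> + 2) * B\<^sup>2" unfolding E(3) by linarith
  then have "dirichlet_norm \<alpha> f \<le> sqrt ((\<alpha> + 2) * B\<^sup>2)" by (rule real_le_rsqrt)
  then show "dirichlet_norm \<alpha> f \<le> sqrt (\<alpha> + 2) * B" using B(1) by (simp add: real_sqrt_mult)
qed

definition interpolant :: "real \<Rightarrow> nat \<Rightarrow> nat \<Rightarrow> complex \<Rightarrow> complex" where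
  "interpolant q n j z = (if z \<in> unit_disk then
     (\<Prod>i\<in>{..<n} - {j}. blaschke (geometric_node q i) z) /
     (\<Prod>i\<in>{..<n} - {j}. blaschke (geometric_node q i) (of_real (geometric_node q j))) else 0)"

lemma interpolant_delta:
  assumes q: "0 < q" "q < 1" and ij: "i < n" "j < n"
  shows "interpolant q n j (of_real (geometric_node q i)) = (if i = j then 1 else 0)"
proof -
  have "of_real (geometric_node q i) \<in> unit_disk"
    using geometric_node_bounds[OF q, of i] by simp
  moreover have "(\<Prod>i\<in>{..<n} - {j}. blaschke (geometric_node q i) (of_real (geometric_node q j))) \<noteq> 0"
    using blaschke_separation[OF q ij(2)] exp_gt_zero[of "- (16 / (1 - q))"] by fastforce
  moreover have "(\<Prod>k\<in>{..<n} - {j}. blaschke (geometric_node q k) (of_real (geometric_node q i))) = 0" if "i \<noteq> j"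
    using ij that by (intro prod_zero) (auto simp: blaschke_def intro!: bexI[of _ i])
  ultimately show ?thesis by (auto simp: interpolant_def)
qed

text \<open>The product rule leaves at most n terms, each with one differentiated factor, bounded by
  2 / q^n because every node is at distance at least q^n from 1, and other factors of modulus at
  most 1. The normalising denominator is bounded below by
  \<open>blaschke_separation\<close>.\<close>

lemma interpolant_derivative:
  assumes q: "0 < q" "q < 1" and j: "j < n" and z: "z \<in> unit_disk"
  obtains D where "(interpolant q n j has_field_derivative D) (at z)"
    "cmod D \<le> real n * (2 / q ^ n) * exp (16 / (1 - q))"
proof -
  let ?b = "\<lambda>i. blaschke (geometric_node q i)"
  let ?I = "{..<n} - {j}"
  define d where "d = (\<lambda>i. of_real (1 - (geometric_node q i)\<^sup>2) / (1 - of_real (geometric_node q i) * z)\<^sup>2 :: complex)"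
  define P where "P = (\<Prod>i\<in>?I. ?b i (of_real (geometric_node q j)))"
  define D where "D = (\<Sum>i\<in>?I. d i * (\<Prod>k\<in>?I - {i}. ?b k z)) / P"
  note w = geometric_node_bounds[OF q]
  have "((\<lambda>z. \<Prod>i\<in>?I. ?b i z) has_field_derivative (\<Sum>i\<in>?I. d i * (\<Prod>k\<in>?I - {i}. ?b k z))) (at z)"
    unfolding d_def by (rule has_field_derivative_prod) (rule blaschke_facts(3)[OF w(1,2) z])
  then have "((\<lambda>z. (\<Prod>i\<in>?I. ?b i z) / P) has_field_derivative D) (at z)"
    unfolding D_def by (rule DERIV_cdivide)
  then have 1: "(interpolant q n j has_field_derivative D) (at z)"
    by (rule has_field_derivative_transform_within_open[OF _ open_ball z]) (simp add: interpolant_def P_def)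
  have db: "cmod (d i * (\<Prod>k\<in>?I - {i}. ?b k z)) \<le> 2 / q ^ n" if i: "i \<in> ?I" for i
  proof -
    have "q ^ n \<le> q ^ i" using q i by (intro power_decreasing) auto
    then have "q ^ n \<le> 1 - geometric_node q i" using w(3)[of i] by linarith
    then have "2 / (1 - geometric_node q i) \<le> 2 / q ^ n"
      using w(2)[of i] q by (intro divide_left_mono mult_pos_pos) auto
    then have "cmod (d i) \<le> 2 / q ^ n" unfolding d_def using blaschke_facts(4)[OF w(1,2) z, of i] by (rule order_trans[rotated])
    moreover have "(\<Prod>k\<in>?I - {i}. cmod (?b k z)) \<le> 1"
      using blaschke_facts(2)[OF w(1,2) z] by (intro prod_le_1) auto
    ultimately have "cmod (d i) * (\<Prod>k\<in>?I - {i}. cmod (?b k z)) \<le> 2 / q ^ n * 1"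
      using q by (intro mult_mono prod_nonneg) auto
    then show ?thesis by (simp add: norm_mult prod_norm)
  qed
  have "cmod (\<Sum>i\<in>?I. d i * (\<Prod>k\<in>?I - {i}. ?b k z)) \<le> (\<Sum>i\<in>?I. 2 / q ^ n)"
    using db by (intro order_trans[OF norm_sum] sum_mono)
  also have "\<dots> = real (card ?I) * (2 / q ^ n)" by simp
  also have "\<dots> \<le> real n * (2 / q ^ n)"
    using q card_mono[of "{..<n}" ?I] by (intro mult_right_mono) auto
  finally have num: "cmod (\<Sum>i\<in>?I. d i * (\<Prod>k\<in>?I - {i}. ?b k z)) \<le> real n * (2 / q ^ n)" .
  have "cmod D \<le> (real n * (2 / q ^ n)) / exp (- (16 / (1 - q)))"
    unfolding D_def norm_divide P_def
    using num blaschke_separation[OF q j] q by (intro frac_le) auto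
  then have "cmod D \<le> real n * (2 / q ^ n) * exp (16 / (1 - q))" by (simp add: exp_minus field_simps)
  with 1 show ?thesis using that by blast
qed

text \<open>One factor n comes from the number of interpolants, the other from the product rule
  inside each of them.\<close>

lemma interpolant_combination:
  assumes \<alpha>: "\<alpha> \<ge> 0" and q: "0 < q" "q < 1" and v: "\<And>j. j < n \<Longrightarrow> cmod (v j) \<le> 1"
  shows "(\<lambda>z. \<Sum>j<n. v j * interpolant q n j z) \<in> dirichlet_space \<alpha>"
    "dirichlet_norm \<alpha> (\<lambda>z. \<Sum>j<n. v j * interpolant q n j z) \<le> sqrt (\<alpha> + 2) * ((real n)\<^sup>2 * (2 / q ^ n) * exp (16 / (1 - q)))"
proof -
  let ?f = "\<lambda>z. \<Sum>j<n. v j * interpolant q n j z"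
  define E where "E = exp (16 / (1 - q))"
  define B where "B = (real n)\<^sup>2 * (2 / q ^ n) * E"
  have E: "E > 0" by (simp add: E_def)
  have D: "\<exists>D. (?f has_field_derivative D) (at z) \<and> cmod D \<le> B" if z: "z \<in> unit_disk" for z
  proof -
    have "\<forall>j\<in>{..<n}. \<exists>D. (interpolant q n j has_field_derivative D) (at z) \<and> cmod D \<le> real n * (2 / q ^ n) * E"
      using interpolant_derivative[OF q _ z] unfolding E_def by (metis lessThan_iff)
    then obtain D where D: "\<And>j. j < n \<Longrightarrow> (interpolant q n j has_field_derivative D j) (at z)"
      "\<And>j. j < n \<Longrightarrow> cmod (D j) \<le> real n * (2 / q ^ n) * E"
      by (metis lessThan_iff)
    have "(?f has_field_derivative (\<Sum>j<n. v j * D j)) (at z)"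
      by (intro DERIV_sum DERIV_cmult D) auto
    moreover have "cmod (\<Sum>j<n. v j * D j) \<le> (\<Sum>j<n. 1 * (real n * (2 / q ^ n) * E))"
    proof (intro order_trans[OF norm_sum] sum_mono)
      fix j assume "j \<in> {..<n}"
      then show "cmod (v j * D j) \<le> 1 * (real n * (2 / q ^ n) * E)"
        unfolding norm_mult using v D(2) by (intro mult_mono) auto
    qed
    ultimately show ?thesis by (intro exI[of _ "\<Sum>j<n. v j * D j"]) (simp add: B_def power2_eq_square mult_ac)
  qed
  have hol: "?f holomorphic_on unit_disk"
    unfolding holomorphic_on_open[OF open_ball] using D by blast
  have d: "cmod (deriv ?f z) \<le> B" if "z \<in> unit_disk" for z
    using D[OF that] DERIV_imp_deriv by blast
  have "cmod (?f 0) \<le> B"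
  proof -
    have "cmod (v j * interpolant q n j 0) \<le> 1 * E" if j: "j < n" for j
    proof -
      have "cmod (\<Prod>i\<in>{..<n} - {j}. blaschke (geometric_node q i) 0) \<le> 1"
        unfolding prod_norm[symmetric] using blaschke_facts(2)[OF geometric_node_bounds(1,2)[OF q], of 0] by (intro prod_le_1) auto
      then have "cmod (interpolant q n j 0) \<le> 1 / exp (- (16 / (1 - q)))"
        unfolding interpolant_def using blaschke_separation[OF q j] by (simp add: norm_divide) (intro frac_le; simp)
      then have "cmod (interpolant q n j 0) \<le> E" by (simp add: E_def exp_minus inverse_eq_divide)
      then show ?thesis unfolding norm_mult using v[OF j] by (intro mult_mono) auto
    qed
    then have "cmod (?f 0) \<le> (\<Sum>j<n. 1 * E)" by (intro order_trans[OF norm_sum] sum_mono) auto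
    also have "\<dots> = real n * E" by simp
    also have "\<dots> \<le> B"
    proof -
      have "real n \<le> (real n)\<^sup>2" by (cases n) (auto simp: power2_eq_square)
      moreover have "1 \<le> 2 / q ^ n"
      proof -
        have "q ^ n \<le> 1" using q by (simp add: power_le_one)
        then show ?thesis using q by (simp add: pos_le_divide_eq)
      qed
      ultimately have "real n * 1 \<le> (real n)\<^sup>2 * (2 / q ^ n)" by (intro mult_mono) auto
      then show ?thesis unfolding B_def using E by (intro mult_right_mono) auto
    qed
    finally show ?thesis .
  qed
  moreover have "B \<ge> 0" using q E by (simp add: B_def)
  moreover have "?f z = 0" if "z \<notin> unit_disk" for z using that by (simp add: interpolant_def)
  ultimately show "?f \<in> dirichlet_space \<alpha>"
    "dirichlet_norm \<alpha> ?f \<le> sqrt (\<alpha> + 2) * ((real n)\<^sup>2 * (2 / q ^ n) * exp (16 / (1 - q)))"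
    using dirichlet_norm_le_sup[OF \<alpha> hol, of B] d unfolding B_def E_def by blast+
qed

lemma approx_number_lower:
  assumes \<alpha>: "\<alpha> \<ge> 0"
  obtains c where "c > 0" "\<And>n q. n \<ge> 1 \<Longrightarrow> 0 < q \<Longrightarrow> q < 1 \<Longrightarrow>
    c * (q ^ n)\<^sup>2 / (real n)\<^sup>2 * exp (- (16 / (1 - q)) - 2 * \<alpha> / q ^ n) \<le> approx_number \<alpha> n cusp_operator"
proof -
  define C where "C = 2 * 2 powr (\<alpha> / 2)"
  have C: "C > 0" by (simp add: C_def)
  define c where "c = 1 / (2 * sqrt (\<alpha> + 2) * (1 + 4 * C))"
  have c: "c > 0" using C \<alpha> by (simp add: c_def)
  have "c * (q ^ n)\<^sup>2 / (real n)\<^sup>2 * exp (- (16 / (1 - q)) - 2 * \<alpha> / q ^ n) \<le> approx_number \<alpha> n cusp_operator"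
    if n: "n \<ge> 1" and q: "0 < q" "q < 1" for n :: nat and q :: real
  proof -
    \<comment> \<open>A common lower bound for the distances of the n nodes from 1.\<close>
    define h where "h = q ^ n"
    have h: "0 < h" "h \<le> 1" using q by (auto simp: h_def power_le_one)
    note w = geometric_node_bounds[OF q]
    have "\<forall>j. \<exists>u::real. 0 \<le> u \<and> u < 1 \<and> cusp_map (of_real u) = of_real (geometric_node q j) \<and>
        exp (- 4 / (1 - geometric_node q j)) \<le> 1 - u"
      using cusp_map_real_preimage[OF w(1,2)] by metis
    then obtain u :: "nat \<Rightarrow> real" where u: "\<And>j. 0 \<le> u j" "\<And>j. u j < 1"
      "\<And>j. cusp_map (of_real (u j)) = of_real (geometric_node q j)"
      "\<And>j. exp (- 4 / (1 - geometric_node q j)) \<le> 1 - u j"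
      by metis
    define A where "A = sqrt (\<alpha> + 2) * ((real n)\<^sup>2 * (2 / h) * exp (16 / (1 - q)))"
    \<comment> \<open>From 1 - u j >= exp (-4 / h): in the point evaluation the logarithm is at most
      4 / h and the power at most exp (2 \<alpha> / h), while 1 / h >= 1 absorbs the summand
      1.\<close>
    define \<kappa> where "\<kappa> = (1 + 4 * C) / h * exp (2 * \<alpha> / h)"
    have A0: "A > 0" using \<alpha> n h by (simp add: A_def)
    have \<kappa>0: "\<kappa> > 0" using C h by (simp add: \<kappa>_def)
    have eval: "cmod (F (of_real (u j))) \<le> \<kappa> * dirichlet_norm \<alpha> F" if F: "F \<in> dirichlet_space \<alpha>" and j: "j < n" for F j
    proof -
      have "h \<le> q ^ j" unfolding h_def using q j by (intro power_decreasing) auto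
      then have hw: "h \<le> 1 - geometric_node q j" using w(3)[of j] by linarith
      then have "4 / (1 - geometric_node q j) \<le> 4 / h" using h by (intro divide_left_mono) auto
      then have "exp (- 4 / h) \<le> exp (- 4 / (1 - geometric_node q j))" by simp
      then have e: "exp (- 4 / h) \<le> 1 - u j" using u(4)[of j] by linarith
      have "ln (exp (- 4 / h)) \<le> ln (1 - u j)" using e u(2)[of j] by (subst ln_le_cancel_iff) auto
      then have ln1: "- ln (1 - u j) \<le> 4 / h" by simp
      have ln0: "0 \<le> - ln (1 - u j)" using u(1,2)[of j] by simp
      have "(1 - u j) powr (- \<alpha> / 2) \<le> exp (- 4 / h) powr (- \<alpha> / 2)"
        using e \<alpha> by (intro powr_mono2') auto
      also have "\<dots> = exp (2 * \<alpha> / h)" by (simp add: exp_powr_real)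
      finally have p: "(1 - u j) powr (- \<alpha> / 2) \<le> exp (2 * \<alpha> / h)" .
      have "C * (1 - u j) powr (- \<alpha> / 2) * (- ln (1 - u j)) \<le> C * exp (2 * \<alpha> / h) * (4 / h)"
        using p ln1 ln0 C by (intro mult_mono mult_left_mono) auto
      moreover have "1 \<le> 1 / h * exp (2 * \<alpha> / h)"
      proof -
        have "1 * 1 \<le> 1 / h * exp (2 * \<alpha> / h)" using h \<alpha> by (intro mult_mono) auto
        then show ?thesis by simp
      qed
      ultimately have "1 + C * (1 - u j) powr (- \<alpha> / 2) * (- ln (1 - u j)) \<le> 1 / h * exp (2 * \<alpha> / h) + C * exp (2 * \<alpha> / h) * (4 / h)"
        by linarith
      also have "\<dots> = \<kappa>" by (simp add: \<kappa>_def add_divide_distrib algebra_simps)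
      finally have "1 + C * (1 - u j) powr (- \<alpha> / 2) * (- ln (1 - u j)) \<le> \<kappa>" .
      then have "(1 + C * (1 - u j) powr (- \<alpha> / 2) * (- ln (1 - u j))) * dirichlet_norm \<alpha> F \<le> \<kappa> * dirichlet_norm \<alpha> F"
        by (intro mult_right_mono dirichlet_norm_nonneg \<alpha>)
      then show ?thesis
        using dirichlet_point_evaluation[OF \<alpha> F u(1,2), of j] unfolding C_def by linarith
    qed
    have single: "interpolant q n j \<in> dirichlet_space \<alpha>" if "j < n" for j
    proof -
      have "(\<Sum>k<n. (if k = j then 1 else 0) * interpolant q n k z) = interpolant q n j z" for z
        using that by (simp add: if_distrib[of "\<lambda>x. x * _"] cong: if_cong)
      then show ?thesis
        using interpolant_combination(1)[OF \<alpha> q, of n "\<lambda>k. if k = j then 1 else 0"] by simp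
    qed
    have "1 / (A * \<kappa>) \<le> approx_number \<alpha> n cusp_operator"
    proof (rule approx_number_ge[OF \<alpha> n, of "interpolant q n" "\<lambda>j. of_real (u j)"])
      show "interpolant q n j (cusp_map (of_real (u i))) = (if i = j then 1 else 0)" if "i < n" "j < n" for i j
        unfolding u(3) by (rule interpolant_delta[OF q that])
      show "dirichlet_norm \<alpha> (\<lambda>z. \<Sum>j<n. v j * interpolant q n j z) \<le> A" if "\<And>j. j < n \<Longrightarrow> cmod (v j) \<le> 1" for v
        unfolding A_def h_def by (rule interpolant_combination(2)[OF \<alpha> q that])
    qed (use A0 \<kappa>0 eval u single in auto)
    moreover have "1 / (A * \<kappa>) = c * h\<^sup>2 / (real n)\<^sup>2 * exp (- (16 / (1 - q)) - 2 * \<alpha> / h)"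
    proof -
      have "1 / ((s * (m\<^sup>2 * (2 / h) * X)) * (K / h * Y)) = 1 / (2 * s * K) * h\<^sup>2 / m\<^sup>2 * (1 / (X * Y))"
        for s m X Y K :: real
        using h by (simp add: power2_eq_square field_simps)
      moreover have "exp (- x - y) = 1 / (exp x * exp y)" for x y :: real
        by (simp add: exp_diff exp_minus field_simps)
      ultimately show ?thesis unfolding A_def \<kappa>_def c_def by (simp only:)
    qed
    ultimately show ?thesis by (simp add: h_def)
  qed
  with c show ?thesis using that by blast
qed

section \<open>Bounds for the approximation numbers\<close>

text \<open>A qualitative \<open>N\<close> suffices, since it never enters the rank. Where |1 - w|
  >= h, the image stays in the disk of radius 1 - \<eta>, and vanishing to order \<open>N\<close> at
  0 makes g uniformly small there; \<open>tail\<close> covers the rest.\<close>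

lemma pull_energy_high_order:
  assumes \<alpha>: "\<alpha> \<ge> 0" and \<epsilon>: "\<epsilon> > 0" and h: "h > 0"
    and tail: "\<And>g. g holomorphic_on unit_disk \<Longrightarrow>
      pull_energy \<alpha> {w. cmod (1 - w) < h} g \<le> ennreal (\<epsilon> / 2) * energy \<alpha> unit_disk g"
  obtains N where "\<And>g. g holomorphic_on unit_disk \<Longrightarrow> (\<And>k. k < N \<Longrightarrow> (deriv ^^ k) g 0 = 0) \<Longrightarrow>
      pull_energy \<alpha> UNIV g \<le> ennreal \<epsilon> * energy \<alpha> unit_disk g"
proof -
  define \<eta> where "\<eta> = min (1 / 2) ((2 - cusp_const) / 4 * h)"
  have \<eta>: "0 < \<eta>" "\<eta> \<le> 1 / 2" using h cusp_const_bounds by (auto simp: \<eta>_def)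
  \<comment> \<open>Halfway between 1 - \<eta> and 1: this leaves room for the pointwise bound on
    |z| <= \<rho> as well as for a Schwarz ratio q < 1.\<close>
  define \<rho> where "\<rho> = 1 - \<eta> / 2"
  define q where "q = (1 - \<eta>) / \<rho>"
  have \<rho>: "0 < \<rho>" "\<rho> < 1" using \<eta> by (auto simp: \<rho>_def)
  have q: "0 \<le> q" "q < 1" using \<eta> by (auto simp: q_def \<rho>_def field_simps)
  define k where "k = pi / 4 * 2 powr (- \<alpha>) * (\<eta> / 2) powr (2 + \<alpha>)"
  have k: "k > 0" using \<eta> by (simp add: k_def)
  have "q\<^sup>2 < 1" using q by (simp add: abs_square_less_1)
  moreover have "0 < \<epsilon> / 2 * ((1 - q)\<^sup>2 * k) / pi" using \<epsilon> q k by simp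
  ultimately obtain N where N: "(q\<^sup>2) ^ N < \<epsilon> / 2 * ((1 - q)\<^sup>2 * k) / pi"
    using real_arch_pow_inv by blast
  have "pull_energy \<alpha> UNIV g \<le> ennreal \<epsilon> * energy \<alpha> unit_disk g"
    if g: "g holomorphic_on unit_disk" and vanish: "\<And>k. k < N \<Longrightarrow> (deriv ^^ k) g 0 = 0" for g
  proof (cases "energy \<alpha> unit_disk g = \<infinity>")
    case True
    then show ?thesis using \<epsilon> by (simp add: ennreal_mult_top)
  next
    case False
    then obtain E where E: "energy \<alpha> unit_disk g = ennreal E" "E \<ge> 0"
      by (cases "energy \<alpha> unit_disk g" rule: ennreal_cases) auto
    let ?S = "{w \<in> cusp_map ` unit_disk. h \<le> cmod (1 - w)}"
    define M where "M = sqrt (E / k)"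
    have M: "cmod (g z) \<le> M" if z: "z \<in> cball 0 \<rho>" for z
    proof -
      have zD: "z \<in> unit_disk" and z1: "\<eta> / 2 \<le> 1 - cmod z" using z \<rho> by (auto simp: \<rho>_def)
      have "(cmod (g z))\<^sup>2 * (pi / 4 * 2 powr (- \<alpha>) * (1 - cmod z) powr (2 + \<alpha>)) \<le> E"
        using pointwise_energy_bound[OF \<alpha> g zD] E by simp
      moreover have "(\<eta> / 2) powr (2 + \<alpha>) \<le> (1 - cmod z) powr (2 + \<alpha>)"
        using z1 \<eta> \<alpha> by (intro powr_mono2) auto
      then have "(cmod (g z))\<^sup>2 * k \<le> (cmod (g z))\<^sup>2 * (pi / 4 * 2 powr (- \<alpha>) * (1 - cmod z) powr (2 + \<alpha>))"
        unfolding k_def by (intro mult_left_mono) auto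
      ultimately have "(cmod (g z))\<^sup>2 * k \<le> E" by linarith
      then have "(cmod (g z))\<^sup>2 \<le> E / k" using k by (simp add: pos_le_divide_eq)
      then show ?thesis unfolding M_def by (rule real_le_rsqrt)
    qed
    define B where "B = M * q ^ N / (1 - q)"
    have B: "cmod (g w) \<le> B" if w: "w \<in> ?S" for w
      unfolding B_def
    proof (rule higher_schwarz[OF \<rho>(1) q _ _ M vanish])
      show "g holomorphic_on ball 0 \<rho>" using \<rho> by (intro holomorphic_on_subset[OF g]) auto
      show "continuous_on (cball 0 \<rho>) g"
        using \<rho> by (intro continuous_on_subset[OF holomorphic_on_imp_continuous_on[OF g]]) auto
      obtain z where z: "z \<in> unit_disk" "w = cusp_map z" "h \<le> cmod (1 - w)" using w by auto
      have "(2 - cusp_const) / 4 * h \<le> (2 - cusp_const) / 4 * cmod (1 - w)"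
        using z cusp_const_bounds by (intro mult_left_mono) auto
      then have "\<eta> \<le> 1 - cmod w" using cusp_map_geometry(5)[OF z(1)] unfolding z(2)[symmetric] \<eta>_def by linarith
      then show "cmod (w - 0) \<le> q * \<rho>" using \<rho> by (simp add: q_def)
    qed
    have "energy \<alpha> ?S g \<le> (\<integral>\<^sup>+z. ennreal (B\<^sup>2) * indicator unit_disk z \<partial>lborel)"
      unfolding energy_def
    proof (intro nn_integral_mono)
      fix w
      have "(cmod (g w))\<^sup>2 * (1 - (cmod w)\<^sup>2) powr \<alpha> \<le> B\<^sup>2 * 1 \<and> w \<in> unit_disk" if w: "w \<in> ?S"
        using B[OF w] cusp_map_image_disk w weight_le_1[OF \<alpha>, of w]
        by (intro conjI mult_mono power_mono) auto
      then show "ennreal (indicator ?S w * ((cmod (g w))\<^sup>2 * (1 - (cmod w)\<^sup>2) powr \<alpha>)) \<le> ennreal (B\<^sup>2) * indicator unit_disk w"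
        by (cases "w \<in> ?S") (auto intro: ennreal_leI)
    qed
    also have "\<dots> = ennreal (B\<^sup>2) * emeasure lborel unit_disk" by (simp add: nn_integral_cmult_indicator)
    also have "\<dots> = ennreal (B\<^sup>2 * pi)" by (simp add: emeasure_ball unit_ball_vol_2 ennreal_mult)
    also have "B\<^sup>2 * pi \<le> \<epsilon> / 2 * E"
    proof -
      have "B\<^sup>2 = E / k * (q\<^sup>2) ^ N / (1 - q)\<^sup>2"
        using E k by (simp add: B_def M_def power_mult_distrib power_divide power_mult[symmetric] mult.commute)
      then have "B\<^sup>2 * pi = E * ((q\<^sup>2) ^ N * (pi / ((1 - q)\<^sup>2 * k)))" by (simp add: mult_ac)
      also have "\<dots> \<le> E * ((\<epsilon> / 2 * ((1 - q)\<^sup>2 * k) / pi) * (pi / ((1 - q)\<^sup>2 * k)))"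
        using N E k by (intro mult_left_mono mult_right_mono) auto
      also have "\<dots> = \<epsilon> / 2 * E" using k q by simp
      finally show ?thesis .
    qed
    then have "ennreal (B\<^sup>2 * pi) \<le> ennreal (\<epsilon> / 2 * E)" by (rule ennreal_leI)
    finally have "energy \<alpha> ?S g \<le> ennreal (\<epsilon> / 2 * E)" .
    moreover have "pull_energy \<alpha> {w. cmod (1 - w) < h} g \<le> ennreal (\<epsilon> / 2 * E)"
      using tail[OF g] E(2) \<epsilon> unfolding E(1) by (subst (asm) ennreal_mult[symmetric]) auto
    ultimately have "pull_energy \<alpha> UNIV g \<le> ennreal (\<epsilon> / 2 * E) + ennreal (\<epsilon> / 2 * E)"
      using pull_energy_split[OF \<alpha> g, of h] by (meson add_mono order_trans)
    also have "\<dots> = ennreal \<epsilon> * energy \<alpha> unit_disk g"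
      unfolding E(1) using \<epsilon> E(2) by (simp add: ennreal_plus[symmetric] ennreal_mult[symmetric] del: ennreal_plus)
    finally show ?thesis .
  qed
  then show ?thesis using that by blast
qed

text \<open>The rank is counted as one condition for f 0 = 0 and \<open>m\<close> conditions at each
  of at most K (J + 1) disk centres.\<close>

lemma approx_number_upper:
  assumes \<alpha>: "\<alpha> \<ge> 0" and \<tau>: "\<And>J. \<tau> J > 0" "\<tau> \<longlonglongrightarrow> 0"
    and tail: "\<And>J g. g holomorphic_on unit_disk \<Longrightarrow>
      pull_energy \<alpha> {w. cmod (1 - w) < cusp_const / 2 ^ J} g \<le> ennreal (\<tau> J) * energy \<alpha> unit_disk g"
  obtains K :: nat where "K > 0" "\<And>n J m. n > 1 + K * (J + 1) * m \<Longrightarrow>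
    approx_number \<alpha> n cusp_operator \<le> sqrt (10 * (real K * real (J + 1) * (4 * 14 powr \<alpha> / 4 ^ m) + \<tau> J))"
proof -
  obtain K :: nat where K: "K > 0" "\<And>J. \<exists>(I :: (complex \<times> nat) set) c r. finite I \<and> card I \<le> K * (J + 1) \<and>
     (\<forall>i\<in>I. r i > 0 \<and> 4 * r i \<le> 1 - cmod (c i)) \<and>
     {w \<in> cusp_map ` unit_disk. cusp_const / 2 ^ J \<le> cmod (1 - w)} \<subseteq> (\<Union>i\<in>I. ball (c i) (r i))"
    by (rule cusp_cover) (rule that)
  have "approx_number \<alpha> n cusp_operator \<le> sqrt (10 * (real K * real (J + 1) * (4 * 14 powr \<alpha> / 4 ^ m) + \<tau> J))"
    if n: "n > 1 + K * (J + 1) * m" for n J m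
  proof -
    define \<delta> where "\<delta> = real K * real (J + 1) * (4 * 14 powr \<alpha> / 4 ^ m) + \<tau> J"
    have \<delta>: "\<delta> > 0" unfolding \<delta>_def using \<tau>(1)[of J] by (intro add_nonneg_pos) auto
    obtain I :: "(complex \<times> nat) set" and c r where I: "finite I" "card I \<le> K * (J + 1)"
      and r: "\<And>i. i \<in> I \<Longrightarrow> r i > 0" "\<And>i. i \<in> I \<Longrightarrow> 4 * r i \<le> 1 - cmod (c i)"
      and cover: "{w \<in> cusp_map ` unit_disk. cusp_const / 2 ^ J \<le> cmod (1 - w)} \<subseteq> (\<Union>i\<in>I. ball (c i) (r i))"
      using K(2)[of J] by blast
    \<comment> \<open>A second cut-off, not tied to \<open>J\<close> and possibly far deeper, which
      serves only to make the remainder after the Taylor polynomial small.\<close>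
    have "\<forall>\<^sub>F j in sequentially. \<tau> j < \<delta> / 2"
      using order_tendstoD(2)[OF \<tau>(2), of "\<delta> / 2"] \<delta> by simp
    then obtain j where j: "\<tau> j < \<delta> / 2" by (auto simp: eventually_sequentially)
    have half: "pull_energy \<alpha> {w. cmod (1 - w) < cusp_const / 2 ^ j} g \<le> ennreal (\<delta> / 2) * energy \<alpha> unit_disk g"
      if "g holomorphic_on unit_disk" for g
    proof -
      have "ennreal (\<tau> j) * energy \<alpha> unit_disk g \<le> ennreal (\<delta> / 2) * energy \<alpha> unit_disk g"
        using j by (intro mult_right_mono ennreal_leI) auto
      then show ?thesis by (rule order_trans[OF tail[OF that]])
    qed
    have h0: "cusp_const / 2 ^ j > 0" using cusp_const_bounds by simp
    obtain N where N: "\<And>g. g holomorphic_on unit_disk \<Longrightarrow> (\<And>k. k < N \<Longrightarrow> (deriv ^^ k) g 0 = 0) \<Longrightarrow>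
      pull_energy \<alpha> UNIV g \<le> ennreal \<delta> * energy \<alpha> unit_disk g"
      by (rule pull_energy_high_order[OF \<alpha> \<delta> h0 half]) blast+
    \<comment> \<open>Conditions of order k on f' are conditions of order \<open>Suc k\<close> on f;
      the pair \<open>(0, 0)\<close> stands for f 0 = 0.\<close>
    define X where "X = insert (0, 0) ((\<lambda>(i, k). (Suc k, c i)) ` (I \<times> {..<m}))"
    have "card ((\<lambda>(i, k). (Suc k, c i)) ` (I \<times> {..<m})) \<le> card (I \<times> {..<m})"
      using I(1) by (intro card_image_le) auto
    also have "\<dots> \<le> K * (J + 1) * m" unfolding card_cartesian_product using I(2) by (simp add: mult_right_mono)
    finally have cardX: "card X < n"
      using n unfolding X_def by (intro le_less_trans[OF card_insert_le_m1]) auto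
    have Xfin: "finite X" using I by (simp add: X_def)
    have cD: "c i \<in> unit_disk" if "i \<in> I" for i using r[OF that] by simp
    have XD: "X \<subseteq> UNIV \<times> unit_disk" using cD by (auto simp: X_def)
    have shift: "(deriv ^^ k) (deriv f) z = (deriv ^^ Suc k) f z" for k f and z :: complex
      by (simp only: funpow_Suc_right comp_def)
    have concl: "(dirichlet_norm \<alpha> (cusp_operator f))\<^sup>2 \<le> \<delta> * (dirichlet_norm \<alpha> f)\<^sup>2"
      if "f \<in> dirichlet_space \<alpha>" "f 0 = 0" "pull_energy \<alpha> UNIV (deriv f) \<le> ennreal \<delta> * energy \<alpha> unit_disk (deriv f)" for f
      using cusp_operator_le(2)[OF that(1) \<alpha> less_imp_le[OF \<delta>] that(3)] that(2) by simp
    have "approx_number \<alpha> n cusp_operator \<le> sqrt (10 * \<delta>)"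
    proof (rule finite_rank_approximation[OF \<alpha> Xfin XD less_imp_le[OF \<delta>] _ _ cardX])
      fix f assume f: "f \<in> dirichlet_space \<alpha>" and van: "\<And>k c. (k, c) \<in> X \<Longrightarrow> (deriv ^^ k) f c = 0"
      note g = deriv_holomorphic_disk[OF dirichlet_space_holomorphic[OF f]]
      have "f 0 = 0" using van[of 0 0] by (simp add: X_def)
      moreover have "pull_energy \<alpha> UNIV (deriv f) \<le> ennreal (real (card I) * (4 * 14 powr \<alpha> / 4 ^ m) + \<tau> J) * energy \<alpha> unit_disk (deriv f)"
      proof (rule pull_energy_vanishing[OF \<alpha> g I(1) r cover _ tail[OF g] less_imp_le[OF \<tau>(1)]])
        fix i k assume "i \<in> I" "k < m"
        then show "(deriv ^^ k) (deriv f) (c i) = 0"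
          unfolding shift by (intro van) (force simp: X_def)
      qed
      moreover have "real (card I) * (4 * 14 powr \<alpha> / 4 ^ m) + \<tau> J \<le> \<delta>"
      proof -
        have "real (card I) \<le> real K * real (J + 1)"
          using I(2) unfolding of_nat_mult[symmetric] of_nat_le_iff .
        then show ?thesis unfolding \<delta>_def by (intro add_right_mono mult_right_mono) auto
      qed
      then have "ennreal (real (card I) * (4 * 14 powr \<alpha> / 4 ^ m) + \<tau> J) * energy \<alpha> unit_disk (deriv f) \<le> ennreal \<delta> * energy \<alpha> unit_disk (deriv f)"
        by (intro mult_right_mono ennreal_leI) auto
      ultimately show "(dirichlet_norm \<alpha> (cusp_operator f))\<^sup>2 \<le> \<delta> * (dirichlet_norm \<alpha> f)\<^sup>2"
        using f by (intro concl) (auto intro: order_trans)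
    next
      fix f assume f: "f \<in> dirichlet_space \<alpha>" and van: "\<And>k. k < Suc N \<Longrightarrow> (deriv ^^ k) f 0 = 0"
      have "f 0 = 0" using van[of 0] by simp
      moreover have "pull_energy \<alpha> UNIV (deriv f) \<le> ennreal \<delta> * energy \<alpha> unit_disk (deriv f)"
        by (rule N[OF deriv_holomorphic_disk[OF dirichlet_space_holomorphic[OF f]]])
           (unfold shift, rule van, simp)
      ultimately show "(dirichlet_norm \<alpha> (cusp_operator f))\<^sup>2 \<le> \<delta> * (dirichlet_norm \<alpha> f)\<^sup>2"
        using f by (intro concl) auto
    qed
    then show ?thesis by (simp only: \<delta>_def)
  qed
  with K(1) show ?thesis using that by blast
qed

text \<open>Here y is the exponent aimed at, sqrt n or n / ln n. The factor J + 1 = O(y) is absorbed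
  by giving up half of the exponent of 4^(-m); the slack 2 in the bound for m costs 4^2 = 16; the
  final halving in \<open>b\<close> is due to the square root.\<close>

lemma upper_rate:
  fixes K :: nat
  assumes "K > 0" "P > 0" "\<beta> > 0" "Q > 0" "\<gamma> > 0"
  obtains b C :: real where "b > 0" "C > 0"
    "\<And>(y::real) (J::nat) (m::nat) t. y > 0 \<Longrightarrow> real (J + 1) \<le> P * y \<Longrightarrow> \<beta> * y - 2 \<le> real m \<Longrightarrow> t \<le> Q * exp (- \<gamma> * y) \<Longrightarrow>
      sqrt (10 * (real K * real (J + 1) * (4 * 14 powr \<alpha> / 4 ^ m) + t)) \<le> C * exp (- b * y)"
proof -
  define \<beta>' where "\<beta>' = ln 4 * \<beta>"
  have \<beta>': "\<beta>' > 0" using assms by (simp add: \<beta>'_def)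
  define A where "A = 64 * real K * P * 14 powr \<alpha> * (2 / \<beta>')"
  have A: "A > 0" using assms \<beta>' by (simp add: A_def)
  define b where "b = min (\<beta>' / 2) \<gamma> / 2"
  have b: "b > 0" using assms \<beta>' by (simp add: b_def)
  define C where "C = sqrt (10 * (A + Q))"
  have C: "C > 0" using A assms by (simp add: C_def)
  have "sqrt (10 * (real K * real (J + 1) * (4 * 14 powr \<alpha> / 4 ^ m) + t)) \<le> C * exp (- b * y)"
    if y: "y > 0" and J: "real (J + 1) \<le> P * y" and m: "\<beta> * y - 2 \<le> real m" and t: "t \<le> Q * exp (- \<gamma> * y)"
    for y :: real and J m :: nat and t
  proof -
    have "exp (\<beta>' * y) / 16 = exp ((\<beta> * y - 2) * ln 4)"
    proof -
      have "exp (2 * ln 4) = (16::real)" using exp_double[of "ln (4::real)"] by simp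
      moreover have "exp ((\<beta> * y - 2) * ln 4) = exp (\<beta>' * y) / exp (2 * ln 4)"
        unfolding exp_diff[symmetric] by (simp add: \<beta>'_def left_diff_distrib)
      ultimately show ?thesis by simp
    qed
    also have "\<dots> \<le> exp (real m * ln 4)" using m by simp
    also have "\<dots> = 4 ^ m" by (simp add: exp_of_nat_mult)
    finally have m4: "exp (\<beta>' * y) / 16 \<le> 4 ^ m" .
    have "\<beta>' / 2 * y \<le> exp (\<beta>' / 2 * y)" using exp_ge_add_one_self[of "\<beta>' / 2 * y"] by linarith
    then have ye: "y \<le> 2 / \<beta>' * exp (\<beta>' / 2 * y)" using \<beta>' by (simp add: field_simps)
    have "4 * 14 powr \<alpha> / 4 ^ m \<le> 4 * 14 powr \<alpha> / (exp (\<beta>' * y) / 16)"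
      using m4 by (intro divide_left_mono) auto
    then have "real K * real (J + 1) * (4 * 14 powr \<alpha> / 4 ^ m) \<le> real K * (P * y) * (4 * 14 powr \<alpha> / (exp (\<beta>' * y) / 16))"
      using J y assms by (intro mult_mono) auto
    also have "\<dots> = 64 * real K * P * 14 powr \<alpha> * (y * exp (- \<beta>' * y))"
      by (simp add: exp_minus field_simps)
    also have "\<dots> \<le> 64 * real K * P * 14 powr \<alpha> * (2 / \<beta>' * exp (\<beta>' / 2 * y) * exp (- \<beta>' * y))"
      using ye assms by (intro mult_left_mono mult_right_mono) auto
    also have "\<dots> = A * exp (- (\<beta>' / 2) * y)"
      by (simp add: A_def exp_add[symmetric] mult.assoc)
    also have "\<dots> \<le> A * exp (- (2 * b) * y)"
      using A y by (intro mult_left_mono) (auto simp: b_def intro!: mult_right_mono)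
    finally have 1: "real K * real (J + 1) * (4 * 14 powr \<alpha> / 4 ^ m) \<le> A * exp (- (2 * b) * y)" .
    have "Q * exp (- \<gamma> * y) \<le> Q * exp (- (2 * b) * y)"
      using assms y by (intro mult_left_mono) (auto simp: b_def intro!: mult_right_mono)
    with 1 t have "real K * real (J + 1) * (4 * 14 powr \<alpha> / 4 ^ m) + t \<le> (A + Q) * exp (- (2 * b) * y)"
      unfolding distrib_right by linarith
    then have "10 * (real K * real (J + 1) * (4 * 14 powr \<alpha> / 4 ^ m) + t) \<le> 10 * (A + Q) * exp (- (2 * b) * y)"
      by (simp only: mult.assoc mult_le_cancel_left_pos[of "10::real", OF zero_less_numeral])
    also have "\<dots> = (C * exp (- b * y))\<^sup>2"
    proof -
      have "(exp (- b * y))\<^sup>2 = exp (- (2 * b) * y)" by (simp add: exp_double[symmetric])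
      then show ?thesis using A assms by (simp add: C_def power_mult_distrib)
    qed
    finally have "sqrt (10 * (real K * real (J + 1) * (4 * 14 powr \<alpha> / 4 ^ m) + t)) \<le> sqrt ((C * exp (- b * y))\<^sup>2)"
      by (rule real_sqrt_le_mono)
    then show ?thesis using C by simp
  qed
  with b C show ?thesis using that by blast
qed

section \<open>Choice of the parameters in terms of n\<close>

lemma ln_le_2_sqrt: "x > 0 \<Longrightarrow> ln x \<le> 2 * sqrt (x::real)"
  using ln_le_minus_one[of "sqrt x"] by (simp add: ln_sqrt)

lemma log_scale_bounds:
  assumes n: "n \<ge> (2::nat)"
  defines "y \<equiv> real n / ln (real n)"
  shows "ln 2 \<le> ln (real n)" "0 < y" "ln (real n) \<le> 4 * y" "sqrt (real n) \<le> 2 * y" "ln 2 * y \<le> real n"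
proof -
  show l2: "ln 2 \<le> ln (real n)" using n by simp
  then have l: "0 < ln (real n)" using ln_gt_zero[of 2] by linarith
  then show "0 < y" using n by (simp add: y_def)
  have s: "ln (real n) \<le> 2 * sqrt (real n)" using n by (intro ln_le_2_sqrt) auto
  have "ln (real n) * ln (real n) \<le> (2 * sqrt (real n)) * (2 * sqrt (real n))"
    using s l by (intro mult_mono) auto
  then show "ln (real n) \<le> 4 * y" using l n by (simp add: y_def pos_le_divide_eq)
  have "sqrt (real n) * ln (real n) \<le> sqrt (real n) * (2 * sqrt (real n))"
    using s by (intro mult_left_mono) auto
  also have "\<dots> = 2 * real n" by simp
  finally show "sqrt (real n) \<le> 2 * y" using l by (simp add: y_def pos_le_divide_eq)
  have "ln 2 * real n \<le> real n * ln (real n)" using l2 n by (simp add: mult.commute)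
  then show "ln 2 * y \<le> real n" using l by (simp add: y_def pos_divide_le_eq)
qed

lemma approx_number_1_le:
  assumes "\<alpha> \<ge> 0" shows "approx_number \<alpha> 1 cusp_operator \<le> sqrt 2"
proof (rule approx_number_le[OF assms zero_operator[OF order_refl]])
  fix f assume f: "f \<in> dirichlet_space \<alpha>" "dirichlet_norm \<alpha> f \<le> 1"
  have "dirichlet_norm \<alpha> (cusp_operator f) \<le> sqrt 2 * dirichlet_norm \<alpha> f"
    using cusp_operator_contraction(2)[OF f(1) assms] assms by (intro dirichlet_norm_bound_sqrt) auto
  also have "\<dots> \<le> sqrt 2 * 1" using f(2) by (intro mult_left_mono) auto
  finally show "dirichlet_norm \<alpha> ((cusp_operator - (\<lambda>f z. 0)) f) \<le> sqrt 2" by (simp add: fun_diff_def)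
qed

text \<open>The quotient is the largest m with n > 1 + d m, so the admissible rank is used up except
  for rounding.\<close>

lemma quotient_estimates:
  assumes "n \<ge> 2" "(d::nat) > 0"
  shows "n > 1 + d * ((n - 2) div d)" "(real n - 2) / real d - 1 \<le> real ((n - 2) div d)"
proof -
  have "d * ((n - 2) div d) \<le> n - 2" by (rule times_div_less_eq_dividend)
  then show "n > 1 + d * ((n - 2) div d)" using assms by linarith
  show "(real n - 2) / real d - 1 \<le> real ((n - 2) div d)"
  proof -
    have "n - 2 < d * ((n - 2) div d) + d"
      using dividend_less_times_div[OF assms(2), of "n - 2"] by simp
    then have "real (n - 2) < real (d * ((n - 2) div d) + d)"
      by (rule of_nat_less_iff[THEN iffD2])
    then have "real (n - 2) < real d * (real ((n - 2) div d) + 1)"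
      by (simp add: distrib_left)
    then show ?thesis using assms by (simp add: field_simps of_nat_diff)
  qed
qed

lemma upper_bound_zero:
  obtains b C :: real where "b > 0" "C > 0"
    "\<And>n. n \<ge> 1 \<Longrightarrow> approx_number 0 n cusp_operator \<le> C * exp (- b * sqrt (real n))"
proof -
  obtain C0 where C0: "C0 > 0" "\<And>h g. h > 0 \<Longrightarrow> g holomorphic_on unit_disk \<Longrightarrow>
    pull_energy 0 {w. cmod (1 - w) < h} g \<le> ennreal (C0 * h) * energy 0 unit_disk g"
    by (rule pull_energy_tail_zero) (rule that)
  define \<tau> where "\<tau> = (\<lambda>J::nat. C0 * (cusp_const / 2 ^ J))"
  have a: "cusp_const > 0" using cusp_const_bounds by simp
  have lim: "\<tau> \<longlonglongrightarrow> 0" unfolding \<tau>_def by real_asymp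
  have pos: "\<tau> J > 0" for J using C0(1) a by (simp add: \<tau>_def)
  have tail: "pull_energy 0 {w. cmod (1 - w) < cusp_const / 2 ^ J} g \<le> ennreal (\<tau> J) * energy 0 unit_disk g"
    if "g holomorphic_on unit_disk" for J g
    unfolding \<tau>_def by (rule C0(2)[OF _ that]) (use a in simp)
  obtain K :: nat where K: "K > 0" "\<And>n J m. n > 1 + K * (J + 1) * m \<Longrightarrow>
    approx_number 0 n cusp_operator \<le> sqrt (10 * (real K * real (J + 1) * (4 * 14 powr 0 / 4 ^ m) + \<tau> J))"
    by (rule approx_number_upper[OF order_refl pos lim tail]) (assumption, rule that)
  \<comment> \<open>The factor 2 repays rounding sqrt n down to \<open>J\<close>: 2^(-J) <= 2 *
    2^(-y).\<close>
  define Q where "Q = 2 * C0 * cusp_const"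
  have p: "(0::real) < 2" "0 < 1 / (2 * real K)" "0 < Q" "0 < ln (2::real)"
    using K(1) C0(1) a by (auto simp: Q_def)
  obtain b C where bC: "b > 0" "C > 0"
    "\<And>(y::real) (J::nat) (m::nat) t. y > 0 \<Longrightarrow> real (J + 1) \<le> 2 * y \<Longrightarrow> 1 / (2 * real K) * y - 2 \<le> real m \<Longrightarrow>
      t \<le> Q * exp (- ln 2 * y) \<Longrightarrow>
      sqrt (10 * (real K * real (J + 1) * (4 * 14 powr 0 / 4 ^ m) + t)) \<le> C * exp (- b * y)"
    by (rule upper_rate[OF K(1) p, where \<alpha> = 0]) (rule that)
  define C' where "C' = C + sqrt 2 * exp b"
  have "approx_number 0 n cusp_operator \<le> C' * exp (- b * sqrt (real n))" if n: "n \<ge> 1" for n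
  proof (cases "n = 1")
    case True
    have "sqrt 2 \<le> C * exp (- b) + sqrt 2 * (exp b * exp (- b))"
      using bC(2) by (simp add: exp_minus_inverse)
    then show ?thesis using approx_number_1_le[of 0] True by (simp add: C'_def distrib_right mult.assoc)
  next
    case False
    then have n2: "n \<ge> 2" using n by simp
    define y where "y = sqrt (real n)"
    have y: "y \<ge> 1" "y * y = real n" using n by (auto simp: y_def)
    \<comment> \<open>About sqrt n shells, down to size 2^(- sqrt n), leave m of order sqrt n at
      each centre: both error terms then have an exponent of order sqrt n.\<close>
    define J where "J = nat \<lfloor>y\<rfloor>"
    have J: "real J \<le> y" "y < real J + 1" using y unfolding J_def by linarith+
    define d where "d = K * (J + 1)"
    define m where "m = (n - 2) div d"
    have "real K * real (J + 1) \<le> real K * (2 * y)" using J y(1) by (intro mult_left_mono) auto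
    then have d: "d > 0" "real d \<le> 2 * real K * y"
      using K(1) unfolding d_def of_nat_mult by simp_all
    have "approx_number 0 n cusp_operator \<le> sqrt (10 * (real K * real (J + 1) * (4 * 14 powr 0 / 4 ^ m) + \<tau> J))"
      by (rule K(2)) (use quotient_estimates(1)[OF n2 d(1)] in \<open>simp add: m_def d_def\<close>)
    also have "\<dots> \<le> C * exp (- b * y)"
    proof (rule bC(3))
      show "y > 0" "real (J + 1) \<le> 2 * y" using y J by auto
      have "(real n - 2) / (2 * real K * y) \<le> (real n - 2) / real d"
        using n2 d y K by (intro divide_left_mono) auto
      then have "(real n - 2) / (2 * real K * y) - 1 \<le> real m"
        using quotient_estimates(2)[OF n2 d(1)] unfolding m_def by linarith
      moreover have "(real n - 2) / (2 * real K * y) = 1 / (2 * real K) * y - 1 / (real K * y)"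
        using y K(1) by (simp add: y(2)[symmetric] field_simps)
      moreover have "1 / (real K * y) \<le> 1 / (1 * 1)"
        using y K(1) by (intro divide_left_mono mult_mono) auto
      ultimately show "1 / (2 * real K) * y - 2 \<le> real m" by linarith
      have "exp (ln 2 * y) \<le> exp (ln 2 * (real J + 1))" using J by simp
      also have "\<dots> = 2 ^ J * 2" by (simp add: distrib_left exp_add exp_of_nat2_mult)
      finally have "exp (ln 2 * y) \<le> 2 ^ J * 2" .
      then have "Q / (2 ^ J * 2) \<le> Q / exp (ln 2 * y)"
        using C0(1) a by (intro divide_left_mono) (auto simp: Q_def)
      moreover have "\<tau> J = Q / (2 ^ J * 2)" by (simp add: \<tau>_def Q_def)
      moreover have "exp (- ln 2 * y) = 1 / exp (ln 2 * y)" using exp_minus[of "ln 2 * y"] by (simp add: inverse_eq_divide)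
      ultimately show "\<tau> J \<le> Q * exp (- ln 2 * y)" by (simp only: times_divide_eq_right mult_1_right)
    qed
    also have "\<dots> \<le> C' * exp (- b * y)" by (intro mult_right_mono) (auto simp: C'_def)
    finally show ?thesis by (simp add: y_def)
  qed
  moreover have "C' > 0" using bC(2) by (simp add: C'_def add_pos_nonneg)
  ultimately show ?thesis using that bC(1) by blast
qed

lemma upper_bound_positive:
  assumes \<alpha>: "\<alpha> > 0"
  obtains b C :: real where "b > 0" "C > 0"
    "\<And>n. n \<ge> 2 \<Longrightarrow> approx_number \<alpha> n cusp_operator \<le> C * exp (- b * real n / ln (real n))"
proof -
  obtain C0 where C0: "C0 > 0" "\<And>h g. h > 0 \<Longrightarrow> g holomorphic_on unit_disk \<Longrightarrow>
    pull_energy \<alpha> {w. cmod (1 - w) < h} g \<le> ennreal (C0 * exp (- \<alpha> / (4 * h))) * energy \<alpha> unit_disk g"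
    by (rule pull_energy_tail_positive[OF less_imp_le[OF \<alpha>]]) (rule that)
  have a: "1 < cusp_const" "cusp_const < 2" by (fact cusp_const_bounds)+
  define \<tau> where "\<tau> = (\<lambda>J::nat. C0 * exp (- \<alpha> / (4 * (cusp_const / 2 ^ J))))"
  have lim: "\<tau> \<longlonglongrightarrow> 0" unfolding \<tau>_def using \<alpha> a by real_asymp
  have pos: "\<tau> J > 0" for J using C0(1) by (simp add: \<tau>_def)
  have tail: "pull_energy \<alpha> {w. cmod (1 - w) < cusp_const / 2 ^ J} g \<le> ennreal (\<tau> J) * energy \<alpha> unit_disk g"
    if "g holomorphic_on unit_disk" for J g
    unfolding \<tau>_def by (rule C0(2)[OF _ that]) (use a in simp)
  obtain K :: nat where K: "K > 0" "\<And>n J m. n > 1 + K * (J + 1) * m \<Longrightarrow>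
    approx_number \<alpha> n cusp_operator \<le> sqrt (10 * (real K * real (J + 1) * (4 * 14 powr \<alpha> / 4 ^ m) + \<tau> J))"
    by (rule approx_number_upper[OF less_imp_le[OF \<alpha>] pos lim tail]) (assumption, rule that)
  \<comment> \<open>With L = log 2 n >= 1 and J = \<open>nat \<lceil>L\<rceil>\<close>, J + 1 < L +
    2 <= 3 L = D ln n.\<close>
  define D :: real where "D = 3 / ln 2"
  have l2: "ln 2 > (0::real)" by simp
  have D: "D > 0" using l2 by (simp add: D_def)
  have p: "0 < 4 * D" "0 < 1 / (real K * D)" "0 < C0" "0 < \<alpha> * ln 2 / 8"
    using K(1) C0(1) \<alpha> D l2 by auto
  obtain b C where bC: "b > 0" "C > 0"
    "\<And>(y::real) (J::nat) (m::nat) t. y > 0 \<Longrightarrow> real (J + 1) \<le> (4 * D) * y \<Longrightarrow> 1 / (real K * D) * y - 2 \<le> real m \<Longrightarrow>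
      t \<le> C0 * exp (- (\<alpha> * ln 2 / 8) * y) \<Longrightarrow>
      sqrt (10 * (real K * real (J + 1) * (4 * 14 powr \<alpha> / 4 ^ m) + t)) \<le> C * exp (- b * y)"
    by (rule upper_rate[OF K(1) p, where \<alpha> = \<alpha>]) (rule that)
  have "approx_number \<alpha> n cusp_operator \<le> C * exp (- b * real n / ln (real n))" if n: "n \<ge> 2" for n
  proof -
    define y where "y = real n / ln (real n)"
    note y = log_scale_bounds[OF n, folded y_def]
    have l: "ln (real n) > 0" using y(1) l2 by linarith
    define L where "L = log 2 (real n)"
    have L: "L \<ge> 1" "L = ln (real n) / ln 2" using n by (auto simp: L_def log_def)
    \<comment> \<open>Makes the cut-off a / 2^J at most a / n. The tail is then exponentially small
      in n, more than required, and is weakened to the scale y through ln 2 * y <= n.\<close>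
    define J where "J = nat \<lceil>L\<rceil>"
    have J: "L \<le> real J" "real J < L + 1" using L(1) unfolding J_def by linarith+
    have "real n = 2 powr L" using n by (simp add: L_def)
    also have "\<dots> \<le> 2 powr (real J)" using J by simp
    finally have nJ: "real n \<le> 2 ^ J" by (simp add: powr_realpow)
    have "real (J + 1) \<le> 3 * L" using J L(1) by simp
    then have JD: "real (J + 1) \<le> D * ln (real n)" by (simp add: L(2) D_def)
    define d where "d = K * (J + 1)"
    define m where "m = (n - 2) div d"
    have d: "d > 0" "real d \<le> real K * (D * ln (real n))"
      unfolding d_def of_nat_mult using K(1) JD by (auto intro!: mult_left_mono simp del: of_nat_add)
    have "approx_number \<alpha> n cusp_operator \<le> sqrt (10 * (real K * real (J + 1) * (4 * 14 powr \<alpha> / 4 ^ m) + \<tau> J))"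
      by (rule K(2)) (use quotient_estimates(1)[OF n d(1)] in \<open>simp add: m_def d_def\<close>)
    also have "\<dots> \<le> C * exp (- b * y)"
    proof (rule bC(3))
      show "y > 0" by (fact y(2))
      have "D * ln (real n) \<le> D * (4 * y)" using y(3) D by (intro mult_left_mono) auto
      then show "real (J + 1) \<le> (4 * D) * y" using JD by simp
      have "(real n - 2) / (real K * (D * ln (real n))) \<le> (real n - 2) / real d"
        using n d K(1) D l by (intro divide_left_mono) auto
      then have "(real n - 2) / (real K * (D * ln (real n))) - 1 \<le> real m"
        using quotient_estimates(2)[OF n d(1)] unfolding m_def by linarith
      moreover have "(real n - 2) / (real K * (D * ln (real n))) = 1 / (real K * D) * y - 2 / (real K * (D * ln (real n)))"
        by (simp add: y_def diff_divide_distrib)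
      moreover have "2 / (real K * (D * ln (real n))) \<le> 1"
      proof -
        have "D * ln 2 \<le> D * ln (real n)" using y(1) D by (intro mult_left_mono) auto
        then have "3 \<le> D * ln (real n)" by (simp add: D_def)
        then have "1 * 3 \<le> real K * (D * ln (real n))" using K(1) by (intro mult_mono) auto
        then show ?thesis by (subst divide_le_eq_1_pos) linarith+
      qed
      ultimately show "1 / (real K * D) * y - 2 \<le> real m" by linarith
      have "ln 2 * y / 8 \<le> 2 ^ J / 8" using y(5) nJ by linarith
      also have "\<dots> \<le> 2 ^ J / (4 * cusp_const)" using a by (intro divide_left_mono) auto
      finally have "\<alpha> * (ln 2 * y / 8) \<le> \<alpha> * (2 ^ J / (4 * cusp_const))" using \<alpha> by (intro mult_left_mono) auto
      then show "\<tau> J \<le> C0 * exp (- (\<alpha> * ln 2 / 8) * y)"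
        unfolding \<tau>_def using C0(1) by (intro mult_left_mono) (auto simp: mult_ac)
    qed
    finally show ?thesis by (simp add: y_def)
  qed
  then show ?thesis using that bC by blast
qed

text \<open>From exp x >= 1 + x. It turns a ratio q = exp (-x) of the nodes into a bound for the
  exponent 16 / (1 - q).\<close>

lemma inverse_one_minus_exp_le:
  assumes "x > (0::real)"
  shows "1 / (1 - exp (- x)) \<le> 1 + 1 / x"
proof -
  have "exp (- x) = 1 / exp x" by (simp add: exp_minus inverse_eq_divide)
  also have "\<dots> \<le> 1 / (1 + x)" using assms exp_ge_add_one_self[of x] by (intro divide_left_mono) auto
  finally have "x / (1 + x) \<le> 1 - exp (- x)" using assms by (simp add: field_simps)
  then have "1 / (1 - exp (- x)) \<le> 1 / (x / (1 + x))" using assms by (intro divide_left_mono) auto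
  then show ?thesis using assms by (simp add: add_divide_distrib)
qed

lemma lower_bound_zero:
  obtains b c :: real where "c > 0" "b > 0"
    "\<And>n. n \<ge> 1 \<Longrightarrow> c * exp (- b * sqrt (real n)) \<le> approx_number 0 n cusp_operator"
proof -
  obtain c where c: "c > 0" "\<And>n q. n \<ge> 1 \<Longrightarrow> 0 < q \<Longrightarrow> q < 1 \<Longrightarrow>
    c * (q ^ n)\<^sup>2 / (real n)\<^sup>2 * exp (- (16 / (1 - q)) - 2 * 0 / q ^ n) \<le> approx_number 0 n cusp_operator"
    by (rule approx_number_lower[OF order_refl]) (rule that)
  \<comment> \<open>22 = 2 + 4 + 16, from (q^n)^2, from 1 / n^2 and from 16 / (1 - q) <= 16 + 16 y,
    whose constant part is the factor exp (-16).\<close>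
  have "(c * exp (- 16)) * exp (- 22 * sqrt (real n)) \<le> approx_number 0 n cusp_operator" if n: "n \<ge> 1" for n
  proof -
    define y where "y = sqrt (real n)"
    have y: "y \<ge> 1" "y\<^sup>2 = real n" using n by (auto simp: y_def)
    \<comment> \<open>Gives q^n = exp (- sqrt n) and 1 / (1 - q) <= 1 + sqrt n.\<close>
    define q where "q = exp (- (1 / y))"
    have q: "0 < q" "q < 1" using y by (auto simp: q_def)
    have "q ^ n = exp (real n * - (1 / y))" unfolding q_def by (rule exp_of_nat_mult[symmetric])
    also have "real n * - (1 / y) = - y" using y by (simp add: y(2)[symmetric] power2_eq_square)
    finally have "(q ^ n)\<^sup>2 = exp (- y) * exp (- y)" by (simp add: power2_eq_square)
    then have qn: "(q ^ n)\<^sup>2 = exp (- 2 * y)" by (simp add: exp_add[symmetric])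
    have "y \<le> exp y" using exp_ge_add_one_self[of y] by linarith
    then have "y ^ 4 \<le> exp y ^ 4" using y by (intro power_mono) auto
    also have "exp y ^ 4 = exp (4 * y)" using exp_of_nat_mult[of 4 y] by simp
    finally have "(real n)\<^sup>2 \<le> exp (4 * y)" by (simp add: y(2)[symmetric] power_mult[symmetric])
    then have n2: "exp (- 4 * y) \<le> 1 / (real n)\<^sup>2" using n
      by (simp add: exp_minus inverse_eq_divide frac_le)
    have "1 / (1 - q) \<le> 1 + y" unfolding q_def using inverse_one_minus_exp_le[of "1 / y"] y by simp
    then have e: "exp (- 16 - 16 * y) \<le> exp (- (16 / (1 - q)) - 2 * 0 / q ^ n)" by simp
    have "(c * exp (- 16)) * exp (- 22 * y) = c * exp (- 2 * y) * exp (- 4 * y) * exp (- 16 - 16 * y)"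
      by (simp add: mult.assoc exp_add[symmetric])
    also have "\<dots> \<le> c * (q ^ n)\<^sup>2 * (1 / (real n)\<^sup>2) * exp (- (16 / (1 - q)) - 2 * 0 / q ^ n)"
      unfolding qn using n2 e c(1) by (intro mult_mono mult_left_mono) auto
    also have "\<dots> \<le> approx_number 0 n cusp_operator" using c(2)[OF n q] by simp
    finally show ?thesis by (simp add: y_def)
  qed
  then show ?thesis using that[of "c * exp (- 16)" 22] c(1) by simp
qed

lemma lower_bound_positive:
  assumes \<alpha>: "\<alpha> > 0"
  obtains b c :: real where "c > 0" "b > 0"
    "\<And>n. n \<ge> 2 \<Longrightarrow> c * exp (- b * real n / ln (real n)) \<le> approx_number \<alpha> n cusp_operator"
proof -
  obtain c where c: "c > 0" "\<And>n q. n \<ge> 1 \<Longrightarrow> 0 < q \<Longrightarrow> q < 1 \<Longrightarrow>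
    c * (q ^ n)\<^sup>2 / (real n)\<^sup>2 * exp (- (16 / (1 - q)) - 2 * \<alpha> / q ^ n) \<le> approx_number \<alpha> n cusp_operator"
    by (rule approx_number_lower[OF less_imp_le[OF \<alpha>]]) (rule that)
  \<comment> \<open>12 from (q^n)^2 / n^2 = n^(-3) with ln n <= 4 y, 32 from 16 / (1 - q) <= 16 + 32
    y, and 4 \<alpha> from the point evaluations.\<close>
  define b where "b = 44 + 4 * \<alpha>"
  have "(c * exp (- 16)) * exp (- b * real n / ln (real n)) \<le> approx_number \<alpha> n cusp_operator" if n: "n \<ge> 2" for n
  proof -
    define y where "y = real n / ln (real n)"
    note y = log_scale_bounds[OF n, folded y_def]
    have l: "ln (real n) > 0" using n by simp
    \<comment> \<open>Gives q^n = 1 / sqrt n. With q^n = 1 / n the term 2 \<alpha> / q^n would be of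
      order n, beyond the scale n / ln n, whereas sqrt n stays below it.\<close>
    define q where "q = exp (- (1 / (2 * y)))"
    have q: "0 < q" "q < 1" using y by (auto simp: q_def)
    have "q ^ n = exp (real n * - (1 / (2 * y)))" unfolding q_def by (rule exp_of_nat_mult[symmetric])
    also have "real n * - (1 / (2 * y)) = - (ln (real n) / 2)" using n l by (simp add: y_def)
    also have "\<dots> = - ln (sqrt (real n))" using n by (simp add: ln_sqrt)
    also have "exp (- ln (sqrt (real n))) = 1 / sqrt (real n)" using n by (simp add: exp_minus inverse_eq_divide)
    finally have qn: "q ^ n = 1 / sqrt (real n)" .
    then have qn2: "(q ^ n)\<^sup>2 = 1 / real n" by (simp add: power_divide)
    have "exp (- 12 * y) \<le> exp (- (3 * ln (real n)))" using y(3) by simp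
    also have "exp (- (3 * ln (real n))) = 1 / exp (3 * ln (real n))" by (simp add: exp_minus inverse_eq_divide)
    also have "exp (3 * ln (real n)) = (real n) ^ 3" using exp_of_nat_mult[of 3 "ln (real n)"] n by simp
    finally have n3: "exp (- 12 * y) \<le> (q ^ n)\<^sup>2 / (real n)\<^sup>2"
      unfolding qn2 by (simp add: power3_eq_cube power2_eq_square mult.assoc)
    have "1 / (1 - q) \<le> 1 + 2 * y" unfolding q_def using inverse_one_minus_exp_le[of "1 / (2 * y)"] y(2) by simp
    moreover have "2 * \<alpha> / q ^ n \<le> 4 * \<alpha> * y"
    proof -
      have "2 * \<alpha> * sqrt (real n) \<le> 2 * \<alpha> * (2 * y)" using y(4) \<alpha> by (intro mult_left_mono) auto
      then show ?thesis by (simp add: qn)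
    qed
    ultimately have e: "exp (- 16 - 32 * y - 4 * \<alpha> * y) \<le> exp (- (16 / (1 - q)) - 2 * \<alpha> / q ^ n)" by simp
    have "(c * exp (- 16)) * exp (- b * y) = c * exp (- 12 * y) * exp (- 16 - 32 * y - 4 * \<alpha> * y)"
      by (simp add: mult.assoc exp_add[symmetric] b_def algebra_simps)
    also have "\<dots> \<le> c * ((q ^ n)\<^sup>2 / (real n)\<^sup>2) * exp (- (16 / (1 - q)) - 2 * \<alpha> / q ^ n)"
      using n3 e c(1) by (intro mult_mono mult_left_mono) auto
    also have "\<dots> \<le> approx_number \<alpha> n cusp_operator" using c(2)[OF _ q, of n] n by simp
    finally show ?thesis by (simp add: y_def)
  qed
  moreover have "c * exp (- 16) > 0" "b > 0" using c(1) \<alpha> by (auto simp: b_def)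
  ultimately show ?thesis using that by blast
qed

lemma exp_rate_mono:
  fixes y :: real
  assumes "b \<le> b'" "y \<ge> 0" "c > 0" "c * exp (- b * y) \<le> A"
  shows "c * exp (- b' * y) \<le> A"
proof -
  have "exp (- b' * y) \<le> exp (- b * y)" using assms(1,2) by (simp add: mult_right_mono)
  then have "c * exp (- b' * y) \<le> c * exp (- b * y)" using assms(3) by (intro mult_left_mono) auto
  then show ?thesis using assms(4) by linarith
qed

theorem theorem5p3:
  fixes \<alpha> :: real
  assumes "\<alpha> \<ge> 0"
  shows "\<exists>b' b c C :: real. b' > b \<and> b > 0 \<and> c > 0 \<and> C > 0 \<and>
    (\<alpha> > 0 \<longrightarrow> (\<forall>n::nat. n \<ge> 2 \<longrightarrow>
       c * exp (- b' * real n / ln (real n))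
         \<le> approx_number \<alpha> n (composition_operator cusp_map) \<and>
       approx_number \<alpha> n (composition_operator cusp_map)
         \<le> C * exp (- b * real n / ln (real n)))) \<and>
    (\<alpha> = 0 \<longrightarrow> (\<forall>n::nat. n \<ge> 1 \<longrightarrow>
       c * exp (- b' * sqrt (real n))
         \<le> approx_number \<alpha> n (composition_operator cusp_map) \<and>
       approx_number \<alpha> n (composition_operator cusp_map)
         \<le> C * exp (- b * sqrt (real n))))"
proof (cases "\<alpha> = 0")
  case True
  obtain b C where u: "b > 0" "C > 0"
    "\<And>n. n \<ge> 1 \<Longrightarrow> approx_number 0 n cusp_operator \<le> C * exp (- b * sqrt (real n))"
    by (rule upper_bound_zero) (rule that)
  obtain b0 c where l: "c > 0" "b0 > 0"
    "\<And>n. n \<ge> 1 \<Longrightarrow> c * exp (- b0 * sqrt (real n)) \<le> approx_number 0 n cusp_operator"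
    by (rule lower_bound_zero) (rule that)
  \<comment> \<open>The strict inequality b' > b is secured by adding b to the exponent of the lower
    bound, without comparing the two rates.\<close>
  have "c * exp (- (b0 + b) * sqrt (real n)) \<le> approx_number 0 n cusp_operator" if "n \<ge> 1" for n
    by (rule exp_rate_mono[OF _ _ l(1) l(3)[OF that]]) (use u in auto)
  then show ?thesis
    using True u l by (intro exI[of _ "b0 + b"] exI[of _ b] exI[of _ c] exI[of _ C]) auto
next
  case False
  then have \<alpha>: "\<alpha> > 0" using assms by simp
  obtain b C where u: "b > 0" "C > 0"
    "\<And>n. n \<ge> 2 \<Longrightarrow> approx_number \<alpha> n cusp_operator \<le> C * exp (- b * real n / ln (real n))"
    by (rule upper_bound_positive[OF \<alpha>]) (rule that)
  obtain b0 c where l: "c > 0" "b0 > 0"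
    "\<And>n. n \<ge> 2 \<Longrightarrow> c * exp (- b0 * real n / ln (real n)) \<le> approx_number \<alpha> n cusp_operator"
    by (rule lower_bound_positive[OF \<alpha>]) (rule that)
  have "c * exp (- (b0 + b) * real n / ln (real n)) \<le> approx_number \<alpha> n cusp_operator" if "n \<ge> 2" for n
  proof -
    have "c * exp (- (b0 + b) * (real n / ln (real n))) \<le> approx_number \<alpha> n cusp_operator"
    proof (rule exp_rate_mono[OF _ _ l(1)])
      show "c * exp (- b0 * (real n / ln (real n))) \<le> approx_number \<alpha> n cusp_operator"
        using l(3)[OF that] by simp
    qed (use u that in auto)
    then show ?thesis by simp
  qed
  then show ?thesis
    using False u l by (intro exI[of _ "b0 + b"] exI[of _ b] exI[of _ c] exI[of _ C]) auto
qed

end
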